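(* Let $a<b$ be real numbers, let $d\ge 1$ be an integer, let $\alpha,p$ be real numbers with $0<\frac1p<\alpha<1$, and let $L:\mathbb{R}^d\times\mathbb{R}^d\times[a,b]\to\mathbb{R}$, $(x,y,t)\mapsto L(x,y,t)$, be of class $C^1$. Suppose that: (1) there exist $0\le d_1\le p$ and $r_1,s_1\in C(\mathbb{R}^d\times[a,b],\mathbb{R}^+)$ such that for all $(x,y,t)\in\mathbb{R}^d\times\mathbb{R}^d\times[a,b]$, $|L(x,y,t)-L(x,0,t)|\le r_1(x,t)\|y\|^{d_1}+s_1(x,t)$; (2) there exist $0\le d_2\le p$ and $r_2,s_2\in C(\mathbb{R}^d\times[a,b],\mathbb{R}^+)$ such that for all $(x,y,t)\in\mathbb{R}^d\times\mathbb{R}^d\times[a,b]$, $\left\|\frac{\partial L}{\partial x}(x,y,t)\right\|\le r_2(x,t)\|y\|^{d_2}+s_2(x,t)$; (3) there exist $0\le d_3\le p-1$ and $r_3,s_3\in C(\mathbb{R}^d\times[a,b],\mathbb{R}^+)$ such that for all $(x,y,t)\in\mathbb{R}^d\times\mathbb{R}^d\times[a,b]$, $\left\|\frac{\partial L}{\partial y}(x,y,t)\right\|\le r_3(x,t)\|y\|^{d_3}+s_3(x,t)$; (4) there exist $\gamma>0$, $1\le d_4<p$, $c_1\in C(\mathbb{R}^d\times[a,b],[\gamma,\infty))$ and $c_2,c_3\in C([a,b],\mathbb{R})$ such that for all $(x,y,t)\in\mathbb{R}^d\times\mathbb{R}^d\times[a,b]$, $L(x,y,t)\ge c_1(x,t)\|y\|^p+c_2(t)\|x\|^{d_4}+c_3(t)$;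 (5) for every $t\in[a,b]$, the map $L(\cdot,\cdot,t)$ is convex on $\mathbb{R}^d\times\mathbb{R}^d$. Then the fractional Euler-Lagrange equation $$\frac{\partial L}{\partial x}(u,D^\alpha_-u,t)+D^\alpha_+\left(\frac{\partial L}{\partial y}(u,D^\alpha_-u,t)\right)=0$$ admits a weak solution, i.e. there exists $u\in C([a,b];\mathbb{R}^d)$ satisfying this equation almost everywhere on $[a,b]$.
   Context: $\|\cdot\|$ is the Euclidean norm on $\mathbb{R}^d$; $\mathbb{R}^+=[0,\infty)$. $\frac{\partial L}{\partial x}$ and $\frac{\partial L}{\partial y}$ are the gradients of $L$ with respect to its first and second variables. For $\beta>0$ and $f$ integrable on $(a,b)$ with values in $\mathbb{R}^d$, the left and right Riemann-Liouville fractional integrals are, for a.e. $t$, $$I^\beta_-f(t)=\frac{1}{\Gamma(\beta)}\int_a^t(t-\xi)^{\beta-1}f(\xi)\,d\xi,\qquad I^\beta_+f(t)=\frac{1}{\Gamma(\beta)}\int_t^b(\xi-t)^{\beta-1}f(\xi)\,d\xi.$$ For $0<\alpha<1$, the left and right Riemann-Liouville fractional derivatives are $D^\alpha_-f=\frac{d}{dt}\big(I^{1-\alpha}_-f\big)$ and $D^\alpha_+f=-\frac{d}{dt}\big(I^{1-\alpha}_+f\big)$. Equalities between functions are understood almost everywhere on $(a,b)$; in particular, if a fractional integral coincides a.e. with an absolutely continuous function, its derivative is the a.e. derivative of that absolutely continuous representative. *)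

theory Defs
  imports "HOL-Analysis.Analysis"
begin

text \<open>A real power with the convention that anything to the power 0 is 1; the library has
  \<open>0 powr 0 = 0\<close>.\<close>

definition rpow :: "real \<Rightarrow> real \<Rightarrow> real" where
  "rpow x q = (if q = 0 then 1 else x powr q)"

text \<open>Derivatives are taken within \<open>S\<close>, hence one-sided in the directions where \<open>S\<close> has a
  boundary. Meant for sets on which such derivatives are unique.\<close>

definition C1_on :: "'a::real_normed_vector set \<Rightarrow> ('a \<Rightarrow> 'b::real_normed_vector) \<Rightarrow> bool" where
  "C1_on S f \<longleftrightarrow> (\<exists>f'. (\<forall>z\<in>S. (f has_derivative blinfun_apply (f' z)) (at z within S))
                     \<and> continuous_on S f')"

definition grad :: "('a::real_inner \<Rightarrow> real) \<Rightarrow> 'a \<Rightarrow> 'a" where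
  "grad f x = (THE g. GDERIV f x :> g)"

lemma grad_eqI: "grad f x = g" if "GDERIV f x :> g"
proof -
  have "h = g" if h: "GDERIV f x :> h" for h
  proof -
    have "(\<lambda>y. inner y h) = (\<lambda>y. inner y g)"
      using h \<open>GDERIV f x :> g\<close> unfolding gderiv_def by (rule has_derivative_unique)
    then have "\<forall>y. inner y h = inner y g" by (simp add: fun_eq_iff)
    then have "inner (h - g) (h - g) = 0" by (simp add: inner_diff_right)
    then show ?thesis by simp
  qed
  with that show ?thesis unfolding grad_def by blast
qed

definition grad_x :: "('a::real_inner \<times> 'a \<times> real \<Rightarrow> real) \<Rightarrow> 'a \<Rightarrow> 'a \<Rightarrow> real \<Rightarrow> 'a" where
  "grad_x L x y t = grad (\<lambda>\<xi>. L (\<xi>, y, t)) x"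

definition grad_y :: "('a::real_inner \<times> 'a \<times> real \<Rightarrow> real) \<Rightarrow> 'a \<Rightarrow> 'a \<Rightarrow> real \<Rightarrow> 'a" where
  "grad_y L x y t = grad (\<lambda>\<eta>. L (x, \<eta>, t)) y"

definition abs_continuous :: "real \<Rightarrow> real \<Rightarrow> (real \<Rightarrow> 'a::real_normed_vector) \<Rightarrow> bool" where
  "abs_continuous a b f \<longleftrightarrow>
     (\<forall>\<epsilon>>0. \<exists>\<delta>>0. \<forall>(n::nat) l r.
        (\<forall>i<n. a \<le> l i \<and> l i \<le> r i \<and> r i \<le> b) \<and>
        disjoint_family_on (\<lambda>i. {l i<..<r i}) {..<n} \<and>
        (\<Sum>i<n. r i - l i) < \<delta> \<longrightarrow>
        (\<Sum>i<n. norm (f (r i) - f (l i))) < \<epsilon>)"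

text \<open>\<open>g\<close> is the derivative of \<open>f\<close> on \<open>(a, b)\<close>, both being considered up to null sets: \<open>f\<close> has an
  absolutely continuous representative, whose derivative is \<open>g\<close> almost everywhere.\<close>

definition has_ae_derivative ::
  "real \<Rightarrow> real \<Rightarrow> (real \<Rightarrow> 'a::real_normed_vector) \<Rightarrow> (real \<Rightarrow> 'a) \<Rightarrow> bool" where
  "has_ae_derivative a b f g \<longleftrightarrow>
     (\<exists>F. abs_continuous a b F \<and>
          (AE t\<in>{a<..<b} in lebesgue. F t = f t) \<and>
          (AE t\<in>{a<..<b} in lebesgue. (F has_vector_derivative g t) (at t)))"

text \<open>For \<open>f\<close> integrable on \<open>(a, b)\<close> the two integrals below exist for almost every \<open>t\<close>; elsewhere
  the Bochner integral has the default value 0.\<close>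

definition RL_int_left ::
  "real \<Rightarrow> real \<Rightarrow> (real \<Rightarrow> 'a::{banach, second_countable_topology}) \<Rightarrow> real \<Rightarrow> 'a" where
  "RL_int_left a \<beta> f t =
     (1 / Gamma \<beta>) *\<^sub>R (LINT \<xi>:{a<..<t}|lebesgue. (t - \<xi>) powr (\<beta> - 1) *\<^sub>R f \<xi>)"

definition RL_int_right ::
  "real \<Rightarrow> real \<Rightarrow> (real \<Rightarrow> 'a::{banach, second_countable_topology}) \<Rightarrow> real \<Rightarrow> 'a" where
  "RL_int_right b \<beta> f t =
     (1 / Gamma \<beta>) *\<^sub>R (LINT \<xi>:{t<..<b}|lebesgue. (\<xi> - t) powr (\<beta> - 1) *\<^sub>R f \<xi>)"

definition has_RL_deriv_left ::
  "real \<Rightarrow> real \<Rightarrow> real \<Rightarrow> (real \<Rightarrow> 'a::{banach, second_countable_topology}) \<Rightarrow> (real \<Rightarrow> 'a) \<Rightarrow> bool" where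
  "has_RL_deriv_left a b \<alpha> f g \<longleftrightarrow>
     set_integrable lebesgue {a<..<b} f \<and>
     has_ae_derivative a b (RL_int_left a (1 - \<alpha>) f) g"

definition has_RL_deriv_right ::
  "real \<Rightarrow> real \<Rightarrow> real \<Rightarrow> (real \<Rightarrow> 'a::{banach, second_countable_topology}) \<Rightarrow> (real \<Rightarrow> 'a) \<Rightarrow> bool" where
  "has_RL_deriv_right a b \<alpha> f g \<longleftrightarrow>
     set_integrable lebesgue {a<..<b} f \<and>
     has_ae_derivative a b (RL_int_right b (1 - \<alpha>) f) (\<lambda>t. - g t)"

text \<open>\<open>v\<close> is the left derivative of \<open>u\<close>, and \<open>w\<close> the right derivative of the momentum. Both are
  determined by \<open>u\<close> up to null sets.\<close>

definition weak_solution ::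
  "real \<Rightarrow> real \<Rightarrow> real \<Rightarrow> ('a::euclidean_space \<times> 'a \<times> real \<Rightarrow> real) \<Rightarrow> (real \<Rightarrow> 'a) \<Rightarrow> bool" where
  "weak_solution a b \<alpha> L u \<longleftrightarrow>
     continuous_on {a..b} u \<and>
     (\<exists>v w. has_RL_deriv_left a b \<alpha> u v \<and>
            has_RL_deriv_right a b \<alpha> (\<lambda>t. grad_y L (u t) (v t) t) w \<and>
            (AE t\<in>{a..b} in lebesgue. grad_x L (u t) (v t) t + w t = 0))"

end

theory Submission
  imports Defs
begin

text \<open>
  Every \<open>v \<in> L\<^sup>p(a, b)\<close> determines a trajectory \<open>u = I v\<close>, the left fractional integral of order
  \<open>\<alpha>\<close>, whose left derivative of order \<open>\<alpha>\<close> is \<open>v\<close>. The solution is the trajectory of a minimizer of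
  the action \<open>J(v) = \<integral> L(I v, v, t) dt\<close>.

  The condition \<open>1/p < \<alpha>\<close> says exactly that the kernel \<open>s powr (\<alpha> - 1)\<close> lies in the dual space
  \<open>L\<^sup>q\<close> on bounded intervals. Hence \<open>u\<close> is continuous (\<open>continuous_on_I\<alpha>\<close>) and the \<open>p\<close>-th power of
  \<open>u\<close> is bounded by \<open>1 + \<integral> norm v powr p\<close> up to a constant (\<open>norm_I\<alpha>_powr_le\<close>). The coercivity
  hypothesis then makes \<open>J\<close> control \<open>\<integral> norm v powr p\<close> (\<open>action_coercive\<close>), and \<open>J\<close> is convex
  because \<open>L\<close> is.

  A minimizer is usually obtained from weak compactness and weak lower semicontinuity. Convexity
  permits a more elementary route: the sets where \<open>J \<le> inf J + 1/n\<close> are nested, closed under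
  midpoints and bounded in \<open>L\<^sup>p\<close>. Choosing in each of them a function that almost minimizes
  the integral of the strictly convex function \<open>sqrt (1 + x\<^sup>2)\<close> gives a sequence that is Cauchy in
  \<open>L\<^sup>1\<close>, hence has a subsequence converging almost everywhere (\<open>AE_convergent_selection\<close>). Along
  it the trajectories converge pointwise (\<open>I\<alpha>_tendsto\<close>), and Fatou's lemma shows that the limit
  is a minimizer (\<open>minimizer_exists\<close>).

  For a bounded direction \<open>h\<close> the difference quotients of \<open>J\<close> at the minimizer are dominated by
  convexity, so \<open>\<integral> L\<^sub>x \<bullet> I h + L\<^sub>y \<bullet> h = 0\<close>. Fubini's theorem moves the fractional integral onto
  \<open>L\<^sub>x\<close> as a right one (\<open>frac_int_by_parts\<close>), and since \<open>h\<close> is arbitrary \<open>L\<^sub>y\<close> equals minus the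
  right fractional integral of \<open>L\<^sub>x\<close> almost everywhere (\<open>Euler_Lagrange_solution\<close>). Applying the
  right integral of order \<open>1 - \<alpha>\<close>, the semigroup law (\<open>frac_int_semigroup\<close>, a Beta integral) leaves
  minus the integral of \<open>L\<^sub>x\<close> from \<open>t\<close> to \<open>b\<close>. This is absolutely continuous, and by Lebesgue's
  differentiation theorem (\<open>AE_indefinite_integral_has_vector_derivative\<close>) its derivative is
  \<open>L\<^sub>x\<close> almost everywhere, which is the Euler-Lagrange equation.
\<close>

section \<open>Lebesgue points\<close>

lemma set_integrable_const_Ioo:
  "set_integrable lborel {l<..<r::real} (\<lambda>s. c :: 'e::{banach, second_countable_topology})"
proof -
  have "emeasure lborel {l<..<r} < \<infinity>" by (cases "l \<le> r") auto
  then show ?thesis unfolding set_integrable_def by (intro integrable_scaleR_left integrable_real_indicator) auto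
qed

text \<open>The weak type estimate for the uncentred maximal function. By Vitali's covering lemma, the
  intervals on which the mean of \<open>norm k\<close> exceeds \<open>c\<close> are covered by the fivefold enlargements of
  a disjoint subfamily, whose total length is at most the integral of \<open>norm k\<close> divided by \<open>c\<close>.\<close>

lemma maximal_inequality:
  fixes k :: "real \<Rightarrow> 'e::{banach, second_countable_topology}"
  assumes k: "integrable lborel k" and "c > 0"
  obtains E where "E \<in> lmeasurable" "measure lebesgue E \<le> 5 / c * (LINT s|lborel. norm (k s))"
    "\<And>l r x. l < x \<Longrightarrow> x < r \<Longrightarrow> x \<notin> E \<Longrightarrow> (LINT s:{l<..<r}|lborel. norm (k s)) \<le> c * (r - l)"
proof -
  define N where "N = (LINT s|lborel. norm (k s))"
  have kn: "integrable lborel (\<lambda>s. norm (k s))" using k by simp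
  have si: "set_integrable lborel A (\<lambda>s. norm (k s))" if "A \<in> sets borel" for A
    using kn that unfolding set_integrable_def by (intro integrable_mult_indicator) auto
  have leN: "(LINT s:A|lborel. norm (k s)) \<le> N" if "A \<in> sets borel" for A
    unfolding N_def set_lebesgue_integral_def using kn si[OF that]
    by (intro integral_mono) (auto simp: set_integrable_def indicator_def)
  have N0: "N \<ge> 0" unfolding N_def by simp
  define K where "K = {(l, r). l < r \<and> c * (r - l) < (LINT s:{l<..<r}|lborel. norm (k s))}"
  define m where "m = (\<lambda>(l, r). (l + r) / 2 :: real)"
  define h where "h = (\<lambda>(l, r). (r - l) / 2 :: real)"
  have ball: "ball (m i) (h i) = {fst i<..<snd i}" for i
    by (cases i) (auto simp: m_def h_def ball_eq_greaterThanLessThan field_simps)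
  have hB: "0 < h i \<and> h i \<le> N / c" if "i \<in> K" for i
  proof -
    obtain l r where i: "i = (l, r)" by (cases i)
    have "l < r" "c * (r - l) < (LINT s:{l<..<r}|lborel. norm (k s))"
      using that by (auto simp: K_def i)
    moreover from this leN[of "{l<..<r}"] have "c * (r - l) \<le> N" by simp
    ultimately show ?thesis using \<open>c > 0\<close> N0 by (auto simp: h_def i field_simps)
  qed
  obtain C where C: "countable C" "C \<subseteq> K"
    "pairwise (\<lambda>i j. disjnt (ball (m i) (h i)) (ball (m j) (h j))) C"
    "(\<Union>i\<in>K. ball (m i) (h i)) \<subseteq> (\<Union>i\<in>C. ball (m i) (5 * h i))"
    by (rule Vitali_covering_lemma_balls[OF order_refl hB])
  define E where "E = (\<Union>i\<in>C. ball (m i) (5 * h i))"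
  have bound: "measure lebesgue (\<Union>i\<in>D. ball (m i) (5 * h i)) \<le> 5 / c * N"
    if D: "D \<subseteq> C" "finite D" for D
  proof -
    have "measure lebesgue (\<Union>i\<in>D. ball (m i) (5 * h i))
        \<le> (\<Sum>i\<in>D. measure lebesgue (ball (m i) (5 * h i)))"
      using D by (intro measure_UNION_le) auto
    also have "\<dots> \<le> (\<Sum>i\<in>D. 5 / c * (LINT s:{fst i<..<snd i}|lborel. norm (k s)))"
    proof (rule sum_mono)
      fix i assume "i \<in> D"
      then have "i \<in> K" using D C by auto
      then have "c * (snd i - fst i) < (LINT s:{fst i<..<snd i}|lborel. norm (k s))"
        by (auto simp: K_def)
      then have "5 * (2 * h i) \<le> 5 / c * (LINT s:{fst i<..<snd i}|lborel. norm (k s))"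
        using \<open>c > 0\<close> by (auto simp: h_def field_simps split: prod.splits)
      moreover have "measure lebesgue (ball (m i) (5 * h i)) = 5 * (2 * h i)"
        using hB[OF \<open>i \<in> K\<close>] by (simp add: ball_eq_greaterThanLessThan)
      ultimately show "measure lebesgue (ball (m i) (5 * h i))
          \<le> 5 / c * (LINT s:{fst i<..<snd i}|lborel. norm (k s))" by simp
    qed
    also have "\<dots> = 5 / c * (LINT s:(\<Union>i\<in>D. {fst i<..<snd i})|lborel. norm (k s))"
    proof -
      have "(LINT s:(\<Union>i\<in>D. {fst i<..<snd i})|lborel. norm (k s))
          = (\<Sum>i\<in>D. LINT s:{fst i<..<snd i}|lborel. norm (k s))"
      proof (rule set_integral_finite_Union)
        show "disjoint_family_on (\<lambda>i. {fst i<..<snd i}) D"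
          using D C(3) unfolding ball pairwise_def disjnt_def disjoint_family_on_def by blast
      qed (use D in \<open>auto intro: si\<close>)
      then show ?thesis by (simp add: sum_distrib_left)
    qed
    also have "\<dots> \<le> 5 / c * N"
    proof (rule mult_left_mono[OF leN])
      show "(\<Union>i\<in>D. {fst i<..<snd i}) \<in> sets borel" by (intro borel_open open_UN) auto
    qed (use \<open>c > 0\<close> in simp)
    finally show ?thesis .
  qed
  show ?thesis
  proof
    have f: "ball (m i) (5 * h i) \<in> lmeasurable" for i by simp
    show "E \<in> lmeasurable" unfolding E_def
      by (rule fmeasurable_UN_bound[OF C(1) f bound])
    show "measure lebesgue E \<le> 5 / c * (LINT s|lborel. norm (k s))"
      unfolding E_def using measure_UN_bound[OF C(1) f bound] by (simp add: N_def)
    fix l r x :: real assume x: "l < x" "x < r" "x \<notin> E"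
    have "(l, r) \<notin> K"
    proof
      assume "(l, r) \<in> K"
      moreover have "x \<in> ball (m (l, r)) (h (l, r))" using x by (simp add: ball)
      ultimately show False using C(4) x unfolding E_def by blast
    qed
    then show "(LINT s:{l<..<r}|lborel. norm (k s)) \<le> c * (r - l)"
      using x by (auto simp: K_def not_less)
  qed
qed

text \<open>A measurable function is an almost everywhere limit of continuous functions. Truncating the
  values radially at a level \<open>R\<close> is continuous and costs little in \<open>L\<^sup>1\<close>, and after truncation
  bounded convergence applies.\<close>

lemma L1_approx_by_continuous:
  fixes g :: "real \<Rightarrow> 'e::euclidean_space"
  assumes g: "set_integrable lborel {a<..<b} g" and gm[measurable]: "g \<in> borel_measurable borel"
    and "e > 0"
  obtains \<phi> where "continuous_on UNIV \<phi>" "set_integrable lborel {a<..<b} \<phi>"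
    "(LINT s:{a<..<b}|lborel. norm (g s - \<phi> s)) < e"
proof -
\<comment> \<open>radial retraction onto the ball of radius \<open>R\<close>\<close>
  define T where "T = (\<lambda>R (z::'e). (R / max R (norm z)) *\<^sub>R z)"
  have T_cont: "continuous_on UNIV (T R)" if "R > 0" for R
    unfolding T_def using that by (intro continuous_intros) (auto simp: max_def)
  have T_le: "norm (T R z) \<le> norm z" if "R > 0" for R z
    using that by (auto simp: T_def max_def field_simps mult_le_cancel_left)
  have T_R: "norm (T R z) \<le> R" if "R > 0" for R z
    using that by (auto simp: T_def max_def field_simps)
  have T_meas[measurable]: "T R \<in> borel_measurable borel" for R unfolding T_def by measurable
  define I where "I = (indicator {a<..<b} :: real \<Rightarrow> real)"
  have Im[measurable]: "I \<in> borel_measurable borel" unfolding I_def by measurable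
  have I01: "0 \<le> I s" "I s \<le> 1" for s by (auto simp: I_def indicator_def)
  have gi: "integrable lborel (\<lambda>s. I s *\<^sub>R g s)" using g by (simp add: set_integrable_def I_def)
  have Ii: "integrable lborel I"
    using set_integrable_const_Ioo[of a b "1::real"] by (simp add: set_integrable_def I_def)
  have "(\<lambda>n. LINT s|lborel. I s * norm (g s - T (real (Suc n)) (g s))) \<longlonglongrightarrow> (LINT s|(lborel::real measure). 0)"
  proof (rule integral_dominated_convergence[where w = "\<lambda>s. 2 * norm (I s *\<^sub>R g s)"])
    show "AE s in lborel. (\<lambda>n. I s * norm (g s - T (real (Suc n)) (g s))) \<longlonglongrightarrow> 0"
    proof (intro AE_I2 tendsto_eventually)
      fix s
      obtain N where N: "norm (g s) \<le> real N" using real_arch_simple by blast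
      have "T (real (Suc n)) (g s) = g s" if "n \<ge> N" for n
        using N that by (auto simp: T_def max_def)
      then show "\<forall>\<^sub>F n in sequentially. I s * norm (g s - T (real (Suc n)) (g s)) = 0"
        unfolding eventually_sequentially by (intro exI[of _ N]) simp
    qed
    show "AE s in lborel. norm (I s * norm (g s - T (real (Suc n)) (g s))) \<le> 2 * norm (I s *\<^sub>R g s)" for n
    proof (intro AE_I2)
      fix s
      have "norm (g s - T (real (Suc n)) (g s)) \<le> 2 * norm (g s)"
        using norm_triangle_ineq4[of "g s" "T (real (Suc n)) (g s)"] T_le[of "real (Suc n)" "g s"] by simp
      then show "norm (I s * norm (g s - T (real (Suc n)) (g s))) \<le> 2 * norm (I s *\<^sub>R g s)"
        using I01[of s] by (simp add: abs_mult mult_left_mono mult.left_commute)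
    qed
  qed (use integrable_norm[OF gi] in auto)
  then have "(\<lambda>n. LINT s|lborel. I s * norm (g s - T (real (Suc n)) (g s))) \<longlonglongrightarrow> 0" by simp
  then obtain n where n: "(LINT s|lborel. I s * norm (g s - T (real (Suc n)) (g s))) < e / 2"
    using \<open>e > 0\<close> order_tendstoD(2)[of _ 0 sequentially "e/2"] eventually_sequentially by fastforce
  define R where "R = real (Suc n)"
  have R: "R > 0" by (simp add: R_def)
  have "g measurable_on UNIV"
    by (rule lebesgue_measurable_imp_measurable_on) (auto intro: measurable_completion)
  then obtain N \<phi> where N: "negligible N" and \<phi>: "\<And>n. continuous_on UNIV (\<phi> n)"
    and lim: "\<And>x. x \<notin> N \<Longrightarrow> (\<lambda>n. \<phi> n x) \<longlonglongrightarrow> g x"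
    unfolding measurable_on_def by auto
  have \<phi>m[measurable]: "\<phi> n \<in> borel_measurable borel" for n
    using \<phi> borel_measurable_continuous_onI by blast
  have ae: "AE x in lborel. x \<notin> N"
    using N AE_not_in[of N lebesgue] by (simp add: negligible_iff_null_sets AE_completion_iff)
  have "(\<lambda>n. LINT s|lborel. I s * norm (T R (g s) - T R (\<phi> n s))) \<longlonglongrightarrow> (LINT s|(lborel::real measure). 0)"
  proof (rule integral_dominated_convergence[where w = "\<lambda>s. I s * (2 * R)"])
    show "AE s in lborel. (\<lambda>n. I s * norm (T R (g s) - T R (\<phi> n s))) \<longlonglongrightarrow> 0"
      using ae
    proof eventually_elim
      case (elim s)
      have "(\<lambda>n. T R (\<phi> n s)) \<longlonglongrightarrow> T R (g s)"
        using T_cont[OF R] lim[OF elim] continuous_on_tendsto_compose by fastforce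
      then show ?case by (auto intro!: tendsto_eq_intros)
    qed
    show "AE s in lborel. norm (I s * norm (T R (g s) - T R (\<phi> n s))) \<le> I s * (2 * R)" for n
    proof (intro AE_I2)
      fix s
      have "norm (T R (g s) - T R (\<phi> n s)) \<le> 2 * R"
        using norm_triangle_ineq4[of "T R (g s)" "T R (\<phi> n s)"] T_R[OF R, of "g s"] T_R[OF R, of "\<phi> n s"] by simp
      then show "norm (I s * norm (T R (g s) - T R (\<phi> n s))) \<le> I s * (2 * R)"
        using I01[of s] by (simp add: abs_mult mult_left_mono)
    qed
  qed (use Ii in auto)
  then have "(\<lambda>n. LINT s|lborel. I s * norm (T R (g s) - T R (\<phi> n s))) \<longlonglongrightarrow> 0" by simp
  then obtain m where m: "(LINT s|lborel. I s * norm (T R (g s) - T R (\<phi> m s))) < e / 2"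
    using \<open>e > 0\<close> order_tendstoD(2)[of _ 0 sequentially "e/2"] eventually_sequentially by fastforce
  define \<psi> where "\<psi> = (\<lambda>s. T R (\<phi> m s))"
  have Tg: "integrable lborel (\<lambda>s. I s *\<^sub>R T R (g s))"
    by (rule Bochner_Integration.integrable_bound[OF gi])
       (use T_le[OF R] I01 in \<open>auto intro!: mult_left_mono\<close>)
  have T\<phi>: "integrable lborel (\<lambda>s. I s *\<^sub>R \<psi> s)"
    unfolding \<psi>_def
    by (rule Bochner_Integration.integrable_bound[where f = "\<lambda>s. I s * R"])
       (use T_R[OF R] I01 R Ii in \<open>auto intro!: mult_left_mono\<close>)
  have nd: "integrable lborel (\<lambda>s. I s * norm (x s - y s))"
    if "integrable lborel (\<lambda>s. I s *\<^sub>R x s)" "integrable lborel (\<lambda>s. I s *\<^sub>R y s)" for x y :: "real \<Rightarrow> 'e"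
  proof -
    have "integrable lborel (\<lambda>s. norm (I s *\<^sub>R x s - I s *\<^sub>R y s))"
      using that by (intro integrable_norm Bochner_Integration.integrable_diff)
    moreover have "norm (I s *\<^sub>R x s - I s *\<^sub>R y s) = I s * norm (x s - y s)" for s
      using I01[of s] by (simp flip: scaleR_diff_right)
    ultimately show ?thesis by simp
  qed
  show ?thesis
  proof
    show "continuous_on UNIV \<psi>" unfolding \<psi>_def
      using continuous_on_compose2[OF T_cont[OF R] \<phi>] by auto
    show "set_integrable lborel {a<..<b} \<psi>" using T\<phi> by (simp add: set_integrable_def I_def)
    have "(LINT s:{a<..<b}|lborel. norm (g s - \<psi> s)) = (LINT s|lborel. I s * norm (g s - \<psi> s))"
      by (simp add: set_lebesgue_integral_def I_def)
    also have "\<dots> \<le> (LINT s|lborel. I s * norm (g s - T R (g s)) + I s * norm (T R (g s) - \<psi> s))"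
    proof (rule integral_mono)
      fix s
      have "norm (g s - \<psi> s) \<le> norm (g s - T R (g s)) + norm (T R (g s) - \<psi> s)"
        using norm_triangle_ineq[of "g s - T R (g s)" "T R (g s) - \<psi> s"] by simp
      then show "I s * norm (g s - \<psi> s) \<le> I s * norm (g s - T R (g s)) + I s * norm (T R (g s) - \<psi> s)"
        using I01(1)[of s] by (metis distrib_left mult_left_mono)
    qed (intro Bochner_Integration.integrable_add nd gi Tg T\<phi>)+
    also have "\<dots> = (LINT s|lborel. I s * norm (g s - T R (g s))) + (LINT s|lborel. I s * norm (T R (g s) - \<psi> s))"
      by (intro Bochner_Integration.integral_add nd gi Tg T\<phi>)
    also have "\<dots> < e" using n m unfolding R_def \<psi>_def by simp
    finally show "(LINT s:{a<..<b}|lborel. norm (g s - \<psi> s)) < e" .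
  qed
qed

text \<open>Split \<open>g = \<phi> + k\<close> with \<open>\<phi>\<close> continuous and \<open>k\<close> small in \<open>L\<^sup>1\<close>. The oscillation of \<open>\<phi>\<close> near \<open>x\<close> is
  small, and that of \<open>k\<close> is controlled by its maximal function and by \<open>norm (k x)\<close>, each of
  which is small outside a set of measure proportional to the integral of \<open>norm k\<close>.\<close>

lemma AE_lebesgue_point:
  fixes g :: "real \<Rightarrow> 'e::euclidean_space"
  assumes g: "set_integrable lborel {a<..<b} g" and gm[measurable]: "g \<in> borel_measurable borel"
  shows "AE x in lebesgue. x \<in> {a<..<b} \<longrightarrow> (\<forall>e>0. \<exists>d>0. \<forall>l r. a \<le> l \<longrightarrow> l \<le> x \<longrightarrow> x \<le> r \<longrightarrow> r \<le> b \<longrightarrow> r - l < d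
            \<longrightarrow> (LINT s:{l<..<r}|lborel. norm (g s - g x)) \<le> e * (r - l))"
proof -
  define ok where "ok = (\<lambda>e x. \<exists>d>0. \<forall>l r. a \<le> l \<longrightarrow> l \<le> x \<longrightarrow> x \<le> r \<longrightarrow> r \<le> b \<longrightarrow> r - l < d
            \<longrightarrow> (LINT s:{l<..<r}|lborel. norm (g s - g x)) \<le> e * (r - l))"
  have neg: "negligible {x\<in>{a<..<b}. \<not> ok e x}" if e: "e > 0" for e
    unfolding negligible_outer_le
  proof (intro allI impI)
    fix \<eta> :: real assume \<eta>: "\<eta> > 0"
\<comment> \<open>the exceptional sets have measure at most \<open>45 / e\<close> and \<open>3 / e\<close> times the integral of \<open>norm k\<close>\<close>
    obtain \<phi> where \<phi>: "continuous_on UNIV \<phi>" "set_integrable lborel {a<..<b} \<phi>"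
      "(LINT s:{a<..<b}|lborel. norm (g s - \<phi> s)) < e * \<eta> / 48"
      using L1_approx_by_continuous[OF g gm, of "e * \<eta> / 48"] e \<eta> by auto
    have [measurable]: "\<phi> \<in> borel_measurable borel"
      using \<phi>(1) borel_measurable_continuous_onI by blast
    define k where "k = (\<lambda>s. indicator {a<..<b} s *\<^sub>R (g s - \<phi> s))"
    have [measurable]: "k \<in> borel_measurable borel" unfolding k_def by measurable
    have k: "integrable lborel k"
      using g \<phi>(2) unfolding k_def set_integrable_def scaleR_diff_right
      by (rule Bochner_Integration.integrable_diff)
    have kn: "(LINT s|lborel. norm (k s)) < e * \<eta> / 48"
      using \<phi>(3) by (simp add: k_def set_lebesgue_integral_def)
    obtain E where E: "E \<in> lmeasurable" "measure lebesgue E \<le> 5 / (e / 9) * (LINT s|lborel. norm (k s))"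
      "\<And>l r x. l < x \<Longrightarrow> x < r \<Longrightarrow> x \<notin> E \<Longrightarrow> (LINT s:{l<..<r}|lborel. norm (k s)) \<le> e / 9 * (r - l)"
      using maximal_inequality[OF k, of "e / 9"] e by auto
    define H where "H = {x \<in> space lborel. norm (k x) \<ge> e / 3}"
    have Hm: "H \<in> sets borel" unfolding H_def by measurable
    have Hf: "emeasure lborel H \<le> ennreal (1 / (e / 3) * (LINT s|lborel. norm (k s)))"
      unfolding H_def using k e by (intro integral_Markov_inequality) auto
    then have "emeasure lborel H < \<infinity>" by (rule order.strict_trans1) simp
    then have Hl: "H \<in> lmeasurable" using Hm by (auto intro!: fmeasurableI)
    have "ennreal (measure lebesgue H) = emeasure lborel H"
      using emeasure_eq_measure2[OF Hl] Hm by simp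
    also note Hf
    finally have H2: "measure lebesgue H \<le> 3 / e * (LINT s|lborel. norm (k s))"
      using e by (subst (asm) ennreal_le_iff) auto
    show "\<exists>T. {x\<in>{a<..<b}. \<not> ok e x} \<subseteq> T \<and> T \<in> lmeasurable \<and> measure lebesgue T \<le> \<eta>"
    proof (intro exI conjI subsetI)
      show "E \<union> H \<in> lmeasurable" using E Hl by blast
      have "measure lebesgue (E \<union> H) \<le> measure lebesgue E + measure lebesgue H"
        using E(1) Hl by (intro measure_Un_le) auto
      also have "\<dots> \<le> 48 / e * (LINT s|lborel. norm (k s))"
        using E(2) H2 e by (simp add: field_simps)
      also have "\<dots> \<le> \<eta>" using kn e by (simp add: field_simps)
      finally show "measure lebesgue (E \<union> H) \<le> \<eta>" .
    next
      fix x assume x: "x \<in> {x\<in>{a<..<b}. \<not> ok e x}"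
      show "x \<in> E \<union> H"
      proof (rule ccontr)
        assume "x \<notin> E \<union> H"
        then have xE: "x \<notin> E" and xH: "norm (k x) < e / 3" by (auto simp: H_def)
        obtain d where d: "d > 0" "\<And>s. dist s x < d \<Longrightarrow> dist (\<phi> s) (\<phi> x) < e / 3"
          using \<phi>(1) e unfolding continuous_on_iff by (metis UNIV_I zero_less_divide_iff zero_less_numeral)
        have "(LINT s:{l<..<r}|lborel. norm (g s - g x)) \<le> e * (r - l)"
          if lr: "a \<le> l" "l \<le> x" "x \<le> r" "r \<le> b" "r - l < d" for l r
        proof (cases "l = r")
          case True then show ?thesis by (simp add: set_lebesgue_integral_def)
        next
          case False
          then have "l < r" using lr by simp
          have ki: "set_integrable lborel A (\<lambda>s. norm (k s))" if "A \<in> sets borel" for A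
            using k that unfolding set_integrable_def by (intro integrable_mult_indicator) auto
          have ci: "set_integrable lborel {l<..<r} (\<lambda>s. c)" for c :: "'x::{banach, second_countable_topology}"
            by (rule set_integrable_const_Ioo)
          have "(LINT s:{l<..<r}|lborel. norm (g s - g x)) \<le> (LINT s:{l<..<r}|lborel. norm (k s) + 2 * e / 3)"
          proof (rule set_integral_mono)
            have "set_integrable lborel {l<..<r} g" using lr by (intro set_integrable_subset[OF g]) auto
            then show "set_integrable lborel {l<..<r} (\<lambda>s. norm (g s - g x))"
              using ci[of "g x"] by (intro set_integrable_norm set_integral_diff)
            show "set_integrable lborel {l<..<r} (\<lambda>s. norm (k s) + 2 * e / 3)"
              using ki ci by (intro set_integral_add) auto
            fix s assume s: "s \<in> {l<..<r}"
            have "norm (g s - g x) \<le> norm (k s) + norm (\<phi> s - \<phi> x) + norm (k x)"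
              using norm_triangle_ineq[of "k s + (\<phi> s - \<phi> x)" "- k x"] norm_triangle_ineq[of "k s" "\<phi> s - \<phi> x"]
                x s lr by (simp add: k_def)
            moreover have "norm (\<phi> s - \<phi> x) < e / 3"
              using d(2)[of s] s lr by (auto simp: dist_norm)
            ultimately show "norm (g s - g x) \<le> norm (k s) + 2 * e / 3" using xH by linarith
          qed
          also have "\<dots> = (LINT s:{l<..<r}|lborel. norm (k s)) + 2 * e / 3 * (r - l)"
            using \<open>l < r\<close> by (subst set_integral_add) (auto intro: ki ci simp: set_integral_const)
\<comment> \<open>\<open>x\<close> may be an end point of the interval, so pass to the open one of three times the length\<close>
          also have "(LINT s:{l<..<r}|lborel. norm (k s)) \<le> (LINT s:{l - (r - l)<..<r + (r - l)}|lborel. norm (k s))"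
            using \<open>l < r\<close> ki[of "{l<..<r}"] ki[of "{l - (r - l)<..<r + (r - l)}"]
            unfolding set_integrable_def set_lebesgue_integral_def
            by (intro integral_mono) (auto simp: indicator_def)
          also have "\<dots> \<le> e / 9 * (r + (r - l) - (l - (r - l)))"
            using \<open>l < r\<close> lr xE by (intro E(3)[of _ x]) auto
          finally show ?thesis by (simp add: field_simps)
        qed
        then have "ok e x" unfolding ok_def using d(1) by blast
        then show False using x by simp
      qed
    qed
  qed
  have "{x\<in>{a<..<b}. \<not> ok (1 / real (Suc n)) x} \<in> null_sets lebesgue" for n
    using neg[of "1 / real (Suc n)"] by (simp only: negligible_iff_null_sets) simp
  then have "AE x in lebesgue. \<forall>n. x \<notin> {x\<in>{a<..<b}. \<not> ok (1 / real (Suc n)) x}"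
    unfolding AE_all_countable using AE_not_in by blast
  then show ?thesis
  proof eventually_elim
    case (elim x)
    show ?case
    proof (intro impI allI)
      fix e :: real assume x: "x \<in> {a<..<b}" and e: "e > 0"
      obtain n where n: "1 / real (Suc n) < e"
        using e nat_approx_posE by blast
      have "ok (1 / real (Suc n)) x" using elim x by blast
      then obtain d where d: "d > 0" "\<And>l r. a \<le> l \<Longrightarrow> l \<le> x \<Longrightarrow> x \<le> r \<Longrightarrow> r \<le> b \<Longrightarrow> r - l < d
            \<Longrightarrow> (LINT s:{l<..<r}|lborel. norm (g s - g x)) \<le> 1 / real (Suc n) * (r - l)"
        unfolding ok_def by blast
      have "(LINT s:{l<..<r}|lborel. norm (g s - g x)) \<le> e * (r - l)"
        if "a \<le> l" "l \<le> x" "x \<le> r" "r \<le> b" "r - l < d" for l r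
        using d(2)[OF that] mult_right_mono[of "1 / real (Suc n)" e "r - l"] n that by linarith
      then show "\<exists>d>0. \<forall>l r. a \<le> l \<longrightarrow> l \<le> x \<longrightarrow> x \<le> r \<longrightarrow> r \<le> b \<longrightarrow> r - l < d
            \<longrightarrow> (LINT s:{l<..<r}|lborel. norm (g s - g x)) \<le> e * (r - l)"
        using d(1) by blast
    qed
  qed
qed


section \<open>Indefinite integrals\<close>

lemma set_integral_Ioo_diff:
  fixes g :: "real \<Rightarrow> 'e::euclidean_space"
  assumes g: "set_integrable lborel {a<..<b} g" and xy: "a \<le> x" "x \<le> y" "y \<le> b"
  shows "(LINT s:{a<..<y}|lborel. g s) - (LINT s:{a<..<x}|lborel. g s) = (LINT s:{x<..<y}|lborel. g s)"
proof -
  have s: "set_integrable lborel {a<..<x} g" "set_integrable lborel {x<..<y} g" "set_integrable lborel {a<..<y} g"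
    using xy by (auto intro: set_integrable_subset[OF g])
  have "(LINT s:{a<..<x} \<union> {x<..<y}|lborel. g s) = (LINT s:{a<..<x}|lborel. g s) + (LINT s:{x<..<y}|lborel. g s)"
    using s by (intro set_integral_Un) auto
  moreover have "(LINT s:{a<..<x} \<union> {x<..<y}|lborel. g s) = (LINT s:{a<..<y}|lborel. g s)"
    unfolding set_lebesgue_integral_def
  proof (rule integral_cong_AE)
    have "set_integrable lborel ({a<..<x} \<union> {x<..<y}) g" using s by (intro set_integrable_Un) auto
    then show "(\<lambda>s. indicat_real ({a<..<x} \<union> {x<..<y}) s *\<^sub>R g s) \<in> borel_measurable lborel"
      by (auto simp: set_integrable_def)
    show "(\<lambda>s. indicat_real {a<..<y} s *\<^sub>R g s) \<in> borel_measurable lborel"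
      using s(3) by (auto simp: set_integrable_def)
    show "AE s in lborel. indicat_real ({a<..<x} \<union> {x<..<y}) s *\<^sub>R g s = indicat_real {a<..<y} s *\<^sub>R g s"
      using AE_lborel_singleton[of x] by eventually_elim (use xy in \<open>auto simp: indicator_def\<close>)
  qed
  ultimately show ?thesis by (simp add: algebra_simps)
qed

text \<open>Lebesgue's differentiation theorem: the error of the difference quotient at a Lebesgue point is
  at most a mean of \<open>norm (g s - g x)\<close>.\<close>

lemma AE_indefinite_integral_has_vector_derivative:
  fixes g :: "real \<Rightarrow> 'e::euclidean_space"
  assumes g: "set_integrable lborel {a<..<b} g" and gm: "g \<in> borel_measurable borel"
  shows "AE x\<in>{a<..<b} in lebesgue. ((\<lambda>t. LINT s:{a<..<t}|lborel. g s) has_vector_derivative g x) (at x)"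
  using AE_lebesgue_point[OF g gm]
proof eventually_elim
  case (elim x)
  define F where "F = (\<lambda>t. LINT s:{a<..<t}|lborel. g s)"
  show ?case
  proof
    assume x: "x \<in> {a<..<b}"
    have key: "norm ((F r - F l) - (r - l) *\<^sub>R g x) \<le> (LINT s:{l<..<r}|lborel. norm (g s - g x))"
      if "a \<le> l" "l \<le> r" "r \<le> b" for l r
    proof -
      have ci: "set_integrable lborel {l<..<r} (\<lambda>s. g x)"
        by (rule set_integrable_const_Ioo)
      have gi: "set_integrable lborel {l<..<r} g" using that by (auto intro: set_integrable_subset[OF g])
      have "(F r - F l) - (r - l) *\<^sub>R g x = (LINT s:{l<..<r}|lborel. g s - g x)"
        unfolding F_def using that gi ci by (simp add: set_integral_Ioo_diff[OF g] set_integral_const)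
      then show ?thesis using set_integral_norm_bound[OF set_integral_diff(1)[OF gi ci]] by simp
    qed
    have "\<exists>d>0. \<forall>y. norm (y - x) < d \<longrightarrow> norm (F y - F x - (y - x) *\<^sub>R g x) \<le> e * norm (y - x)"
      if "e > 0" for e
    proof -
      obtain d where d: "d > 0" "\<And>l r. a \<le> l \<Longrightarrow> l \<le> x \<Longrightarrow> x \<le> r \<Longrightarrow> r \<le> b \<Longrightarrow> r - l < d
            \<Longrightarrow> (LINT s:{l<..<r}|lborel. norm (g s - g x)) \<le> e * (r - l)"
        using elim x \<open>e > 0\<close> by blast
      show ?thesis
      proof (intro exI[of _ "min d (min (x - a) (b - x))"] conjI allI impI)
        fix y assume y: "norm (y - x) < min d (min (x - a) (b - x))"
        show "norm (F y - F x - (y - x) *\<^sub>R g x) \<le> e * norm (y - x)"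
        proof (cases "x \<le> y")
          case True
          then show ?thesis using key[of x y] d(2)[of x y] y x by auto
        next
          case False
          then have "norm (F x - F y - (x - y) *\<^sub>R g x) \<le> e * (x - y)"
            using key[of y x] d(2)[of y x] y x by auto
          moreover have "F y - F x - (y - x) *\<^sub>R g x = - (F x - F y - (x - y) *\<^sub>R g x)"
            by (simp add: algebra_simps)
          ultimately show ?thesis using False by (metis abs_minus_commute abs_of_pos diff_gt_0_iff_gt linorder_not_le norm_minus_cancel real_norm_def)
        qed
      qed (use d x in auto)
    qed
    then show "((\<lambda>t. LINT s:{a<..<t}|lborel. g s) has_vector_derivative g x) (at x)"
      unfolding has_vector_derivative_def has_derivative_within_alt F_def[symmetric]
      by (auto intro: bounded_linear_scaleR_left)
  qed
qed

text \<open>Where \<open>norm g\<close> is at most \<open>n\<close>, the integral over a set is at most \<open>n\<close> times its measure; the part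
  of \<open>norm g\<close> above \<open>n\<close> has small integral over the whole interval.\<close>

lemma abs_continuous_indefinite_integral:
  fixes g :: "real \<Rightarrow> 'e::euclidean_space"
  assumes g: "set_integrable lborel {a<..<b} g" and gm[measurable]: "g \<in> borel_measurable borel"
  shows "abs_continuous a b (\<lambda>t. LINT s:{a<..<t}|lborel. g s)"
  unfolding abs_continuous_def
proof (intro allI impI)
  fix \<epsilon> :: real assume \<epsilon>: "\<epsilon> > 0"
  define tl where "tl = (\<lambda>n s. if norm (g s) \<le> real n then 0 else norm (g s))"
  have [measurable]: "tl n \<in> borel_measurable borel" for n unfolding tl_def by measurable
  have gn: "integrable lborel (\<lambda>s. indicator {a<..<b} s *\<^sub>R norm (g s))"
    using set_integrable_norm[OF g] by (simp add: set_integrable_def)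
  have ti: "integrable lborel (\<lambda>s. indicator {a<..<b} s *\<^sub>R tl n s)" for n
    by (rule Bochner_Integration.integrable_bound[OF gn]) (auto simp: tl_def indicator_def)
  have "(\<lambda>n. LINT s|lborel. indicator {a<..<b} s *\<^sub>R tl n s) \<longlonglongrightarrow> (LINT s|(lborel::real measure). 0)"
  proof (rule integral_dominated_convergence[OF _ _ gn])
    show "AE s in lborel. (\<lambda>n. indicator {a<..<b} s *\<^sub>R tl n s) \<longlonglongrightarrow> 0"
    proof (intro AE_I2 tendsto_eventually)
      fix s
      obtain N where N: "norm (g s) \<le> real N" using real_arch_simple by blast
      then show "\<forall>\<^sub>F n in sequentially. indicator {a<..<b} s *\<^sub>R tl n s = 0"
        unfolding eventually_sequentially by (intro exI[of _ N]) (auto simp: tl_def)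
    qed
  qed (auto simp: tl_def indicator_def)
  then obtain n where n: "(LINT s|lborel. indicator {a<..<b} s *\<^sub>R tl n s) < \<epsilon> / 2"
    using \<epsilon> order_tendstoD(2)[of _ 0 sequentially "\<epsilon>/2"] eventually_sequentially by fastforce
  show "\<exists>\<delta>>0. \<forall>(k::nat) l r. (\<forall>i<k. a \<le> l i \<and> l i \<le> r i \<and> r i \<le> b) \<and>
        disjoint_family_on (\<lambda>i. {l i<..<r i}) {..<k} \<and> (\<Sum>i<k. r i - l i) < \<delta> \<longrightarrow>
        (\<Sum>i<k. norm ((LINT s:{a<..<r i}|lborel. g s) - (LINT s:{a<..<l i}|lborel. g s))) < \<epsilon>"
  proof (intro exI[of _ "\<epsilon> / (2 * (real n + 1))"] conjI allI impI, goal_cases)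
    case 1 then show ?case using \<epsilon> by simp
  next
    case (2 k l r)
    then have lr: "\<And>i. i < k \<Longrightarrow> a \<le> l i \<and> l i \<le> r i \<and> r i \<le> b"
      and disj: "disjoint_family_on (\<lambda>i. {l i<..<r i}) {..<k}"
      and len: "(\<Sum>i<k. r i - l i) < \<epsilon> / (2 * (real n + 1))" by auto
    have tsi: "set_integrable lborel A (tl n)" if "A \<in> sets borel" "A \<subseteq> {a<..<b}" for A
      using ti[of n] set_integrable_subset[of lborel "{a<..<b}" "tl n" A] that by (simp add: set_integrable_def)
    have sub: "{l i<..<r i} \<subseteq> {a<..<b}" if "i < k" for i using lr[OF that] by auto
    have "(\<Sum>i<k. norm ((LINT s:{a<..<r i}|lborel. g s) - (LINT s:{a<..<l i}|lborel. g s)))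
        \<le> (\<Sum>i<k. (LINT s:{l i<..<r i}|lborel. tl n s) + real n * (r i - l i))"
    proof (rule sum_mono)
      fix i assume "i \<in> {..<k}"
      then have i: "i < k" by simp
      have gi: "set_integrable lborel {l i<..<r i} g" using sub[OF i] by (auto intro: set_integrable_subset[OF g])
      have ci: "set_integrable lborel {l i<..<r i} (\<lambda>s. real n)"
        by (rule set_integrable_const_Ioo)
      have "norm ((LINT s:{a<..<r i}|lborel. g s) - (LINT s:{a<..<l i}|lborel. g s))
          = norm (LINT s:{l i<..<r i}|lborel. g s)"
        using lr[OF i] by (simp add: set_integral_Ioo_diff[OF g])
      also have "\<dots> \<le> (LINT s:{l i<..<r i}|lborel. norm (g s))" by (rule set_integral_norm_bound[OF gi])
      also have "\<dots> \<le> (LINT s:{l i<..<r i}|lborel. tl n s + real n)"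
        using set_integrable_norm[OF gi] tsi[OF _ sub[OF i]] ci
        by (intro set_integral_mono set_integral_add) (auto simp: tl_def)
      also have "\<dots> = (LINT s:{l i<..<r i}|lborel. tl n s) + real n * (r i - l i)"
        using tsi[OF _ sub[OF i]] ci lr[OF i] by (subst set_integral_add) (auto simp: set_integral_const)
      finally show "norm ((LINT s:{a<..<r i}|lborel. g s) - (LINT s:{a<..<l i}|lborel. g s))
          \<le> (LINT s:{l i<..<r i}|lborel. tl n s) + real n * (r i - l i)" .
    qed
    also have "\<dots> = (LINT s:(\<Union>i<k. {l i<..<r i})|lborel. tl n s) + real n * (\<Sum>i<k. r i - l i)"
    proof -
      have "(LINT s:(\<Union>i<k. {l i<..<r i})|lborel. tl n s) = (\<Sum>i<k. LINT s:{l i<..<r i}|lborel. tl n s)"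
        using disj sub by (intro set_integral_finite_Union tsi) auto
      then show ?thesis by (simp add: sum.distrib sum_distrib_left)
    qed
    also have "(LINT s:(\<Union>i<k. {l i<..<r i})|lborel. tl n s) \<le> (LINT s:{a<..<b}|lborel. tl n s)"
      using tsi[of "\<Union>i<k. {l i<..<r i}"] tsi[of "{a<..<b}"] sub
      unfolding set_integrable_def set_lebesgue_integral_def
      by (intro integral_mono) (auto simp: indicator_def tl_def, force+)
    also have "\<dots> < \<epsilon> / 2" using n by (simp add: set_lebesgue_integral_def)
    also have "real n * (\<Sum>i<k. r i - l i) \<le> \<epsilon> / 2"
    proof -
      have "real n * (\<Sum>i<k. r i - l i) \<le> real n * (\<epsilon> / (2 * (real n + 1)))"
        using len by (intro mult_left_mono) auto
      also have "\<dots> \<le> \<epsilon> / 2" using \<epsilon> by (simp add: field_simps)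
      finally show ?thesis .
    qed
    finally show ?case by simp
  qed
qed

section \<open>Integrals of products and limits\<close>

lemma conjugate_exponent:
  fixes p q :: real
  assumes "1 < p" "1 / p + 1 / q = 1"
  shows "q = p / (p - 1)" "1 < q"
proof -
  have "q \<noteq> 0" using assms by auto
  have "1 / q = (p - 1) / p" using assms by (simp add: field_simps)
  then show "q = p / (p - 1)" using assms \<open>q \<noteq> 0\<close> by (auto simp: field_simps)
  then show "1 < q" using assms by (simp add: less_divide_eq)
qed

text \<open>If \<open>k \<le> \<eta> * z powr (p - 1)\<close>, then the first term on the right suffices; otherwise
  \<open>z \<le> (k / \<eta>) powr (1 / (p - 1))\<close> and the second one does. The free parameter \<open>\<eta>\<close> makes the
  \<open>p\<close>-th power as cheap as desired.\<close>

lemma scaled_Young_inequality: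
  fixes p q k z \<eta> :: real
  assumes p: "1 < p" "1 / p + 1 / q = 1" and nn: "0 \<le> k" "0 \<le> z" "0 < \<eta>"
  shows "k * z \<le> \<eta> * z powr p + \<eta> powr (- 1 / (p - 1)) * k powr q"
proof (cases "k \<le> \<eta> * z powr (p - 1)")
  case True
  have "k * z \<le> \<eta> * z powr (p - 1) * z" using True nn by (intro mult_right_mono) auto
  also have "\<dots> = \<eta> * z powr p" using nn p by (cases "z = 0") (auto simp: powr_diff)
  finally show ?thesis using nn by (simp add: add_increasing2)
next
  case False
  then have k: "k > 0" using nn by (smt (verit) mult_nonneg_nonneg powr_ge_zero)
  have "z = (z powr (p - 1)) powr (1 / (p - 1))" using nn p by (simp add: powr_powr)
  also have "\<dots> \<le> (k / \<eta>) powr (1 / (p - 1))"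
    using False nn p by (intro powr_mono2) (auto simp: field_simps)
  also have "\<dots> = \<eta> powr (- 1 / (p - 1)) * k powr (1 / (p - 1))"
    using k nn by (simp add: powr_divide powr_minus_divide divide_simps flip: minus_divide_left)
  finally have "k * z \<le> k * (\<eta> powr (- 1 / (p - 1)) * k powr (1 / (p - 1)))"
    using k by (intro mult_left_mono) auto
  also have "\<dots> = \<eta> powr (- 1 / (p - 1)) * k powr (1 + 1 / (p - 1))"
    using k by (simp add: powr_add)
  also have "1 + 1 / (p - 1) = q" using conjugate_exponent(1)[OF p] p by (simp add: field_simps)
  finally show ?thesis using nn by (simp add: add_increasing)
qed

lemma norm_add_powr_le:
  fixes x y :: "'e::real_normed_vector"
  assumes "0 \<le> p"
  shows "norm (x + y) powr p \<le> 2 powr p * (norm x powr p + norm y powr p)"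
proof -
  have "norm (x + y) powr p \<le> (2 * max (norm x) (norm y)) powr p"
    using norm_triangle_ineq[of x y] assms by (intro powr_mono2) auto
  also have "\<dots> = 2 powr p * (max (norm x) (norm y)) powr p"
    by (simp add: powr_mult)
  also have "\<dots> \<le> 2 powr p * (norm x powr p + norm y powr p)"
    by (intro mult_left_mono) (auto simp: max_def)
  finally show ?thesis .
qed

lemma powr_le_one_plus_powr:
  fixes s :: real assumes "0 \<le> s" "0 \<le> d" "d \<le> p"
  shows "s powr d \<le> 1 + s powr p"
proof (cases "s \<le> 1")
  case True
  then have "s powr d \<le> 1" using assms powr_mono2[of d s 1] by simp
  then show ?thesis by (simp add: add_increasing2)
next
  case False
  then have "s powr d \<le> s powr p" using assms by (intro powr_mono) auto
  then show ?thesis by simp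
qed

lemma powr_absorb:
  fixes d p \<epsilon> :: real
  assumes "0 \<le> d" "d < p" "0 < \<epsilon>"
  obtains C where "0 \<le> C" "\<And>s. 0 \<le> s \<Longrightarrow> s powr d \<le> \<epsilon> * s powr p + C"
proof
  define R where "R = \<epsilon> powr (1 / (d - p))"
  have R: "R > 0" using assms by (simp add: R_def)
  show "0 \<le> R powr d" by simp
  fix s :: real assume s: "0 \<le> s"
  show "s powr d \<le> \<epsilon> * s powr p + R powr d"
  proof (cases "s \<le> R")
    case True
    then have "s powr d \<le> R powr d" using s assms by (intro powr_mono2) auto
    then show ?thesis using assms by (simp add: add_increasing)
  next
    case False
    then have "s powr (d - p) \<le> R powr (d - p)" using R assms by (intro powr_mono2') auto
    also have "\<dots> = \<epsilon>" using assms by (simp add: R_def powr_powr)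
    finally have "s powr p * s powr (d - p) \<le> s powr p * \<epsilon>" by (intro mult_left_mono) auto
    moreover have "s powr p * s powr (d - p) = s powr d" by (simp flip: powr_add)
    ultimately show ?thesis by (simp add: mult.commute add_increasing2)
  qed
qed

lemma integrable_conjugate_product:
  fixes k :: "'a \<Rightarrow> real" and z :: "'a \<Rightarrow> 'e::{banach, second_countable_topology}"
  assumes p: "1 < p" "1 / p + 1 / q = 1"
    and [measurable]: "k \<in> borel_measurable M" "z \<in> borel_measurable M"
    and k0: "\<And>x. 0 \<le> k x" and ki: "integrable M (\<lambda>x. k x powr q)"
    and zi: "integrable M (\<lambda>x. norm (z x) powr p)"
  shows "integrable M (\<lambda>x. k x *\<^sub>R z x)" "integrable M (\<lambda>x. k x * norm (z x))"
proof -
  have le: "k x * norm (z x) \<le> norm (z x) powr p + k x powr q" for x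
    using scaled_Young_inequality[OF p, of "k x" "norm (z x)" 1] k0[of x] by simp
  show "integrable M (\<lambda>x. k x *\<^sub>R z x)" "integrable M (\<lambda>x. k x * norm (z x))"
    by (rule Bochner_Integration.integrable_bound[OF Bochner_Integration.integrable_add[OF zi ki]];
        use le k0 in \<open>auto intro!: AE_I2 simp: abs_mult\<close>)+
qed

text \<open>Hoelder's inequality up to a constant, from Young's inequality with the parameter that balances
  its two terms. Adding 1 to the integrals keeps that parameter positive and finite.\<close>

lemma weak_Holder_inequality:
  fixes k :: "'a \<Rightarrow> real" and z :: "'a \<Rightarrow> 'e::{banach, second_countable_topology}"
  assumes p: "1 < p" "1 / p + 1 / q = 1"
    and m[measurable]: "k \<in> borel_measurable M" "z \<in> borel_measurable M"
    and k0: "\<And>x. 0 \<le> k x" and ki: "integrable M (\<lambda>x. k x powr q)"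
    and zi: "integrable M (\<lambda>x. norm (z x) powr p)"
  shows "(\<integral>x. k x * norm (z x) \<partial>M) powr p
    \<le> (1 + (\<integral>x. k x powr q \<partial>M)) powr p * (1 + (\<integral>x. norm (z x) powr p \<partial>M))"
proof -
  define N where "N = (\<integral>x. norm (z x) powr p \<partial>M)"
  define Q where "Q = (\<integral>x. k x powr q \<partial>M)"
  have N: "N \<ge> 0" and Q: "Q \<ge> 0" by (auto simp: N_def Q_def)
  define \<eta> where "\<eta> = (1 + N) powr (- (p - 1) / p)"
  have \<eta>: "\<eta> > 0" using N by (simp add: \<eta>_def)
  have e1: "\<eta> * (1 + N) = (1 + N) powr (1 / p)"
  proof -
    have "\<eta> * (1 + N) = (1 + N) powr (- (p - 1) / p + 1)"
      using N by (simp add: \<eta>_def powr_add)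
    also have "- (p - 1) / p + 1 = 1 / p" using p by (simp add: field_simps)
    finally show ?thesis .
  qed
  have e2: "\<eta> powr (- 1 / (p - 1)) = (1 + N) powr (1 / p)"
  proof -
    have "- (p - 1) / p * (- 1 / (p - 1)) = 1 / p" using p by (simp add: divide_simps)
    then show ?thesis unfolding \<eta>_def powr_powr by (rule arg_cong)
  qed
  have "(\<integral>x. k x * norm (z x) \<partial>M) \<le> (\<integral>x. \<eta> * norm (z x) powr p + \<eta> powr (- 1 / (p - 1)) * k x powr q \<partial>M)"
  proof (rule integral_mono)
    show "integrable M (\<lambda>x. k x * norm (z x))"
      by (rule integrable_conjugate_product[OF p m k0 ki zi])
    show "integrable M (\<lambda>x. \<eta> * norm (z x) powr p + \<eta> powr (- 1 / (p - 1)) * k x powr q)"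
      using ki zi by simp
    show "k x * norm (z x) \<le> \<eta> * norm (z x) powr p + \<eta> powr (- 1 / (p - 1)) * k x powr q" for x
      using scaled_Young_inequality[OF p, of "k x" "norm (z x)" \<eta>] k0[of x] \<eta> by simp
  qed
  also have "\<dots> = \<eta> * N + \<eta> powr (- 1 / (p - 1)) * Q"
    using ki zi by (simp add: N_def Q_def)
  also have "\<dots> \<le> \<eta> * (1 + N) + \<eta> powr (- 1 / (p - 1)) * Q"
    using \<eta> by simp
  also have "\<dots> = (1 + N) powr (1 / p) * (1 + Q)"
    unfolding e1 e2 by (simp add: algebra_simps)
  finally have "(\<integral>x. k x * norm (z x) \<partial>M) powr p \<le> ((1 + N) powr (1 / p) * (1 + Q)) powr p"
    using k0 p by (intro powr_mono2) auto
  also have "\<dots> = (1 + Q) powr p * (1 + N)"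
    using N Q p by (simp add: powr_mult powr_powr)
  finally show ?thesis by (simp add: N_def Q_def)
qed

text \<open>Bounded sequences in \<open>L\<^sup>p\<close> that tend to 0 almost everywhere tend to 0 weakly. By Young's
  inequality, \<open>k * norm z\<close> is at most \<open>\<eta> * norm z powr p\<close> plus the minimum of \<open>k * norm z\<close> and
  a multiple of \<open>k powr q\<close>; the minimum is dominated, so its integral tends to 0.\<close>

lemma integral_product_tendsto_zero:
  fixes k :: "'a \<Rightarrow> real" and z :: "nat \<Rightarrow> 'a \<Rightarrow> 'e::{banach, second_countable_topology}"
  assumes p: "1 < p" "1 / p + 1 / q = 1"
    and km[measurable]: "k \<in> borel_measurable M" and zm[measurable]: "\<And>n. z n \<in> borel_measurable M"
    and k0: "\<And>x. 0 \<le> k x" and ki: "integrable M (\<lambda>x. k x powr q)"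
    and zi: "\<And>n. integrable M (\<lambda>x. norm (z n x) powr p)"
    and zB: "\<And>n. (\<integral>x. norm (z n x) powr p \<partial>M) \<le> B"
    and lim: "AE x in M. (\<lambda>n. z n x) \<longlonglongrightarrow> 0"
  shows "(\<lambda>n. \<integral>x. k x * norm (z n x) \<partial>M) \<longlonglongrightarrow> 0"
proof (rule tendstoI)
  fix e :: real assume e: "e > 0"
  have B: "0 \<le> B" using zB[of 0] by (rule order_trans[rotated]) simp
  define \<eta> where "\<eta> = e / (2 * (B + 1))"
  have \<eta>: "\<eta> > 0" using e B by (simp add: \<eta>_def)
  have \<eta>B: "\<eta> * B \<le> e / 2"
    using e B by (simp add: \<eta>_def field_simps)
  define C where "C = \<eta> powr (- 1 / (p - 1))"
  define m where "m = (\<lambda>n x. min (k x * norm (z n x)) (C * k x powr q))"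
  have C: "C \<ge> 0" by (simp add: C_def)
  have kz: "integrable M (\<lambda>x. k x * norm (z n x))" for n
    by (rule integrable_conjugate_product[OF p km zm k0 ki zi])
  have mi: "integrable M (m n)" for n
    unfolding m_def using kz ki by (intro integrable_min) auto
  have "(\<lambda>n. \<integral>x. m n x \<partial>M) \<longlonglongrightarrow> (\<integral>x. 0 \<partial>M)"
  proof (rule integral_dominated_convergence)
    show "AE x in M. (\<lambda>n. m n x) \<longlonglongrightarrow> 0"
      using lim
    proof eventually_elim
      case (elim x)
      have "(\<lambda>n. min (k x * norm (z n x)) (C * k x powr q)) \<longlonglongrightarrow> min (k x * norm (0::'e)) (C * k x powr q)"
        using elim by (intro tendsto_intros)
      then show ?case using C by (simp add: m_def)
    qed
    show "integrable M (\<lambda>x. C * k x powr q)" using ki by simp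
    show "AE x in M. norm (m n x) \<le> C * k x powr q" for n
      using C k0 by (intro AE_I2) (auto simp: m_def min_def)
  qed (auto simp: m_def)
  then have "\<forall>\<^sub>F n in sequentially. (\<integral>x. m n x \<partial>M) < e / 2"
    using e by (intro order_tendstoD(2)[of _ 0]) auto
  then show "\<forall>\<^sub>F n in sequentially. dist (\<integral>x. k x * norm (z n x) \<partial>M) 0 < e"
  proof eventually_elim
    case (elim n)
    have "(\<integral>x. k x * norm (z n x) \<partial>M) \<le> (\<integral>x. \<eta> * norm (z n x) powr p + m n x \<partial>M)"
    proof (rule integral_mono[OF kz])
      show "integrable M (\<lambda>x. \<eta> * norm (z n x) powr p + m n x)" using zi mi by simp
      show "k x * norm (z n x) \<le> \<eta> * norm (z n x) powr p + m n x" for x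
        using scaled_Young_inequality[OF p, of "k x" "norm (z n x)" \<eta>] k0[of x] \<eta>
        by (auto simp: m_def min_def C_def)
    qed
    also have "\<dots> = \<eta> * (\<integral>x. norm (z n x) powr p \<partial>M) + (\<integral>x. m n x \<partial>M)" using zi mi by simp
    also have "\<dots> \<le> \<eta> * B + (\<integral>x. m n x \<partial>M)" using zB \<eta> by simp
    also have "\<dots> < e" using elim \<eta>B by simp
    finally show ?case using k0 by (simp add: dist_norm)
  qed
qed

text \<open>Fatou's lemma for real functions that have a common integrable minorant.\<close>

lemma integrable_limit_of_bounded_integrals:
  fixes f :: "nat \<Rightarrow> 'a \<Rightarrow> real"
  assumes fi: "\<And>n. integrable M (f n)" and [measurable]: "F \<in> borel_measurable M"
    and lim: "AE x in M. (\<lambda>n. f n x) \<longlonglongrightarrow> F x"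
    and gi: "integrable M g" and gf: "\<And>n. AE x in M. g x \<le> f n x"
    and le: "\<And>n. (\<integral>x. f n x \<partial>M) \<le> B n" and B: "B \<longlonglongrightarrow> b"
  shows "integrable M F" "(\<integral>x. F x \<partial>M) \<le> b"
proof -
  have [measurable]: "f n \<in> borel_measurable M" "g \<in> borel_measurable M" for n
    using fi gi by auto
  define G where "G = (\<integral>x. g x \<partial>M)"
  have AEg: "AE x in M. \<forall>n. g x \<le> f n x" using gf by (simp add: AE_all_countable)
  have hge: "AE x in M. g x \<le> F x"
    using AEg lim by eventually_elim (auto intro: LIMSEQ_le_const)
  have "G \<le> (\<integral>x. f n x \<partial>M)" for n unfolding G_def using fi gi gf by (intro integral_mono_AE)
  then have "G \<le> B n" for n using le order_trans by blast
  then have Gb: "G \<le> b" using B by (auto intro: LIMSEQ_le_const)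
  have "(\<integral>\<^sup>+x. ennreal (F x - g x) \<partial>M) = (\<integral>\<^sup>+x. liminf (\<lambda>n. ennreal (f n x - g x)) \<partial>M)"
  proof (rule nn_integral_cong_AE)
    show "AE x in M. ennreal (F x - g x) = liminf (\<lambda>n. ennreal (f n x - g x))"
      using lim
    proof eventually_elim
      case (elim x)
      have "(\<lambda>n. ennreal (f n x - g x)) \<longlonglongrightarrow> ennreal (F x - g x)"
        using elim by (intro tendsto_intros)
      then show ?case by (simp add: lim_imp_Liminf)
    qed
  qed
  also have "\<dots> \<le> liminf (\<lambda>n. \<integral>\<^sup>+x. ennreal (f n x - g x) \<partial>M)"
    by (rule nn_integral_liminf) measurable
  also have "\<dots> \<le> liminf (\<lambda>n. ennreal (B n - G))"
  proof (rule Liminf_mono, rule always_eventually, rule allI)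
    fix n
    have "(\<integral>\<^sup>+x. ennreal (f n x - g x) \<partial>M) = ennreal (\<integral>x. f n x - g x \<partial>M)"
      using fi gi gf[of n] by (intro nn_integral_eq_integral) auto
    also have "\<dots> \<le> ennreal (B n - G)"
      using fi gi le[of n] by (intro ennreal_leI) (simp add: G_def)
    finally show "(\<integral>\<^sup>+x. ennreal (f n x - g x) \<partial>M) \<le> ennreal (B n - G)" .
  qed
  also have "\<dots> = ennreal (b - G)"
  proof -
    have "(\<lambda>n. ennreal (B n - G)) \<longlonglongrightarrow> ennreal (b - G)" using B by (intro tendsto_intros)
    then show ?thesis by (simp add: lim_imp_Liminf)
  qed
  finally have fin: "(\<integral>\<^sup>+x. ennreal (F x - g x) \<partial>M) \<le> ennreal (b - G)" .
  have hi: "integrable M (\<lambda>x. F x - g x)"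
    using hge by (intro integrableI_nonneg order.strict_trans1[OF fin]) auto
  then have "integrable M (\<lambda>x. (F x - g x) + g x)" using gi by (rule Bochner_Integration.integrable_add)
  then show Fi: "integrable M F" by simp
  have "ennreal (\<integral>x. F x - g x \<partial>M) \<le> ennreal (b - G)"
    using fin hi hge by (subst (asm) nn_integral_eq_integral) auto
  then show "(\<integral>x. F x \<partial>M) \<le> b"
    using Gb Fi gi by (subst (asm) ennreal_le_iff) (auto simp: G_def)
qed

section \<open>Compactness of nested convex sets of functions\<close>

text \<open>A strictly convex function of linear growth: its integral is finite on \<open>L\<^sup>1\<close>, and its convexity
  defect at a midpoint measures the distance of the end points.\<close>

definition smooth_norm :: "'e::real_normed_vector \<Rightarrow> real" where
  "smooth_norm x = sqrt (1 + (norm x)\<^sup>2)"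

lemma smooth_norm_bounds: "1 \<le> smooth_norm x" "norm x \<le> smooth_norm x" "smooth_norm x \<le> 1 + norm x"
  unfolding smooth_norm_def
  by (auto intro!: real_le_rsqrt real_le_lsqrt simp: power2_eq_square algebra_simps)

lemma borel_measurable_smooth_norm[measurable]: "smooth_norm \<in> borel_measurable borel"
  unfolding smooth_norm_def by measurable

text \<open>Let \<open>s\<close>, \<open>r\<close>, \<open>m\<close> be the values at \<open>x\<close>, \<open>y\<close> and the midpoint. The parallelogram law gives
  \<open>(s + r)\<^sup>2 - 4 * m\<^sup>2 = (norm (x - y))\<^sup>2 - (s - r)\<^sup>2\<close>. Since
  \<open>\<bar>s\<^sup>2 - r\<^sup>2\<bar> \<le> norm (x - y) * (norm x + norm y)\<close> while \<open>s + r\<close> exceeds \<open>norm x + norm y\<close>, the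
  last square takes away only part of the distance.\<close>

lemma smooth_norm_midpoint_gap:
  fixes x y :: "'e::real_inner"
  shows "(norm (x - y))\<^sup>2 \<le> (smooth_norm x + smooth_norm y) ^ 3
      * (smooth_norm x + smooth_norm y - 2 * smooth_norm ((1 / 2) *\<^sub>R (x + y)))"
proof -
  define s where "s = smooth_norm x"
  define r where "r = smooth_norm y"
  define m where "m = smooth_norm ((1 / 2) *\<^sub>R (x + y))"
  define d where "d = norm (x - y)"
  have s2: "s\<^sup>2 = 1 + (norm x)\<^sup>2" and r2: "r\<^sup>2 = 1 + (norm y)\<^sup>2"
    by (auto simp: s_def r_def smooth_norm_def)
  have pos: "s \<ge> 1" "r \<ge> 1" "m \<ge> 1" "d \<ge> 0" "norm x \<le> s" "norm y \<le> r"
    by (auto simp: s_def r_def m_def d_def smooth_norm_bounds)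
  have m2: "4 * m\<^sup>2 = 2 * s\<^sup>2 + 2 * r\<^sup>2 - d\<^sup>2"
  proof -
    have "4 * m\<^sup>2 = 4 + (norm (x + y))\<^sup>2"
      by (simp add: m_def smooth_norm_def power_mult_distrib power_divide)
    moreover have "(norm (x + y))\<^sup>2 + d\<^sup>2 = 2 * (norm x)\<^sup>2 + 2 * (norm y)\<^sup>2"
      by (simp add: d_def power2_norm_eq_inner algebra_simps inner_commute)
    ultimately show ?thesis using s2 r2 by simp
  qed
  have "\<bar>norm x - norm y\<bar> \<le> d" unfolding d_def by (rule norm_triangle_ineq3)
  then have "(norm x - norm y)\<^sup>2 \<le> d\<^sup>2" by (metis abs_ge_zero power2_abs power_mono)
  then have "(norm x - norm y)\<^sup>2 * (norm x + norm y)\<^sup>2 \<le> d\<^sup>2 * (norm x + norm y)\<^sup>2"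
    by (intro mult_right_mono) auto
  moreover have "(s - r)\<^sup>2 * (s + r)\<^sup>2 = (norm x - norm y)\<^sup>2 * (norm x + norm y)\<^sup>2"
  proof -
    have "(s - r)\<^sup>2 * (s + r)\<^sup>2 = (s\<^sup>2 - r\<^sup>2)\<^sup>2" by (simp add: power2_eq_square algebra_simps)
    also have "\<dots> = ((norm x)\<^sup>2 - (norm y)\<^sup>2)\<^sup>2" using s2 r2 by simp
    also have "\<dots> = (norm x - norm y)\<^sup>2 * (norm x + norm y)\<^sup>2" by (simp add: power2_eq_square algebra_simps)
    finally show ?thesis .
  qed
  ultimately have sr: "(s - r)\<^sup>2 * (s + r)\<^sup>2 \<le> d\<^sup>2 * (norm x + norm y)\<^sup>2" by simp
  have "norm x * norm y \<le> s * r" using pos by (intro mult_mono) auto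
  then have "(norm x + norm y)\<^sup>2 + 2 \<le> (s + r)\<^sup>2"
    using s2 r2 by (simp add: power2_sum)
  then have "d\<^sup>2 * ((norm x + norm y)\<^sup>2 + 2) \<le> d\<^sup>2 * (s + r)\<^sup>2" by (intro mult_left_mono) auto
  then have "2 * d\<^sup>2 \<le> (s + r)\<^sup>2 * (d\<^sup>2 - (s - r)\<^sup>2)" using sr by (simp add: algebra_simps)
  also have "d\<^sup>2 - (s - r)\<^sup>2 = (s + r - 2 * m) * (s + r + 2 * m)"
    using m2 by (simp add: power2_eq_square algebra_simps)
  finally have key: "2 * d\<^sup>2 \<le> (s + r)\<^sup>2 * ((s + r - 2 * m) * (s + r + 2 * m))" .
  have gap: "0 \<le> s + r - 2 * m"
  proof (rule ccontr)
    assume "\<not> 0 \<le> s + r - 2 * m"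
    then have "(s + r)\<^sup>2 * ((s + r - 2 * m) * (s + r + 2 * m)) < 0"
      using pos by (intro mult_pos_neg mult_neg_pos) auto
    then show False using key zero_le_power2[of d] by linarith
  qed
  have "(s + r)\<^sup>2 * ((s + r - 2 * m) * (s + r + 2 * m)) \<le> (s + r)\<^sup>2 * ((s + r - 2 * m) * (2 * (s + r)))"
    using gap by (intro mult_left_mono) auto
  then have "d\<^sup>2 \<le> (s + r) ^ 3 * (s + r - 2 * m)"
    using key by (simp add: power2_eq_square power3_eq_cube algebra_simps)
  then show ?thesis by (simp add: s_def r_def m_def d_def)
qed

text \<open>Bounds a distance by terms with integrals that can all be made small. Let \<open>S\<close> be the sum of the
  values of \<open>smooth_norm\<close> at \<open>x\<close> and \<open>y\<close>. Where \<open>S \<le> R\<close>, either the distance is at most \<open>\<eta>\<close> or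
  the gap estimate controls it; where \<open>S > R\<close>, the distance is at most \<open>S\<close>, which is at most
  \<open>R powr (1 - p) * S powr p\<close>.\<close>

lemma norm_diff_le_midpoint_gap:
  fixes x y :: "'e::real_inner"
  assumes "1 < p" "0 < \<eta>" "0 < R"
  shows "norm (x - y) \<le> R ^ 3 / \<eta> * (smooth_norm x + smooth_norm y - 2 * smooth_norm ((1 / 2) *\<^sub>R (x + y)))
      + \<eta> + R powr (1 - p) * (smooth_norm x + smooth_norm y) powr p"
proof -
  define S where "S = smooth_norm x + smooth_norm y"
  define g where "g = S - 2 * smooth_norm ((1 / 2) *\<^sub>R (x + y))"
  define d where "d = norm (x - y)"
  have S: "S \<ge> 2" using smooth_norm_bounds(1)[of x] smooth_norm_bounds(1)[of y] by (simp add: S_def)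
  have dS: "d \<le> S" using smooth_norm_bounds(2)[of x] smooth_norm_bounds(2)[of y] norm_triangle_ineq4[of x y]
    by (simp add: S_def d_def)
  have key: "d\<^sup>2 \<le> S ^ 3 * g" using smooth_norm_midpoint_gap[of x y] by (simp add: S_def g_def d_def)
  have g: "g \<ge> 0"
  proof (rule ccontr)
    assume "\<not> g \<ge> 0"
    then have "S ^ 3 * g < 0" using S by (intro mult_pos_neg) auto
    then show False using key zero_le_power2[of d] by linarith
  qed
  have "d \<le> R ^ 3 / \<eta> * g + \<eta> + R powr (1 - p) * S powr p"
  proof (cases "S \<le> R")
    case True
    have "d \<le> R ^ 3 / \<eta> * g + \<eta>"
    proof (cases "d \<le> \<eta>")
      case True then show ?thesis using g assms by (simp add: add_increasing)
    next
      case False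
      have "d * \<eta> \<le> d\<^sup>2" using False assms unfolding power2_eq_square by (intro mult_left_mono) (auto simp: d_def)
      also have "\<dots> \<le> R ^ 3 * g"
        using key mult_right_mono[OF power_mono[OF True, of 3] g] S by linarith
      finally have "d \<le> R ^ 3 / \<eta> * g" using assms by (simp add: field_simps)
      then show ?thesis using assms by simp
    qed
    then show ?thesis by (simp add: add_increasing2)
  next
    case False
    have "S = S powr (1 - p) * S powr p" using S by (simp flip: powr_add)
    also have "\<dots> \<le> R powr (1 - p) * S powr p"
      using False assms by (intro mult_right_mono powr_mono2') auto
    finally have "d \<le> R powr (1 - p) * S powr p" using dS by simp
    then show ?thesis using g assms by (smt (verit) divide_nonneg_pos mult_nonneg_nonneg zero_le_power)
  qed
  then show ?thesis by (simp add: S_def g_def d_def)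
qed

text \<open>Choose \<open>w n \<in> K n\<close> whose integral of \<open>smooth_norm\<close> is within \<open>1 / (n + 1)\<close> of the infimum \<open>m n\<close>
  over \<open>K n\<close>. For \<open>i, j \<ge> N\<close> the functions \<open>w i\<close>, \<open>w j\<close> and their midpoint all lie in \<open>K N\<close>, so
  the midpoint gap has integral at most \<open>2 * (l - m N) + 2 / (N + 1)\<close>, where \<open>l\<close> is the limit of
  the bounded increasing sequence \<open>m\<close>. With the bound in \<open>L\<^sup>p\<close> the sequence is Cauchy in \<open>L\<^sup>1\<close>.\<close>

lemma (in finite_measure) AE_convergent_selection:
  fixes K :: "nat \<Rightarrow> ('a \<Rightarrow> 'e::euclidean_space) set"
  assumes p: "1 < p"
    and ne: "\<And>n. K n \<noteq> {}" and dec: "\<And>m n. m \<le> n \<Longrightarrow> K n \<subseteq> K m"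
    and mid: "\<And>n v w. v \<in> K n \<Longrightarrow> w \<in> K n \<Longrightarrow> (\<lambda>x. (1 / 2) *\<^sub>R (v x + w x)) \<in> K n"
    and Km: "\<And>v. v \<in> K 0 \<Longrightarrow> v \<in> borel_measurable M"
    and Ki: "\<And>v. v \<in> K 0 \<Longrightarrow> integrable M (\<lambda>x. norm (v x) powr p)"
    and KB: "\<And>v. v \<in> K 0 \<Longrightarrow> (\<integral>x. norm (v x) powr p \<partial>M) \<le> B"
  obtains w v where "\<And>n. w n \<in> K n" "v \<in> borel_measurable M" "AE x in M. (\<lambda>n. w n x) \<longlonglongrightarrow> v x"
proof -
  define \<mu> where "\<mu> = measure M (space M)"
  define \<Phi> where "\<Phi> = (\<lambda>v::'a \<Rightarrow> 'e. \<integral>x. smooth_norm (v x) \<partial>M)"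
  have K0: "v \<in> K 0" if "v \<in> K n" for v n using dec[of 0 n] that by auto
  have powr_le: "s \<le> 1 + s powr p" if "s \<ge> 0" for s :: real
  proof (cases "s \<le> 1")
    case False
    then have "s powr 1 \<le> s powr p" using p by (intro powr_mono) auto
    then show ?thesis using False by simp
  qed (simp add: add_increasing2)
  have sn_le: "smooth_norm (v x) \<le> 2 + norm (v x) powr p" for v :: "'a \<Rightarrow> 'e" and x
    using smooth_norm_bounds(3)[of "v x"] powr_le[of "norm (v x)"] by simp
  have sn_nn: "0 \<le> smooth_norm z" for z :: 'e using smooth_norm_bounds(1)[of z] by linarith
  have sn_i: "integrable M (\<lambda>x. smooth_norm (v x))" if "v \<in> K 0" for v
  proof (rule Bochner_Integration.integrable_bound)
    show "integrable M (\<lambda>x. 2 + norm (v x) powr p)" using Ki[OF that] by simp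
    show "(\<lambda>x. smooth_norm (v x)) \<in> borel_measurable M" using Km[OF that] by measurable
    show "AE x in M. norm (smooth_norm (v x)) \<le> norm (2 + norm (v x) powr p)"
      using sn_le[of v] sn_nn by (intro AE_I2) (auto intro: order_trans)
  qed
  have \<Phi>_nn: "0 \<le> \<Phi> v" for v unfolding \<Phi>_def using sn_nn by (intro Bochner_Integration.integral_nonneg) auto
  have \<Phi>_le: "\<Phi> v \<le> 2 * \<mu> + B" if "v \<in> K 0" for v
  proof -
    have "\<Phi> v \<le> (\<integral>x. 2 + norm (v x) powr p \<partial>M)"
      unfolding \<Phi>_def using sn_i[OF that] Ki[OF that] sn_le by (intro integral_mono) auto
    also have "\<dots> = 2 * \<mu> + (\<integral>x. norm (v x) powr p \<partial>M)" using Ki[OF that] by (simp add: \<mu>_def)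
    finally show ?thesis using KB[OF that] by simp
  qed
  define m where "m = (\<lambda>n. Inf (\<Phi> ` K n))"
  have bdd: "bdd_below (\<Phi> ` K n)" for n using \<Phi>_nn by (intro bdd_belowI[of _ 0]) auto
  have m_le: "m n \<le> \<Phi> v" if "v \<in> K n" for n v
    unfolding m_def using that bdd by (intro cInf_lower) auto
  have inc: "incseq m"
    unfolding incseq_def m_def using ne dec bdd by (intro allI impI cInf_superset_mono image_mono) auto
  have m_bd: "m n \<le> 2 * \<mu> + B" for n
  proof -
    obtain v where "v \<in> K n" using ne by blast
    then show ?thesis using m_le[of v n] \<Phi>_le[of v] K0[of v n] by simp
  qed
  obtain l where l: "m \<longlonglongrightarrow> l" "\<And>n. m n \<le> l"
    using incseq_convergent[OF inc, of "2 * \<mu> + B"] m_bd by blast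
  have "\<exists>v\<in>K n. \<Phi> v < m n + 1 / real (Suc n)" for n
    using cInf_lessD[of "\<Phi> ` K n" "m n + 1 / real (Suc n)"] ne[of n] by (auto simp: m_def)
  then obtain w where w: "\<And>n. w n \<in> K n" "\<And>n. \<Phi> (w n) < m n + 1 / real (Suc n)" by metis
  have wm[measurable]: "w n \<in> borel_measurable M" for n using w(1) K0 Km by blast
  define gap where "gap = (\<lambda>i j x. smooth_norm (w i x) + smooth_norm (w j x)
      - 2 * smooth_norm ((1 / 2) *\<^sub>R (w i x + w j x)))"
  define mi where "mi = (\<lambda>i j x. (1 / 2) *\<^sub>R (w i x + w j x))"
  have gap_eq: "gap i j x = smooth_norm (w i x) + smooth_norm (w j x) - 2 * smooth_norm (mi i j x)" for i j x
    by (simp add: gap_def mi_def)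
  have miK: "mi i j \<in> K N" if "i \<ge> N" "j \<ge> N" for i j N
    using mid[of "w i" N "w j"] w(1) dec that unfolding mi_def by blast
  have gap_i: "integrable M (gap i j)" for i j
    unfolding gap_eq[abs_def]
    using sn_i[OF K0[OF w(1)]] sn_i[OF miK[of 0 i j]] by simp
  have gap_le: "(\<integral>x. gap i j x \<partial>M) \<le> 2 * (l - m N) + 2 / real (Suc N)" if "i \<ge> N" "j \<ge> N" for i j N
  proof -
    have "(\<integral>x. gap i j x \<partial>M) = \<Phi> (w i) + \<Phi> (w j) - 2 * \<Phi> (mi i j)"
      unfolding gap_eq[abs_def] \<Phi>_def
      using sn_i[OF K0[OF w(1)]] sn_i[OF miK[of 0 i j]] by simp
    moreover have "\<Phi> (w i') \<le> l + 1 / real (Suc N)" if "i' \<ge> N" for i'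
    proof -
      have "1 / real (Suc i') \<le> 1 / real (Suc N)" using that by (intro divide_left_mono) auto
      then show ?thesis using w(2)[of i'] l(2)[of i'] by linarith
    qed
    moreover have "m N \<le> \<Phi> (mi i j)" using m_le miK that by blast
    ultimately show ?thesis using that by (smt (verit) add_divide_distrib)
  qed
  define A where "A = 2 powr p * (2 * (2 powr p * (\<mu> + B)))"
  have Sp_i: "integrable M (\<lambda>x. (smooth_norm (w i x) + smooth_norm (w j x)) powr p)"
    and Sp_le: "(\<integral>x. (smooth_norm (w i x) + smooth_norm (w j x)) powr p \<partial>M) \<le> A" for i j
  proof -
    have two: "(s + t) powr p \<le> 2 powr p * (s powr p + t powr p)" if "0 \<le> s" "0 \<le> t" for s t :: real
    proof -
      have "(s + t) powr p \<le> (2 * max s t) powr p" using that p by (intro powr_mono2) auto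
      also have "\<dots> = 2 powr p * (max s t) powr p" by (simp add: powr_mult)
      also have "\<dots> \<le> 2 powr p * (s powr p + t powr p)" by (intro mult_left_mono) (auto simp: max_def)
      finally show ?thesis .
    qed
    have one: "smooth_norm (w i x) powr p \<le> 2 powr p * (1 + norm (w i x) powr p)" for i x
    proof -
      have "smooth_norm (w i x) powr p \<le> (1 + norm (w i x)) powr p"
        using smooth_norm_bounds(3) sn_nn p by (intro powr_mono2) auto
      then show ?thesis using two[of 1 "norm (w i x)"] by simp
    qed
    have le: "(smooth_norm (w i x) + smooth_norm (w j x)) powr p
        \<le> 2 powr p * (2 powr p * (1 + norm (w i x) powr p) + 2 powr p * (1 + norm (w j x) powr p))" for x
    proof -
      have "(smooth_norm (w i x) + smooth_norm (w j x)) powr p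
        \<le> 2 powr p * (smooth_norm (w i x) powr p + smooth_norm (w j x) powr p)"
        using two sn_nn by blast
      also have "\<dots> \<le> 2 powr p * (2 powr p * (1 + norm (w i x) powr p) + 2 powr p * (1 + norm (w j x) powr p))"
        by (intro mult_left_mono add_mono one) simp
      finally show ?thesis .
    qed
    have ii: "integrable M (\<lambda>x. norm (w i x) powr p)" for i using Ki K0 w(1) by blast
    have Ri: "integrable M (\<lambda>x. 2 powr p * (2 powr p * (1 + norm (w i x) powr p) + 2 powr p * (1 + norm (w j x) powr p)))"
      using ii by simp
    show 1: "integrable M (\<lambda>x. (smooth_norm (w i x) + smooth_norm (w j x)) powr p)"
      by (rule Bochner_Integration.integrable_bound[OF Ri]) (use le in \<open>auto intro!: AE_I2 intro: order_trans\<close>)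
    have "(\<integral>x. (smooth_norm (w i x) + smooth_norm (w j x)) powr p \<partial>M)
       \<le> (\<integral>x. 2 powr p * (2 powr p * (1 + norm (w i x) powr p) + 2 powr p * (1 + norm (w j x) powr p)) \<partial>M)"
      using 1 Ri le by (rule integral_mono)
    also have "\<dots> = 2 powr p * (2 powr p * (\<mu> + (\<integral>x. norm (w i x) powr p \<partial>M)) + 2 powr p * (\<mu> + (\<integral>x. norm (w j x) powr p \<partial>M)))"
      using ii by (simp add: \<mu>_def)
    also have "\<dots> \<le> 2 powr p * (2 powr p * (\<mu> + B) + 2 powr p * (\<mu> + B))"
      using KB K0 w(1) by (intro mult_left_mono add_mono order_refl) auto
    finally show "(\<integral>x. (smooth_norm (w i x) + smooth_norm (w j x)) powr p \<partial>M) \<le> A" by (simp add: A_def mult.commute)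
  qed
  have wi: "integrable M (w n)" for n
    by (rule Bochner_Integration.integrable_bound[OF sn_i[OF K0[OF w(1)[of n]]]])
       (use smooth_norm_bounds(2) sn_nn in auto)
  have cauchy: "\<exists>N. \<forall>i\<ge>N. \<forall>j\<ge>N. (\<integral>x. norm (w i x - w j x) \<partial>M) < e" if e: "e > 0" for e
  proof -
    have \<mu>: "\<mu> \<ge> 0" by (simp add: \<mu>_def)
    have A0: "A \<ge> 0" using Sp_le[of 0 0] by (rule order_trans[rotated]) simp
\<comment> \<open>the three error terms of \<open>norm_diff_le_midpoint_gap\<close> each receive \<open>e / 4\<close>: \<open>\<eta>\<close> and \<open>R\<close> are
    fixed first, then \<open>N\<close> is chosen for the gap term\<close>
    define \<eta> where "\<eta> = e / (4 * (\<mu> + 1))"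
    have \<eta>: "\<eta> > 0" "\<eta> * \<mu> \<le> e / 4" using e \<mu> by (auto simp: \<eta>_def field_simps)
    define R where "R = (e / (4 * (A + 1))) powr (1 / (1 - p))"
    have R: "R > 0" using e A0 by (simp add: R_def)
    have RA: "R powr (1 - p) * A \<le> e / 4" using e A0 p by (simp add: R_def powr_powr field_simps)
    have "(\<lambda>N. R ^ 3 / \<eta> * (2 * (l - m N) + 2 * (1 / real (Suc N)))) \<longlonglongrightarrow> R ^ 3 / \<eta> * (2 * (l - l) + 2 * 0)"
      by (intro tendsto_intros l LIMSEQ_Suc lim_1_over_n)
    then have "\<forall>\<^sub>F N in sequentially. R ^ 3 / \<eta> * (2 * (l - m N) + 2 * (1 / real (Suc N))) < e / 4"
      using e by (intro order_tendstoD(2)) auto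
    then obtain N where N: "R ^ 3 / \<eta> * (2 * (l - m N) + 2 / real (Suc N)) < e / 4"
      by (auto simp: eventually_sequentially)
    have "(\<integral>x. norm (w i x - w j x) \<partial>M) < e" if ij: "i \<ge> N" "j \<ge> N" for i j
    proof -
      have "(\<integral>x. norm (w i x - w j x) \<partial>M) \<le> (\<integral>x. R ^ 3 / \<eta> * gap i j x + \<eta>
          + R powr (1 - p) * (smooth_norm (w i x) + smooth_norm (w j x)) powr p \<partial>M)"
        using wi gap_i Sp_i norm_diff_le_midpoint_gap[OF p \<eta>(1) R]
        by (intro integral_mono) (auto simp: gap_def)
      also have "\<dots> = R ^ 3 / \<eta> * (\<integral>x. gap i j x \<partial>M) + \<eta> * \<mu>
          + R powr (1 - p) * (\<integral>x. (smooth_norm (w i x) + smooth_norm (w j x)) powr p \<partial>M)"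
        using gap_i Sp_i by (simp add: \<mu>_def)
      also have "\<dots> \<le> R ^ 3 / \<eta> * (2 * (l - m N) + 2 / real (Suc N)) + \<eta> * \<mu> + R powr (1 - p) * A"
        using gap_le[OF ij] Sp_le R \<eta> by (intro add_mono mult_left_mono order_refl) auto
      also have "\<dots> < e" using N \<eta> RA e by linarith
      finally show ?thesis .
    qed
    then show ?thesis by blast
  qed
  obtain r where r: "strict_mono r" "AE x in M. Cauchy (\<lambda>i. w (r i) x)"
    using cauchy_L1_AE_cauchy_subseq[of M w] wi cauchy by blast
  show ?thesis
  proof
    show "w (r n) \<in> K n" for n
      using w(1)[of "r n"] dec[of n "r n"] strict_mono_imp_increasing[OF r(1)] by blast
    show "(\<lambda>x. lim (\<lambda>n. w (r n) x)) \<in> borel_measurable M" by measurable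
    show "AE x in M. (\<lambda>n. w (r n) x) \<longlonglongrightarrow> lim (\<lambda>n. w (r n) x)"
      using r(2) by eventually_elim (metis Cauchy_convergent convergent_LIMSEQ_iff)
  qed
qed

section \<open>The Riemann-Liouville kernel\<close>

definition RL_kernel :: "real \<Rightarrow> real \<Rightarrow> real" where
  "RL_kernel \<beta> s = (if 0 < s then s powr (\<beta> - 1) / Gamma \<beta> else 0)"

lemma borel_measurable_RL_kernel[measurable]: "RL_kernel \<beta> \<in> borel_measurable borel"
  unfolding RL_kernel_def by measurable

lemma RL_kernel_nonneg: "0 < \<beta> \<Longrightarrow> 0 \<le> RL_kernel \<beta> s"
  unfolding RL_kernel_def by (simp add: Gamma_real_pos less_imp_le)

text \<open>A power of the kernel is a multiple of a kernel of another order, so that integrability of the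
  powers reduces to that of the kernels themselves.\<close>

lemma RL_kernel_powr:
  assumes "0 < \<beta>" "0 < (\<beta> - 1) * q + 1"
  shows "RL_kernel \<beta> s powr q
    = Gamma ((\<beta> - 1) * q + 1) / Gamma \<beta> powr q * RL_kernel ((\<beta> - 1) * q + 1) s"
proof (cases "0 < s")
  case True
  have "Gamma \<beta> > 0" "Gamma ((\<beta> - 1) * q + 1) > 0" using assms by (auto intro: Gamma_real_pos)
  then show ?thesis using True by (simp add: RL_kernel_def powr_divide powr_powr)
qed (simp add: RL_kernel_def)

lemma nn_integral_RL_kernel:
  assumes "0 < \<beta>" "0 \<le> T"
  shows "(\<integral>\<^sup>+s. ennreal (RL_kernel \<beta> s * indicator {0..T} s) \<partial>lborel) = ennreal (T powr \<beta> / (\<beta> * Gamma \<beta>))"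
proof -
  have G: "Gamma \<beta> > 0" using assms by (intro Gamma_real_pos)
  have "((\<lambda>x. x powr (\<beta> - 1)) has_integral (T powr (\<beta> - 1 + 1) / (\<beta> - 1 + 1))) {0..T}"
    using assms by (intro has_integral_powr_from_0) auto
  from has_integral_divide[OF this, of "Gamma \<beta>"]
  have "((\<lambda>x. x powr (\<beta> - 1) / Gamma \<beta>) has_integral (T powr \<beta> / \<beta> / Gamma \<beta>)) {0..T}" by simp
  then have "(\<integral>\<^sup>+x. ennreal (indicator {0..T} x * (x powr (\<beta> - 1) / Gamma \<beta>)) \<partial>lborel) = ennreal (T powr \<beta> / \<beta> / Gamma \<beta>)"
    using G by (intro nn_integral_has_integral_lebesgue) auto
  moreover have "(\<integral>\<^sup>+s. ennreal (RL_kernel \<beta> s * indicator {0..T} s) \<partial>lborel)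
      = (\<integral>\<^sup>+x. ennreal (indicator {0..T} x * (x powr (\<beta> - 1) / Gamma \<beta>)) \<partial>lborel)"
    by (intro nn_integral_cong) (auto simp: RL_kernel_def indicator_def)
  ultimately show ?thesis by simp
qed

text \<open>The substitution \<open>s = \<xi> + (t - \<xi>) * y\<close> turns the integral into the Beta integral with
  parameters \<open>\<alpha>\<close> and \<open>1 - \<alpha>\<close>, and its powers of \<open>t - \<xi>\<close> cancel. The sign \<open>\<sigma>\<close> covers the left
  (\<open>\<sigma> = 1\<close>) and the right (\<open>\<sigma> = -1\<close>) operators at once.\<close>

lemma nn_integral_RL_kernel_convolution:
  assumes \<alpha>: "0 < \<alpha>" "\<alpha> < 1" and \<sigma>: "\<bar>\<sigma>\<bar> = 1"
  shows "(\<integral>\<^sup>+s. ennreal (RL_kernel (1 - \<alpha>) (\<sigma> * (t - s)) * RL_kernel \<alpha> (\<sigma> * (s - \<xi>))) \<partial>lborel)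
    = indicator {0<..} (\<sigma> * (t - \<xi>))"
proof (cases "0 < \<sigma> * (t - \<xi>)")
  case False
  have z: "RL_kernel (1 - \<alpha>) (\<sigma> * (t - s)) * RL_kernel \<alpha> (\<sigma> * (s - \<xi>)) = 0" for s
  proof -
    have "\<sigma> * (t - s) + \<sigma> * (s - \<xi>) = \<sigma> * (t - \<xi>)" by (simp add: algebra_simps)
    then have "\<not> (0 < \<sigma> * (t - s) \<and> 0 < \<sigma> * (s - \<xi>))" using False by linarith
    then show ?thesis by (auto simp: RL_kernel_def)
  qed
  show ?thesis unfolding z using False by simp
next
  case True
  define T where "T = \<sigma> * (t - \<xi>)"
  have T: "T > 0" using True by (simp add: T_def)
  have \<sigma>2: "\<sigma> = 1 \<or> \<sigma> = -1" using \<sigma> by linarith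
  then have T_abs: "\<bar>t - \<xi>\<bar> = T" using T by (auto simp: T_def)
  have G: "Gamma \<alpha> > 0" "Gamma (1 - \<alpha>) > 0" using \<alpha> by (auto intro!: Gamma_real_pos)
  have "(\<integral>\<^sup>+s. ennreal (RL_kernel (1 - \<alpha>) (\<sigma> * (t - s)) * RL_kernel \<alpha> (\<sigma> * (s - \<xi>))) \<partial>lborel)
    = ennreal \<bar>t - \<xi>\<bar> * (\<integral>\<^sup>+y. ennreal (RL_kernel (1 - \<alpha>) (\<sigma> * (t - (\<xi> + (t - \<xi>) * y)))
        * RL_kernel \<alpha> (\<sigma> * (\<xi> + (t - \<xi>) * y - \<xi>))) \<partial>lborel)"
    using T T_abs by (intro nn_integral_real_affine) auto
  also have "\<dots> = (\<integral>\<^sup>+y. ennreal T * ennreal (RL_kernel (1 - \<alpha>) (\<sigma> * (t - (\<xi> + (t - \<xi>) * y)))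
        * RL_kernel \<alpha> (\<sigma> * (\<xi> + (t - \<xi>) * y - \<xi>))) \<partial>lborel)"
    unfolding T_abs by (subst nn_integral_cmult) auto
  also have "\<dots> = (\<integral>\<^sup>+y. ennreal (indicator {0..1} y * (y powr (\<alpha> - 1) * (1 - y) powr ((1 - \<alpha>) - 1)
      / (Gamma \<alpha> * Gamma (1 - \<alpha>)))) \<partial>lborel)"
  proof (rule nn_integral_cong_AE)
    have "AE y in lborel. y \<noteq> 0 \<and> y \<noteq> (1::real)" by (auto intro: AE_lborel_singleton)
    then show "AE y in lborel. ennreal T * ennreal (RL_kernel (1 - \<alpha>) (\<sigma> * (t - (\<xi> + (t - \<xi>) * y)))
        * RL_kernel \<alpha> (\<sigma> * (\<xi> + (t - \<xi>) * y - \<xi>)))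
      = ennreal (indicator {0..1} y * (y powr (\<alpha> - 1) * (1 - y) powr ((1 - \<alpha>) - 1)
      / (Gamma \<alpha> * Gamma (1 - \<alpha>))))"
    proof eventually_elim
      case (elim y)
      have e1: "\<sigma> * (t - (\<xi> + (t - \<xi>) * y)) = T * (1 - y)" and e2: "\<sigma> * (\<xi> + (t - \<xi>) * y - \<xi>) = T * y"
        by (simp_all add: T_def algebra_simps)
      have "T * (RL_kernel (1 - \<alpha>) (T * (1 - y)) * RL_kernel \<alpha> (T * y))
        = indicator {0..1} y * (y powr (\<alpha> - 1) * (1 - y) powr ((1 - \<alpha>) - 1) / (Gamma \<alpha> * Gamma (1 - \<alpha>)))"
      proof (cases "0 < y \<and> y < 1")
        case True
        have "T * (T powr (- \<alpha>) * T powr (\<alpha> - 1)) = 1"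
        proof -
          have "T * (T powr (- \<alpha>) * T powr (\<alpha> - 1)) = T powr 1 * (T powr (- \<alpha>) * T powr (\<alpha> - 1))"
            using T by simp
          also have "\<dots> = T powr (1 + (- \<alpha> + (\<alpha> - 1)))" by (simp only: powr_add)
          finally show ?thesis using T by simp
        qed
        moreover have "T * (RL_kernel (1 - \<alpha>) (T * (1 - y)) * RL_kernel \<alpha> (T * y))
          = (T * (T powr (- \<alpha>) * T powr (\<alpha> - 1))) * (y powr (\<alpha> - 1) * (1 - y) powr (- \<alpha>) / (Gamma \<alpha> * Gamma (1 - \<alpha>)))"
          using True T by (simp add: RL_kernel_def powr_mult mult_ac)
        ultimately show ?thesis using True by simp
      next
        case False
        then have "y < 0 \<or> y > 1" using elim by linarith
        then show ?thesis using T by (auto simp: RL_kernel_def zero_less_mult_iff)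
      qed
      then show ?case unfolding e1 e2 using T by (simp flip: ennreal_mult')
    qed
  qed
  also have "\<dots> = ennreal 1"
  proof (rule nn_integral_has_integral_lebesgue)
    have "((\<lambda>y. y powr (\<alpha> - 1) * (1 - y) powr ((1 - \<alpha>) - 1) / (Gamma \<alpha> * Gamma (1 - \<alpha>)))
        has_integral Beta \<alpha> (1 - \<alpha>) / (Gamma \<alpha> * Gamma (1 - \<alpha>))) {0..1}"
      using \<alpha> by (intro has_integral_divide has_integral_Beta_real) auto
    then show "((\<lambda>y. y powr (\<alpha> - 1) * (1 - y) powr ((1 - \<alpha>) - 1) / (Gamma \<alpha> * Gamma (1 - \<alpha>))) has_integral 1) {0..1}"
      using G by (simp add: Beta_def)
  qed (use G in auto)
  finally show ?thesis using True by simp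
qed

section \<open>Fractional integrals over a bounded interval\<close>

locale bounded_interval =
  fixes a b :: real
  assumes ab: "a < b"
begin

text \<open>Lebesgue measure on \<open>(a, b)\<close>, as a density on the whole line: its measurable functions are then
  the Borel functions on the line.\<close>

definition M :: "real measure" where
  "M = density lborel (\<lambda>t. ennreal (indicator {a<..<b} t))"

lemma sets_M[measurable_cong, simp]: "sets M = sets borel"
  by (simp add: M_def)

lemma space_M[simp]: "space M = UNIV"
  by (simp add: M_def)

lemma measurable_M_iff[simp]: "measurable M N = measurable borel N"
  by (rule measurable_cong_sets) auto

lemma nn_integral_M: "f \<in> borel_measurable borel \<Longrightarrow>
    (\<integral>\<^sup>+t. f t \<partial>M) = (\<integral>\<^sup>+t. ennreal (indicator {a<..<b} t) * f t \<partial>lborel)"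
  unfolding M_def by (subst nn_integral_density) auto

lemma integral_M: "f \<in> borel_measurable borel \<Longrightarrow> (\<integral>t. f t \<partial>M) = (LINT t:{a<..<b}|lborel. f t)"
  for f :: "real \<Rightarrow> 'e::{banach, second_countable_topology}"
  unfolding M_def set_lebesgue_integral_def by (subst integral_density) auto

lemma integrable_M: "f \<in> borel_measurable borel \<Longrightarrow> integrable M f \<longleftrightarrow> set_integrable lborel {a<..<b} f"
  for f :: "real \<Rightarrow> 'e::{banach, second_countable_topology}"
  unfolding M_def set_integrable_def by (subst integrable_density) auto

lemma AE_M: "(AE t in M. P t) \<longleftrightarrow> (AE t\<in>{a<..<b} in lborel. P t)"
  unfolding M_def by (subst AE_density) (auto simp: indicator_def)

lemma AE_M_interval: "AE t in M. t \<in> {a<..<b}"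
  unfolding AE_M by simp

lemma emeasure_M: "emeasure M UNIV = ennreal (b - a)"
proof -
  have "emeasure M UNIV = (\<integral>\<^sup>+t. ennreal (indicator {a<..<b} t) \<partial>lborel)"
    unfolding M_def by (subst emeasure_density) auto
  also have "\<dots> = emeasure lborel {a<..<b}"
    by (simp add: ennreal_indicator)
  finally show ?thesis using ab by simp
qed

sublocale finite_measure M
  by (rule finite_measureI) (simp add: emeasure_M)

lemmas M_nn_integral_fst = nn_integral_fst

sublocale pair_sigma_finite M M ..

lemma measure_M: "measure M UNIV = b - a"
  unfolding measure_def using ab by (simp add: emeasure_M)

text \<open>The left fractional integral for \<open>\<sigma> = 1\<close>, the right one for \<open>\<sigma> = -1\<close>.\<close>

definition frac_int :: "real \<Rightarrow> real \<Rightarrow> (real \<Rightarrow> 'e::{banach, second_countable_topology}) \<Rightarrow> real \<Rightarrow> 'e" where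
  "frac_int \<sigma> \<beta> f t = (\<integral>\<xi>. RL_kernel \<beta> (\<sigma> * (t - \<xi>)) *\<^sub>R f \<xi> \<partial>M)"

lemma borel_measurable_frac_int[measurable]:
  assumes [measurable]: "f \<in> borel_measurable borel"
  shows "frac_int \<sigma> \<beta> f \<in> borel_measurable borel"
  unfolding frac_int_def by measurable

lemma RL_int_eq_frac_int:
  fixes f g :: "real \<Rightarrow> 'e::euclidean_space"
  assumes [measurable]: "g \<in> borel_measurable borel" and fg: "\<And>\<xi>. \<xi> \<in> {a<..<b} \<Longrightarrow> f \<xi> = g \<xi>"
    and t: "t \<in> {a<..<b}"
  shows "RL_int_left a \<beta> f t = frac_int 1 \<beta> g t" "RL_int_right b \<beta> f t = frac_int (-1) \<beta> g t"
proof -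
  have eq: "indicat_real A \<xi> *\<^sub>R (c *\<^sub>R f \<xi>) = indicat_real A \<xi> *\<^sub>R (c *\<^sub>R g \<xi>)"
    if "A \<subseteq> {a<..<b}" for A c \<xi>
    using fg that by (cases "\<xi> \<in> A") auto
  have sub: "{a<..<t} \<subseteq> {a<..<b}" "{t<..<b} \<subseteq> {a<..<b}" using t by auto
  have "RL_int_left a \<beta> f t
      = (1 / Gamma \<beta>) *\<^sub>R (\<integral>\<xi>. indicator {a<..<t} \<xi> *\<^sub>R ((t - \<xi>) powr (\<beta> - 1) *\<^sub>R g \<xi>) \<partial>lebesgue)"
    unfolding RL_int_left_def set_lebesgue_integral_def eq[OF sub(1)] eq[OF sub(2)] ..
  also have "\<dots> = (1 / Gamma \<beta>) *\<^sub>R (\<integral>\<xi>. indicator {a<..<t} \<xi> *\<^sub>R ((t - \<xi>) powr (\<beta> - 1) *\<^sub>R g \<xi>) \<partial>lborel)"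
    by (subst integral_completion) auto
  also have "\<dots> = frac_int 1 \<beta> g t"
    unfolding frac_int_def
    by (subst integral_M; (measurable)?)
       (auto simp: set_lebesgue_integral_def RL_kernel_def indicator_def t simp flip: integral_scaleR_right
             intro!: Bochner_Integration.integral_cong; use t in auto)
  finally show "RL_int_left a \<beta> f t = frac_int 1 \<beta> g t" .
  have "RL_int_right b \<beta> f t
      = (1 / Gamma \<beta>) *\<^sub>R (\<integral>\<xi>. indicator {t<..<b} \<xi> *\<^sub>R ((\<xi> - t) powr (\<beta> - 1) *\<^sub>R g \<xi>) \<partial>lebesgue)"
    unfolding RL_int_right_def set_lebesgue_integral_def eq[OF sub(1)] eq[OF sub(2)] ..
  also have "\<dots> = (1 / Gamma \<beta>) *\<^sub>R (\<integral>\<xi>. indicator {t<..<b} \<xi> *\<^sub>R ((\<xi> - t) powr (\<beta> - 1) *\<^sub>R g \<xi>) \<partial>lborel)"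
    by (subst integral_completion) auto
  also have "\<dots> = frac_int (-1) \<beta> g t"
    unfolding frac_int_def
    by (subst integral_M; (measurable)?)
       (auto simp: set_lebesgue_integral_def RL_kernel_def indicator_def t simp flip: integral_scaleR_right
             intro!: Bochner_Integration.integral_cong; use t in auto)
  finally show "RL_int_right b \<beta> f t = frac_int (-1) \<beta> g t" .
qed

lemma RL_kernel_integral_bound:
  assumes \<beta>: "0 < \<beta>" and \<sigma>: "\<bar>\<sigma>\<bar> = 1" and t: "t \<in> {a..b}"
  shows "(\<integral>\<^sup>+\<xi>. ennreal (RL_kernel \<beta> (\<sigma> * (t - \<xi>))) \<partial>M) \<le> ennreal ((b - a) powr \<beta> / (\<beta> * Gamma \<beta>))"
    and "integrable M (\<lambda>\<xi>. RL_kernel \<beta> (\<sigma> * (t - \<xi>)))"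
    and "(\<integral>\<xi>. RL_kernel \<beta> (\<sigma> * (t - \<xi>)) \<partial>M) \<le> (b - a) powr \<beta> / (\<beta> * Gamma \<beta>)"
proof -
  have \<sigma>2: "\<sigma> = 1 \<or> \<sigma> = -1" using \<sigma> by linarith
  have "(\<integral>\<^sup>+\<xi>. ennreal (RL_kernel \<beta> (\<sigma> * (t - \<xi>))) \<partial>M)
      = (\<integral>\<^sup>+\<xi>. ennreal (indicator {a<..<b} \<xi>) * ennreal (RL_kernel \<beta> (\<sigma> * (t - \<xi>))) \<partial>lborel)"
    by (subst nn_integral_M) auto
  also have "\<dots> \<le> (\<integral>\<^sup>+\<xi>. ennreal (RL_kernel \<beta> (\<sigma> * (t - \<xi>)) * indicator {0..b - a} (\<sigma> * (t - \<xi>))) \<partial>lborel)"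
  proof (intro nn_integral_mono)
    fix \<xi>
    show "ennreal (indicator {a<..<b} \<xi>) * ennreal (RL_kernel \<beta> (\<sigma> * (t - \<xi>)))
        \<le> ennreal (RL_kernel \<beta> (\<sigma> * (t - \<xi>)) * indicator {0..b - a} (\<sigma> * (t - \<xi>)))"
    proof (cases "a < \<xi> \<and> \<xi> < b \<and> 0 < \<sigma> * (t - \<xi>)")
      case True
      then have "\<sigma> * (t - \<xi>) \<in> {0..b - a}" using \<sigma>2 t by auto
      then show ?thesis using True by simp
    qed (auto simp: RL_kernel_def indicator_def)
  qed
  also have "\<dots> = (\<integral>\<^sup>+s. ennreal (RL_kernel \<beta> s * indicator {0..b - a} s) \<partial>lborel)"
  proof -
    have "(\<integral>\<^sup>+s. ennreal (RL_kernel \<beta> s * indicator {0..b - a} s) \<partial>lborel)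
      = ennreal \<bar>- \<sigma>\<bar> * (\<integral>\<^sup>+\<xi>. ennreal (RL_kernel \<beta> (\<sigma> * t + (- \<sigma>) * \<xi>) * indicator {0..b - a} (\<sigma> * t + (- \<sigma>) * \<xi>)) \<partial>lborel)"
      using \<sigma>2 by (intro nn_integral_real_affine) auto
    then show ?thesis using \<sigma> by (simp add: right_diff_distrib)
  qed
  also have "\<dots> = ennreal ((b - a) powr \<beta> / (\<beta> * Gamma \<beta>))"
    using \<beta> ab by (intro nn_integral_RL_kernel) auto
  finally show le: "(\<integral>\<^sup>+\<xi>. ennreal (RL_kernel \<beta> (\<sigma> * (t - \<xi>))) \<partial>M) \<le> ennreal ((b - a) powr \<beta> / (\<beta> * Gamma \<beta>))" .
  show i: "integrable M (\<lambda>\<xi>. RL_kernel \<beta> (\<sigma> * (t - \<xi>)))"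
    using RL_kernel_nonneg[OF \<beta>] by (intro integrableI_nonneg order.strict_trans1[OF le]) auto
  have "ennreal (\<integral>\<xi>. RL_kernel \<beta> (\<sigma> * (t - \<xi>)) \<partial>M) \<le> ennreal ((b - a) powr \<beta> / (\<beta> * Gamma \<beta>))"
    using le i RL_kernel_nonneg[OF \<beta>] by (subst (asm) nn_integral_eq_integral) auto
  then show "(\<integral>\<xi>. RL_kernel \<beta> (\<sigma> * (t - \<xi>)) \<partial>M) \<le> (b - a) powr \<beta> / (\<beta> * Gamma \<beta>)"
    using \<beta> by (subst (asm) ennreal_le_iff) (auto intro!: divide_nonneg_pos mult_pos_pos Gamma_real_pos)
qed

text \<open>Fubini's theorem and the convolution identity of the kernels. That identity bounds the double
  integral by the \<open>L\<^sup>1\<close> norm of \<open>f\<close> for each single \<open>t\<close>, so the equation holds at every \<open>t\<close>, although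
  the inner integral may diverge on a null set.\<close>

lemma frac_int_semigroup:
  fixes f :: "real \<Rightarrow> 'e::{banach, second_countable_topology}"
  assumes \<alpha>: "0 < \<alpha>" "\<alpha> < 1" and \<sigma>: "\<bar>\<sigma>\<bar> = 1" and fi: "integrable M f" and t: "t \<in> {a<..<b}"
  shows "frac_int \<sigma> (1 - \<alpha>) (frac_int \<sigma> \<alpha> f) t = (\<integral>\<xi>. indicator {0<..} (\<sigma> * (t - \<xi>)) *\<^sub>R f \<xi> \<partial>M)"
proof -
  have \<sigma>2: "\<sigma> = 1 \<or> \<sigma> = -1" using \<sigma> by linarith
  have [measurable]: "f \<in> borel_measurable borel" using borel_measurable_integrable[OF fi] by simp
  define k where "k = (\<lambda>s \<xi>. RL_kernel (1 - \<alpha>) (\<sigma> * (t - s)) * RL_kernel \<alpha> (\<sigma> * (s - \<xi>)))"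
  have [measurable]: "(\<lambda>(s, \<xi>). k s \<xi>) \<in> borel_measurable (borel \<Otimes>\<^sub>M borel)" unfolding k_def by measurable
  have k0: "0 \<le> k s \<xi>" for s \<xi> unfolding k_def using \<alpha> by (intro mult_nonneg_nonneg RL_kernel_nonneg) auto
  have kI: "(\<integral>\<^sup>+s. ennreal (k s \<xi>) \<partial>M) = indicator {0<..} (\<sigma> * (t - \<xi>))" if \<xi>: "\<xi> \<in> {a<..<b}" for \<xi>
  proof -
    have "(\<integral>\<^sup>+s. ennreal (k s \<xi>) \<partial>M) = (\<integral>\<^sup>+s. ennreal (indicator {a<..<b} s) * ennreal (k s \<xi>) \<partial>lborel)"
      by (subst nn_integral_M) auto
    also have "\<dots> = (\<integral>\<^sup>+s. ennreal (k s \<xi>) \<partial>lborel)"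
    proof (intro nn_integral_cong)
      fix s
      have "s \<in> {a<..<b}" if "k s \<xi> \<noteq> 0"
        using that \<xi> t \<sigma>2 by (auto simp: k_def RL_kernel_def split: if_splits)
      then show "ennreal (indicator {a<..<b} s) * ennreal (k s \<xi>) = ennreal (k s \<xi>)"
        by (cases "k s \<xi> = 0") (auto simp: indicator_def)
    qed
    also have "\<dots> = indicator {0<..} (\<sigma> * (t - \<xi>))"
      unfolding k_def by (rule nn_integral_RL_kernel_convolution[OF \<alpha> \<sigma>])
    finally show ?thesis .
  qed
  have int: "integrable (M \<Otimes>\<^sub>M M) (\<lambda>(s, \<xi>). k s \<xi> *\<^sub>R f \<xi>)"
  proof (rule integrableI_bounded)
    show "(\<lambda>(s, \<xi>). k s \<xi> *\<^sub>R f \<xi>) \<in> borel_measurable (M \<Otimes>\<^sub>M M)" by measurable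
    have "(\<integral>\<^sup>+x. ennreal (norm (case x of (s, \<xi>) \<Rightarrow> k s \<xi> *\<^sub>R f \<xi>)) \<partial>(M \<Otimes>\<^sub>M M))
        = (\<integral>\<^sup>+\<xi>. \<integral>\<^sup>+s. ennreal (norm (k s \<xi> *\<^sub>R f \<xi>)) \<partial>M \<partial>M)"
      by (subst nn_integral_snd[symmetric]) auto
    also have "\<dots> = (\<integral>\<^sup>+\<xi>. indicator {0<..} (\<sigma> * (t - \<xi>)) * ennreal (norm (f \<xi>)) \<partial>M)"
    proof (rule nn_integral_cong_AE)
      show "AE \<xi> in M. (\<integral>\<^sup>+s. ennreal (norm (k s \<xi> *\<^sub>R f \<xi>)) \<partial>M) = indicator {0<..} (\<sigma> * (t - \<xi>)) * ennreal (norm (f \<xi>))"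
        using AE_M_interval
      proof eventually_elim
        case (elim \<xi>)
        have "(\<integral>\<^sup>+s. ennreal (norm (k s \<xi> *\<^sub>R f \<xi>)) \<partial>M) = (\<integral>\<^sup>+s. ennreal (k s \<xi>) * ennreal (norm (f \<xi>)) \<partial>M)"
          using k0 by (intro nn_integral_cong) (simp add: ennreal_mult)
        also have "\<dots> = (\<integral>\<^sup>+s. ennreal (k s \<xi>) \<partial>M) * ennreal (norm (f \<xi>))"
          by (subst nn_integral_multc) auto
        finally show ?case using kI[OF elim] by simp
      qed
    qed
    also have "\<dots> \<le> (\<integral>\<^sup>+\<xi>. ennreal (norm (f \<xi>)) \<partial>M)"
      by (intro nn_integral_mono) (auto simp: indicator_def)
    also have "\<dots> < \<infinity>" using fi by (simp add: integrable_iff_bounded)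
    finally show "(\<integral>\<^sup>+x. ennreal (norm (case x of (s, \<xi>) \<Rightarrow> k s \<xi> *\<^sub>R f \<xi>)) \<partial>(M \<Otimes>\<^sub>M M)) < \<infinity>" .
  qed
  have "frac_int \<sigma> (1 - \<alpha>) (frac_int \<sigma> \<alpha> f) t = (\<integral>s. \<integral>\<xi>. k s \<xi> *\<^sub>R f \<xi> \<partial>M \<partial>M)"
    unfolding frac_int_def k_def by (simp flip: integral_scaleR_right)
  also have "\<dots> = (\<integral>\<xi>. \<integral>s. k s \<xi> *\<^sub>R f \<xi> \<partial>M \<partial>M)"
    by (rule Fubini_integral[OF int, symmetric])
  also have "\<dots> = (\<integral>\<xi>. indicator {0<..} (\<sigma> * (t - \<xi>)) *\<^sub>R f \<xi> \<partial>M)"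
  proof (rule integral_cong_AE)
    show "(\<lambda>\<xi>. \<integral>s. k s \<xi> *\<^sub>R f \<xi> \<partial>M) \<in> borel_measurable M"
      by measurable
    show "(\<lambda>\<xi>. indicator {0<..} (\<sigma> * (t - \<xi>)) *\<^sub>R f \<xi>) \<in> borel_measurable M" by measurable
    show "AE \<xi> in M. (\<integral>s. k s \<xi> *\<^sub>R f \<xi> \<partial>M) = indicator {0<..} (\<sigma> * (t - \<xi>)) *\<^sub>R f \<xi>"
      using AE_M_interval
    proof eventually_elim
      case (elim \<xi>)
      have "has_bochner_integral M (\<lambda>s. k s \<xi>) (indicator {0<..} (\<sigma> * (t - \<xi>)))"
        using kI[OF elim] k0 by (intro has_bochner_integral_nn_integral) (auto simp: indicator_def)
      then have "has_bochner_integral M (\<lambda>s. k s \<xi> *\<^sub>R f \<xi>) (indicator {0<..} (\<sigma> * (t - \<xi>)) *\<^sub>R f \<xi>)"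
        by (rule has_bochner_integral_scaleR_left)
      then show ?case by (rule has_bochner_integral_integral_eq)
    qed
  qed
  finally show ?thesis .
qed

text \<open>Fubini's theorem for the kernel \<open>RL_kernel \<beta> (\<sigma> * (t - \<xi>))\<close>: exchanging \<open>t\<close> and \<open>\<xi>\<close> changes the
  sign of \<open>\<sigma>\<close>.\<close>

lemma frac_int_by_parts:
  fixes g h :: "real \<Rightarrow> 'e::euclidean_space"
  assumes \<beta>: "0 < \<beta>" and \<sigma>: "\<bar>\<sigma>\<bar> = 1" and gi: "integrable M g"
    and [measurable]: "h \<in> borel_measurable borel" and hB: "\<And>t. norm (h t) \<le> B"
  shows "(\<integral>t. g t \<bullet> frac_int \<sigma> \<beta> h t \<partial>M) = (\<integral>\<xi>. frac_int (- \<sigma>) \<beta> g \<xi> \<bullet> h \<xi> \<partial>M)"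
    and "integrable M (\<lambda>\<xi>. frac_int (- \<sigma>) \<beta> g \<xi> \<bullet> h \<xi>)"
    and "integrable M (\<lambda>t. g t \<bullet> frac_int \<sigma> \<beta> h t)"
proof -
  have [measurable]: "g \<in> borel_measurable borel" using borel_measurable_integrable[OF gi] by simp
  have B: "0 \<le> B" using hB[of 0] norm_ge_zero order_trans by blast
  define C where "C = (b - a) powr \<beta> / (\<beta> * Gamma \<beta>)"
  have C: "C \<ge> 0" unfolding C_def using \<beta> by (auto intro!: divide_nonneg_pos mult_pos_pos Gamma_real_pos)
  define k where "k = (\<lambda>t \<xi>. RL_kernel \<beta> (\<sigma> * (t - \<xi>)))"
  have k0: "0 \<le> k t \<xi>" for t \<xi> unfolding k_def using \<beta> by (rule RL_kernel_nonneg)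
  have [measurable]: "(\<lambda>(s, \<xi>). k s \<xi>) \<in> borel_measurable (borel \<Otimes>\<^sub>M borel)" unfolding k_def by measurable
  define F where "F = (\<lambda>t \<xi>. k t \<xi> * (g t \<bullet> h \<xi>))"
  have [measurable]: "case_prod F \<in> borel_measurable (borel \<Otimes>\<^sub>M borel)" unfolding F_def by measurable
  have int: "integrable (M \<Otimes>\<^sub>M M) (case_prod F)"
  proof (rule integrableI_bounded)
    show "case_prod F \<in> borel_measurable (M \<Otimes>\<^sub>M M)" by measurable
    have "(\<integral>\<^sup>+x. ennreal (norm (case_prod F x)) \<partial>(M \<Otimes>\<^sub>M M)) = (\<integral>\<^sup>+t. \<integral>\<^sup>+\<xi>. ennreal (norm (F t \<xi>)) \<partial>M \<partial>M)"
      using M_nn_integral_fst[of "\<lambda>x. ennreal (norm (case_prod F x))" M] by simp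
    also have "\<dots> \<le> (\<integral>\<^sup>+t. ennreal (C * B) * ennreal (norm (g t)) \<partial>M)"
    proof (rule nn_integral_mono_AE)
      show "AE t in M. (\<integral>\<^sup>+\<xi>. ennreal (norm (F t \<xi>)) \<partial>M) \<le> ennreal (C * B) * ennreal (norm (g t))"
        using AE_M_interval
      proof eventually_elim
        case (elim t)
        have "(\<integral>\<^sup>+\<xi>. ennreal (norm (F t \<xi>)) \<partial>M) \<le> (\<integral>\<^sup>+\<xi>. ennreal (k t \<xi>) * ennreal (B * norm (g t)) \<partial>M)"
        proof (intro nn_integral_mono)
          fix \<xi>
          have "norm (g t \<bullet> h \<xi>) \<le> B * norm (g t)"
            using Cauchy_Schwarz_ineq2[of "g t" "h \<xi>"] mult_left_mono[OF hB[of \<xi>], of "norm (g t)"]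
            by (simp add: mult.commute)
          then have "norm (F t \<xi>) \<le> k t \<xi> * (B * norm (g t))"
            unfolding F_def using k0[of t \<xi>] by (simp add: abs_mult mult_left_mono)
          then show "ennreal (norm (F t \<xi>)) \<le> ennreal (k t \<xi>) * ennreal (B * norm (g t))"
            using k0 B by (subst ennreal_mult[symmetric]) (auto intro: ennreal_leI)
        qed
        also have "\<dots> = (\<integral>\<^sup>+\<xi>. ennreal (k t \<xi>) \<partial>M) * ennreal (B * norm (g t))"
          by (subst nn_integral_multc) auto
        also have "\<dots> \<le> ennreal C * ennreal (B * norm (g t))"
          using RL_kernel_integral_bound(1)[OF \<beta> \<sigma>, of t] elim unfolding k_def C_def by (intro mult_right_mono) auto
        also have "\<dots> = ennreal (C * B) * ennreal (norm (g t))"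
          using B C by (simp add: ennreal_mult mult.assoc)
        finally show ?case .
      qed
    qed
    also have "\<dots> = ennreal (C * B) * (\<integral>\<^sup>+t. ennreal (norm (g t)) \<partial>M)"
      by (subst nn_integral_cmult) auto
    also have "\<dots> < \<infinity>" using gi by (simp add: integrable_iff_bounded ennreal_mult_less_top)
    finally show "(\<integral>\<^sup>+x. ennreal (norm (case_prod F x)) \<partial>(M \<Otimes>\<^sub>M M)) < \<infinity>" .
  qed
  have inner1: "(\<integral>\<xi>. F t \<xi> \<partial>M) = g t \<bullet> frac_int \<sigma> \<beta> h t" if t: "t \<in> {a<..<b}" for t
  proof -
    have ki: "integrable M (\<lambda>\<xi>. k t \<xi>)" unfolding k_def using RL_kernel_integral_bound(2)[OF \<beta> \<sigma>, of t] t by auto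
    have "integrable M (\<lambda>\<xi>. k t \<xi> *\<^sub>R h \<xi>)"
    proof (rule Bochner_Integration.integrable_bound)
      show "integrable M (\<lambda>\<xi>. B * k t \<xi>)" using ki by simp
      show "AE \<xi> in M. norm (k t \<xi> *\<^sub>R h \<xi>) \<le> norm (B * k t \<xi>)"
        using k0 B hB by (intro AE_I2) (auto simp: mult.commute intro!: mult_right_mono)
    qed measurable
    then have "(\<integral>\<xi>. g t \<bullet> (k t \<xi> *\<^sub>R h \<xi>) \<partial>M) = g t \<bullet> (\<integral>\<xi>. k t \<xi> *\<^sub>R h \<xi> \<partial>M)"
      by (intro integral_inner_right) auto
    then show ?thesis by (simp add: F_def frac_int_def k_def)
  qed
  have inner2: "AE \<xi> in M. (\<integral>t. F t \<xi> \<partial>M) = frac_int (- \<sigma>) \<beta> g \<xi> \<bullet> h \<xi>"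
  proof -
    have "integrable (M \<Otimes>\<^sub>M M) (\<lambda>(t, \<xi>). k t \<xi> *\<^sub>R g t)"
    proof (rule integrableI_bounded)
      show "(\<lambda>(t, \<xi>). k t \<xi> *\<^sub>R g t) \<in> borel_measurable (M \<Otimes>\<^sub>M M)" by measurable
      have "(\<integral>\<^sup>+x. ennreal (norm (case x of (t, \<xi>) \<Rightarrow> k t \<xi> *\<^sub>R g t)) \<partial>(M \<Otimes>\<^sub>M M))
        = (\<integral>\<^sup>+t. \<integral>\<^sup>+\<xi>. ennreal (norm (k t \<xi> *\<^sub>R g t)) \<partial>M \<partial>M)"
        using M_nn_integral_fst[of "\<lambda>x. ennreal (norm (case x of (t, \<xi>) \<Rightarrow> k t \<xi> *\<^sub>R g t))" M] by simp
      also have "\<dots> = (\<integral>\<^sup>+t. (\<integral>\<^sup>+\<xi>. ennreal (k t \<xi>) \<partial>M) * ennreal (norm (g t)) \<partial>M)"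
      proof (intro nn_integral_cong)
        fix t
        have "(\<integral>\<^sup>+\<xi>. ennreal (norm (k t \<xi> *\<^sub>R g t)) \<partial>M) = (\<integral>\<^sup>+\<xi>. ennreal (k t \<xi>) * ennreal (norm (g t)) \<partial>M)"
          using k0 by (intro nn_integral_cong) (simp add: ennreal_mult)
        then show "(\<integral>\<^sup>+\<xi>. ennreal (norm (k t \<xi> *\<^sub>R g t)) \<partial>M) = (\<integral>\<^sup>+\<xi>. ennreal (k t \<xi>) \<partial>M) * ennreal (norm (g t))"
          by (subst (asm) nn_integral_multc) auto
      qed
      also have "\<dots> \<le> (\<integral>\<^sup>+t. ennreal C * ennreal (norm (g t)) \<partial>M)"
      proof (rule nn_integral_mono_AE)
        show "AE t in M. (\<integral>\<^sup>+\<xi>. ennreal (k t \<xi>) \<partial>M) * ennreal (norm (g t)) \<le> ennreal C * ennreal (norm (g t))"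
          using AE_M_interval
        proof eventually_elim
          case (elim t)
          then show ?case
            using RL_kernel_integral_bound(1)[OF \<beta> \<sigma>, of t] unfolding k_def C_def by (intro mult_right_mono) auto
        qed
      qed
      also have "\<dots> = ennreal C * (\<integral>\<^sup>+t. ennreal (norm (g t)) \<partial>M)"
        by (subst nn_integral_cmult) auto
      also have "\<dots> < \<infinity>" using gi by (simp add: integrable_iff_bounded ennreal_mult_less_top)
      finally show "(\<integral>\<^sup>+x. ennreal (norm (case x of (t, \<xi>) \<Rightarrow> k t \<xi> *\<^sub>R g t)) \<partial>(M \<Otimes>\<^sub>M M)) < \<infinity>" .
    qed
    then have "AE \<xi> in M. integrable M (\<lambda>t. k t \<xi> *\<^sub>R g t)"
      by (rule AE_integrable_snd)
    then show ?thesis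
    proof eventually_elim
      case (elim \<xi>)
      then have "(\<integral>t. (k t \<xi> *\<^sub>R g t) \<bullet> h \<xi> \<partial>M) = (\<integral>t. k t \<xi> *\<^sub>R g t \<partial>M) \<bullet> h \<xi>"
        by (intro integral_inner_left) auto
      moreover have "k t \<xi> = RL_kernel \<beta> (- \<sigma> * (\<xi> - t))" for t
        unfolding k_def by (rule arg_cong) (simp add: algebra_simps)
      ultimately show ?case by (simp add: F_def frac_int_def)
    qed
  qed
  have m2: "(\<lambda>\<xi>. frac_int (- \<sigma>) \<beta> g \<xi> \<bullet> h \<xi>) \<in> borel_measurable M" by measurable
  have m1: "(\<lambda>t. g t \<bullet> frac_int \<sigma> \<beta> h t) \<in> borel_measurable M" by measurable
  have ae1: "AE t in M. (\<integral>\<xi>. F t \<xi> \<partial>M) = g t \<bullet> frac_int \<sigma> \<beta> h t"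
    using AE_M_interval by eventually_elim (rule inner1)
  note i1 = integrable_fst[OF int] and i2 = integrable_snd[OF int]
  show "integrable M (\<lambda>\<xi>. frac_int (- \<sigma>) \<beta> g \<xi> \<bullet> h \<xi>)"
    using i2 by (rule integrable_cong_AE_imp[OF _ m2]) (use inner2 in \<open>auto elim: eventually_mono\<close>)
  show "integrable M (\<lambda>t. g t \<bullet> frac_int \<sigma> \<beta> h t)"
    using i1 by (rule integrable_cong_AE_imp[OF _ m1]) (use ae1 in \<open>auto elim: eventually_mono\<close>)
  have "(\<integral>t. g t \<bullet> frac_int \<sigma> \<beta> h t \<partial>M) = (\<integral>t. \<integral>\<xi>. F t \<xi> \<partial>M \<partial>M)"
    using ae1 by (intro integral_cong_AE m1 borel_measurable_integrable[OF i1]) (auto elim: eventually_mono)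
  also have "\<dots> = (\<integral>\<xi>. \<integral>t. F t \<xi> \<partial>M \<partial>M)" by (rule Fubini_integral[OF int, symmetric])
  also have "\<dots> = (\<integral>\<xi>. frac_int (- \<sigma>) \<beta> g \<xi> \<bullet> h \<xi> \<partial>M)"
    using inner2 by (intro integral_cong_AE m2 borel_measurable_integrable[OF i2]) (auto elim: eventually_mono)
  finally show "(\<integral>t. g t \<bullet> frac_int \<sigma> \<beta> h t \<partial>M) = (\<integral>\<xi>. frac_int (- \<sigma>) \<beta> g \<xi> \<bullet> h \<xi> \<partial>M)" .
qed

end

section \<open>Fractional integrals of p-integrable functions\<close>

locale supercritical_order = bounded_interval +
  fixes \<alpha> p q :: real
  assumes p: "1 < p" "1 / p + 1 / q = 1" and \<alpha>: "1 / p < \<alpha>" "\<alpha> < 1"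
begin

lemma \<alpha>_pos: "0 < \<alpha>"
  using p \<alpha> by (smt (verit) divide_pos_pos)

lemma q: "1 < q" "1 / q + 1 / p = 1"
  using conjugate_exponent[OF p] p by auto

text \<open>The \<open>q\<close>-th power of the kernel is integrable at 0; this is where \<open>1 / p < \<alpha>\<close> enters.\<close>

lemma kernel_exponent_pos: "0 < (\<alpha> - 1) * q + 1"
proof -
  have "1 - \<alpha> < 1 / q" using p \<alpha> by linarith
  then have "(1 - \<alpha>) * q < 1" using q(1) by (simp add: field_simps)
  then show ?thesis by (simp add: algebra_simps)
qed

text \<open>A bound for the integral of the \<open>q\<close>-th power of the kernel, uniform in its singular point.\<close>

definition kernel_bound :: real where
  "kernel_bound = Gamma ((\<alpha> - 1) * q + 1) / Gamma \<alpha> powr q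
     * ((b - a) powr ((\<alpha> - 1) * q + 1) / (((\<alpha> - 1) * q + 1) * Gamma ((\<alpha> - 1) * q + 1)))"

lemma RL_kernel_powr_integrable:
  assumes t: "t \<in> {a..b}"
  shows "integrable M (\<lambda>\<xi>. RL_kernel \<alpha> (t - \<xi>) powr q)"
    and "(\<integral>\<xi>. RL_kernel \<alpha> (t - \<xi>) powr q \<partial>M) \<le> kernel_bound"
proof -
  have G: "Gamma ((\<alpha> - 1) * q + 1) > 0" using kernel_exponent_pos by (rule Gamma_real_pos)
  note k = RL_kernel_powr[OF \<alpha>_pos kernel_exponent_pos]
  have B: "integrable M (\<lambda>\<xi>. RL_kernel ((\<alpha> - 1) * q + 1) (t - \<xi>))"
    "(\<integral>\<xi>. RL_kernel ((\<alpha> - 1) * q + 1) (t - \<xi>) \<partial>M)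
      \<le> (b - a) powr ((\<alpha> - 1) * q + 1) / (((\<alpha> - 1) * q + 1) * Gamma ((\<alpha> - 1) * q + 1))"
    using RL_kernel_integral_bound(2,3)[OF kernel_exponent_pos _ t, of 1] by (simp_all only: mult_1 abs_one)
  show "integrable M (\<lambda>\<xi>. RL_kernel \<alpha> (t - \<xi>) powr q)"
    unfolding k using B(1) by (rule integrable_mult_right)
  show "(\<integral>\<xi>. RL_kernel \<alpha> (t - \<xi>) powr q \<partial>M) \<le> kernel_bound"
    unfolding k kernel_bound_def integral_mult_right_zero
    by (rule mult_left_mono[OF B(2)]) (use G in simp)
qed

definition Lp :: "(real \<Rightarrow> 'e::euclidean_space) \<Rightarrow> bool" where
  "Lp v \<longleftrightarrow> v \<in> borel_measurable borel \<and> integrable M (\<lambda>t. norm (v t) powr p)"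

definition Lp_int :: "(real \<Rightarrow> 'e::euclidean_space) \<Rightarrow> real" where
  "Lp_int v = (\<integral>t. norm (v t) powr p \<partial>M)"

lemma Lp_int_nonneg: "0 \<le> Lp_int v"
  unfolding Lp_int_def by simp

lemma Lp_measurable[measurable_dest]: "Lp v \<Longrightarrow> v \<in> borel_measurable borel"
  by (simp add: Lp_def)

lemma Lp_integrable_powr: "Lp v \<Longrightarrow> integrable M (\<lambda>t. norm (v t) powr p)"
  by (simp add: Lp_def)

lemma Lp_add:
  assumes "Lp v" "Lp w" shows "Lp (\<lambda>t. v t + w t)"
proof -
  note [measurable] = Lp_measurable[OF assms(1)] Lp_measurable[OF assms(2)]
  have "integrable M (\<lambda>t. norm (v t + w t) powr p)"
  proof (rule Bochner_Integration.integrable_bound)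
    show "integrable M (\<lambda>t. 2 powr p * (norm (v t) powr p + norm (w t) powr p))"
      using assms by (simp add: Lp_def)
    show "AE t in M. norm (norm (v t + w t) powr p) \<le> norm (2 powr p * (norm (v t) powr p + norm (w t) powr p))"
      using norm_add_powr_le[of p] p by (intro AE_I2) (auto simp: abs_mult intro: order_trans)
  qed measurable
  then show ?thesis by (simp add: Lp_def)
qed

lemma Lp_scaleR: assumes "Lp v" shows "Lp (\<lambda>t. c *\<^sub>R v t)"
proof -
  note [measurable] = Lp_measurable[OF assms]
  have "integrable M (\<lambda>t. \<bar>c\<bar> powr p * norm (v t) powr p)" using assms by (simp add: Lp_def)
  then show ?thesis by (simp add: Lp_def powr_mult)
qed

lemma Lp_bounded:
  assumes [measurable]: "v \<in> borel_measurable borel" and B: "\<And>t. norm (v t) \<le> B" shows "Lp v"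
proof -
  have "integrable M (\<lambda>t. norm (v t) powr p)"
    using B p by (intro integrable_const_bound[where B = "B powr p"] AE_I2) (auto intro!: powr_mono2)
  then show ?thesis by (simp add: Lp_def)
qed

lemma Lp_integrable: assumes "Lp v" shows "integrable M v"
proof (rule Bochner_Integration.integrable_bound)
  show "integrable M (\<lambda>t. 1 + norm (v t) powr p)" using assms by (simp add: Lp_def)
  show "AE t in M. norm (v t) \<le> norm (1 + norm (v t) powr p)"
    using powr_le_one_plus_powr[of _ 1 p] p by (intro AE_I2) (auto intro: order_trans)
qed (use assms in \<open>simp add: Lp_def\<close>)

lemma kernel_times_Lp_integrable:
  assumes "Lp v" "t \<in> {a..b}"
  shows "integrable M (\<lambda>\<xi>. RL_kernel \<alpha> (t - \<xi>) *\<^sub>R v \<xi>)"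
    "integrable M (\<lambda>\<xi>. RL_kernel \<alpha> (t - \<xi>) * norm (v \<xi>))"
  using assms
  by (auto intro!: integrable_conjugate_product[OF p] RL_kernel_nonneg \<alpha>_pos RL_kernel_powr_integrable
      simp: Lp_def)

abbreviation I\<alpha> :: "(real \<Rightarrow> 'e::euclidean_space) \<Rightarrow> real \<Rightarrow> 'e" where
  "I\<alpha> \<equiv> frac_int 1 \<alpha>"

lemma I\<alpha>_add_scaleR:
  assumes "Lp v" "Lp w" "t \<in> {a..b}"
  shows "I\<alpha> (\<lambda>t. v t + c *\<^sub>R w t) t = I\<alpha> v t + c *\<^sub>R I\<alpha> w t"
proof -
  have "(\<integral>\<xi>. RL_kernel \<alpha> (t - \<xi>) *\<^sub>R (v \<xi> + c *\<^sub>R w \<xi>) \<partial>M)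
      = (\<integral>\<xi>. RL_kernel \<alpha> (t - \<xi>) *\<^sub>R v \<xi> + c *\<^sub>R (RL_kernel \<alpha> (t - \<xi>) *\<^sub>R w \<xi>) \<partial>M)"
    by (simp add: scaleR_add_right mult.commute)
  also have "\<dots> = (\<integral>\<xi>. RL_kernel \<alpha> (t - \<xi>) *\<^sub>R v \<xi> \<partial>M) + (\<integral>\<xi>. c *\<^sub>R (RL_kernel \<alpha> (t - \<xi>) *\<^sub>R w \<xi>) \<partial>M)"
    using kernel_times_Lp_integrable(1) assms by (intro Bochner_Integration.integral_add integrable_scaleR_right)
  finally show ?thesis by (simp only: frac_int_def mult_1 integral_scaleR_right)
qed

lemma norm_I\<alpha>_powr_le:
  assumes v: "Lp v" and t: "t \<in> {a..b}"
  shows "norm (I\<alpha> v t) powr p \<le> (1 + kernel_bound) powr p * (1 + Lp_int v)"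
proof -
  note [measurable] = Lp_measurable[OF v]
  have "norm (I\<alpha> v t) \<le> (\<integral>\<xi>. norm (RL_kernel \<alpha> (t - \<xi>) *\<^sub>R v \<xi>) \<partial>M)"
    unfolding frac_int_def mult_1 by (rule integral_norm_bound)
  also have "\<dots> = (\<integral>\<xi>. RL_kernel \<alpha> (t - \<xi>) * norm (v \<xi>) \<partial>M)"
    using RL_kernel_nonneg[OF \<alpha>_pos] by simp
  finally have "norm (I\<alpha> v t) powr p \<le> (\<integral>\<xi>. RL_kernel \<alpha> (t - \<xi>) * norm (v \<xi>) \<partial>M) powr p"
    using p by (intro powr_mono2) auto
  also have "\<dots> \<le> (1 + (\<integral>\<xi>. RL_kernel \<alpha> (t - \<xi>) powr q \<partial>M)) powr p * (1 + (\<integral>\<xi>. norm (v \<xi>) powr p \<partial>M))"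
    using v by (intro weak_Holder_inequality[OF p] RL_kernel_nonneg \<alpha>_pos RL_kernel_powr_integrable t) (auto simp: Lp_def)
  also have "\<dots> \<le> (1 + kernel_bound) powr p * (1 + Lp_int v)"
    unfolding Lp_int_def using p RL_kernel_powr_integrable(2)[OF t]
    by (intro mult_right_mono powr_mono2) (auto intro!: add_nonneg_nonneg)
  finally show ?thesis .
qed

lemma norm_I\<alpha>_le:
  assumes v: "Lp v" and t: "t \<in> {a..b}" and N: "Lp_int v \<le> N"
  shows "norm (I\<alpha> v t) \<le> ((1 + kernel_bound) powr p * (1 + N)) powr (1 / p)"
proof -
  have "norm (I\<alpha> v t) = (norm (I\<alpha> v t) powr p) powr (1 / p)" using p by (simp add: powr_powr)
  also have "\<dots> \<le> ((1 + kernel_bound) powr p * (1 + N)) powr (1 / p)"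
  proof (rule powr_mono2)
    have "(1 + kernel_bound) powr p * (1 + Lp_int v) \<le> (1 + kernel_bound) powr p * (1 + N)"
      using N by (intro mult_left_mono) auto
    then show "norm (I\<alpha> v t) powr p \<le> (1 + kernel_bound) powr p * (1 + N)"
      using norm_I\<alpha>_powr_le[OF v t] by linarith
  qed (use p in auto)
  finally show ?thesis .
qed

text \<open>When \<open>s n\<close> tends to \<open>t\<close>, the kernels with singularity at \<open>s n\<close> converge almost everywhere to the
  one at \<open>t\<close> and stay bounded in \<open>L\<^sup>q\<close>; hence they converge weakly, and \<open>v\<close> is in the dual \<open>L\<^sup>p\<close>.\<close>

lemma continuous_on_I\<alpha>:
  assumes v: "Lp v"
  shows "continuous_on {a..b} (I\<alpha> v)"
  unfolding continuous_on_sequentially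
proof (intro allI ballI impI, elim conjE)
  note [measurable] = Lp_measurable[OF v]
  fix s t assume t: "t \<in> {a..b}" and s: "\<forall>n. s n \<in> {a..b}" and st: "s \<longlonglongrightarrow> t"
  define z where "z = (\<lambda>n \<xi>. RL_kernel \<alpha> (s n - \<xi>) - RL_kernel \<alpha> (t - \<xi>))"
  have [measurable]: "z n \<in> borel_measurable borel" for n unfolding z_def by measurable
  have zle: "norm (z n \<xi>) powr q \<le> 2 powr q * (RL_kernel \<alpha> (s n - \<xi>) powr q + RL_kernel \<alpha> (t - \<xi>) powr q)" for n \<xi>
    using norm_add_powr_le[of q "RL_kernel \<alpha> (s n - \<xi>)" "- RL_kernel \<alpha> (t - \<xi>)"] q RL_kernel_nonneg[OF \<alpha>_pos]
    by (simp add: z_def)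
  have Ri: "integrable M (\<lambda>\<xi>. 2 powr q * (RL_kernel \<alpha> (s n - \<xi>) powr q + RL_kernel \<alpha> (t - \<xi>) powr q))" for n
    using RL_kernel_powr_integrable(1) s t by simp
  have zi: "integrable M (\<lambda>\<xi>. norm (z n \<xi>) powr q)" for n
    by (rule Bochner_Integration.integrable_bound[OF Ri[of n]])
       (use zle in \<open>auto intro!: AE_I2 intro: order_trans\<close>)
  have zB: "(\<integral>\<xi>. norm (z n \<xi>) powr q \<partial>M) \<le> 2 powr q * (kernel_bound + kernel_bound)" for n
  proof -
    have "(\<integral>\<xi>. norm (z n \<xi>) powr q \<partial>M) \<le> (\<integral>\<xi>. 2 powr q * (RL_kernel \<alpha> (s n - \<xi>) powr q + RL_kernel \<alpha> (t - \<xi>) powr q) \<partial>M)"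
      using zi Ri zle by (rule integral_mono)
    also have "\<dots> = 2 powr q * ((\<integral>\<xi>. RL_kernel \<alpha> (s n - \<xi>) powr q \<partial>M) + (\<integral>\<xi>. RL_kernel \<alpha> (t - \<xi>) powr q \<partial>M))"
      using RL_kernel_powr_integrable(1) s t by simp
    also have "\<dots> \<le> 2 powr q * (kernel_bound + kernel_bound)"
      using RL_kernel_powr_integrable(2) s t by (intro mult_left_mono add_mono) auto
    finally show ?thesis .
  qed
  have lim: "AE \<xi> in M. (\<lambda>n. z n \<xi>) \<longlonglongrightarrow> 0"
  proof -
    have "AE \<xi> in M. \<xi> \<noteq> t" unfolding AE_M using AE_lborel_singleton[of t] by eventually_elim simp
    then show ?thesis
    proof eventually_elim
      case (elim \<xi>)
      have st': "(\<lambda>n. s n - \<xi>) \<longlonglongrightarrow> t - \<xi>" using st by (intro tendsto_intros)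
      have "(\<lambda>n. RL_kernel \<alpha> (s n - \<xi>)) \<longlonglongrightarrow> RL_kernel \<alpha> (t - \<xi>)"
      proof (cases "0 < t - \<xi>")
        case True
        then have "\<forall>\<^sub>F n in sequentially. 0 < s n - \<xi>" using order_tendstoD(1)[OF st'] by blast
        then have "\<forall>\<^sub>F n in sequentially. (s n - \<xi>) powr (\<alpha> - 1) / Gamma \<alpha> = RL_kernel \<alpha> (s n - \<xi>)"
          by eventually_elim (simp add: RL_kernel_def)
        moreover have "(\<lambda>n. (s n - \<xi>) powr (\<alpha> - 1) / Gamma \<alpha>) \<longlonglongrightarrow> (t - \<xi>) powr (\<alpha> - 1) / Gamma \<alpha>"
          using st True Gamma_real_pos[OF \<alpha>_pos] by (intro tendsto_intros) auto
        ultimately show ?thesis using True by (subst tendsto_cong[symmetric]) (auto simp: RL_kernel_def)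
      next
        case False
        then have "t - \<xi> < 0" using elim by simp
        then have "\<forall>\<^sub>F n in sequentially. s n - \<xi> < 0" using order_tendstoD(2)[OF st'] by blast
        then have "\<forall>\<^sub>F n in sequentially. RL_kernel \<alpha> (s n - \<xi>) = RL_kernel \<alpha> (t - \<xi>)"
          by eventually_elim (use False in \<open>simp add: RL_kernel_def\<close>)
        then show ?thesis by (rule tendsto_eventually)
      qed
      then show ?case unfolding z_def by (simp add: LIM_zero)
    qed
  qed
  have "(\<lambda>n. \<integral>\<xi>. norm (v \<xi>) * norm (z n \<xi>) \<partial>M) \<longlonglongrightarrow> 0"
    using v by (intro integral_product_tendsto_zero[OF q _ _ _ _ zi zB lim]) (auto simp: Lp_def)
  then have "(\<lambda>n. I\<alpha> v (s n) - I\<alpha> v t) \<longlonglongrightarrow> 0"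
  proof (rule Lim_null_comparison[rotated])
    show "\<forall>\<^sub>F n in sequentially. norm (I\<alpha> v (s n) - I\<alpha> v t) \<le> (\<integral>\<xi>. norm (v \<xi>) * norm (z n \<xi>) \<partial>M)"
    proof (intro always_eventually allI)
      fix n
      have "I\<alpha> v (s n) - I\<alpha> v t = (\<integral>\<xi>. z n \<xi> *\<^sub>R v \<xi> \<partial>M)"
        unfolding frac_int_def z_def using kernel_times_Lp_integrable(1)[OF v] s t
        by (simp add: scaleR_diff_left)
      also have "norm \<dots> \<le> (\<integral>\<xi>. norm (z n \<xi> *\<^sub>R v \<xi>) \<partial>M)" by (rule integral_norm_bound)
      finally show "norm (I\<alpha> v (s n) - I\<alpha> v t) \<le> (\<integral>\<xi>. norm (v \<xi>) * norm (z n \<xi>) \<partial>M)"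
        by (simp add: mult.commute)
    qed
  qed
  then show "((I\<alpha> v) \<circ> s) \<longlonglongrightarrow> I\<alpha> v t"
    by (simp add: LIM_zero_iff o_def)
qed

text \<open>Dual to the continuity of a single trajectory: the kernel is fixed in \<open>L\<^sup>q\<close>, and \<open>w n\<close> is
  bounded in \<open>L\<^sup>p\<close> and converges almost everywhere.\<close>

lemma I\<alpha>_tendsto:
  assumes w: "\<And>n. Lp (w n)" "\<And>n. Lp_int (w n) \<le> B" and v: "Lp v"
    and lim: "AE t in M. (\<lambda>n. w n t) \<longlonglongrightarrow> v t" and t: "t \<in> {a..b}"
  shows "(\<lambda>n. I\<alpha> (w n) t) \<longlonglongrightarrow> I\<alpha> v t"
proof -
  note [measurable] = Lp_measurable[OF w(1)] Lp_measurable[OF v]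
  define z where "z = (\<lambda>n \<xi>. w n \<xi> - v \<xi>)"
  have zLp: "Lp (z n)" for n
    using Lp_add[OF w(1)[of n] Lp_scaleR[OF v, of "-1"]] by (simp add: z_def)
  have zB: "(\<integral>\<xi>. norm (z n \<xi>) powr p \<partial>M) \<le> 2 powr p * (B + Lp_int v)" for n
  proof -
    have "(\<integral>\<xi>. norm (z n \<xi>) powr p \<partial>M) \<le> (\<integral>\<xi>. 2 powr p * (norm (w n \<xi>) powr p + norm (v \<xi>) powr p) \<partial>M)"
      using zLp[of n] w(1)[of n] v norm_add_powr_le[of p "w n _" "- v _"] p
      by (intro integral_mono) (auto simp: Lp_def z_def)
    also have "\<dots> = 2 powr p * (Lp_int (w n) + Lp_int v)"
      using w(1)[of n] v by (simp add: Lp_def Lp_int_def)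
    also have "\<dots> \<le> 2 powr p * (B + Lp_int v)" using w(2) by (intro mult_left_mono add_mono) auto
    finally show ?thesis .
  qed
  have "(\<lambda>n. \<integral>\<xi>. RL_kernel \<alpha> (t - \<xi>) * norm (z n \<xi>) \<partial>M) \<longlonglongrightarrow> 0"
  proof (rule integral_product_tendsto_zero[OF p _ _ _ _ _ zB])
    show "AE \<xi> in M. (\<lambda>n. z n \<xi>) \<longlonglongrightarrow> 0"
      using lim by eventually_elim (simp add: z_def LIM_zero)
  qed (use zLp RL_kernel_powr_integrable(1)[OF t] RL_kernel_nonneg[OF \<alpha>_pos] in \<open>auto simp: Lp_def\<close>)
  then have "(\<lambda>n. I\<alpha> (w n) t - I\<alpha> v t) \<longlonglongrightarrow> 0"
  proof (rule Lim_null_comparison[rotated])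
    show "\<forall>\<^sub>F n in sequentially. norm (I\<alpha> (w n) t - I\<alpha> v t) \<le> (\<integral>\<xi>. RL_kernel \<alpha> (t - \<xi>) * norm (z n \<xi>) \<partial>M)"
    proof (intro always_eventually allI)
      fix n
      have "I\<alpha> (w n) t - I\<alpha> v t = (\<integral>\<xi>. RL_kernel \<alpha> (t - \<xi>) *\<^sub>R z n \<xi> \<partial>M)"
        unfolding frac_int_def z_def using kernel_times_Lp_integrable(1)[OF w(1) t] kernel_times_Lp_integrable(1)[OF v t]
        by (simp add: scaleR_diff_right)
      also have "norm \<dots> \<le> (\<integral>\<xi>. norm (RL_kernel \<alpha> (t - \<xi>) *\<^sub>R z n \<xi>) \<partial>M)" by (rule integral_norm_bound)
      finally show "norm (I\<alpha> (w n) t - I\<alpha> v t) \<le> (\<integral>\<xi>. RL_kernel \<alpha> (t - \<xi>) * norm (z n \<xi>) \<partial>M)"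
        using RL_kernel_nonneg[OF \<alpha>_pos] by simp
    qed
  qed
  then show ?thesis by (simp add: LIM_zero_iff)
qed

end

section \<open>Minimizers of the action\<close>

text \<open>Bounds for the difference quotients that are independent of \<open>s\<close>. The upper one compares
  \<open>z + s h\<close> with \<open>z\<close> and \<open>z + h\<close>, the lower one \<open>z\<close> with \<open>z - h\<close> and \<open>z + s h\<close>.\<close>

lemma convex_difference_quotient_bounds:
  fixes f :: "'a::real_vector \<Rightarrow> real"
  assumes f: "convex_on UNIV f" and s: "0 < s" "s \<le> 1"
  shows "(f (z + s *\<^sub>R h) - f z) / s \<le> f (z + h) - f z"
    and "f z - f (z - h) \<le> (f (z + s *\<^sub>R h) - f z) / s"
proof -
  have "f ((1 - s) *\<^sub>R z + s *\<^sub>R (z + h)) \<le> (1 - s) * f z + s * f (z + h)"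
    using f s by (intro convex_onD) auto
  moreover have "(1 - s) *\<^sub>R z + s *\<^sub>R (z + h) = z + s *\<^sub>R h" by (simp add: algebra_simps)
  ultimately have "f (z + s *\<^sub>R h) - f z \<le> s * (f (z + h) - f z)" by (simp add: algebra_simps)
  then show "(f (z + s *\<^sub>R h) - f z) / s \<le> f (z + h) - f z" using s by (simp add: field_simps)
  define r where "r = s / (1 + s)"
  have r: "0 \<le> r" "r \<le> 1" using s by (auto simp: r_def)
  have "f ((1 - r) *\<^sub>R (z + s *\<^sub>R h) + r *\<^sub>R (z - h)) \<le> (1 - r) * f (z + s *\<^sub>R h) + r * f (z - h)"
    using f r by (intro convex_onD) auto
  moreover have "(1 - r) *\<^sub>R (z + s *\<^sub>R h) + r *\<^sub>R (z - h) = z"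
  proof -
    have "(1 - r) * s = r" using s by (simp add: r_def field_simps)
    then have "(1 - r) *\<^sub>R (s *\<^sub>R h) = r *\<^sub>R h" by simp
    then show ?thesis by (simp add: scaleR_add_right scaleR_diff_right scaleR_diff_left)
  qed
  ultimately have "f z \<le> (1 - r) * f (z + s *\<^sub>R h) + r * f (z - h)" by simp
  then have "(1 + s) * f z \<le> (1 + s) * ((1 - r) * f (z + s *\<^sub>R h) + r * f (z - h))"
    using s by (intro mult_left_mono) auto
  also have "\<dots> = f (z + s *\<^sub>R h) + s * f (z - h)"
  proof -
    have "(1 + s) * (1 - r) = 1" "(1 + s) * r = s" using s by (auto simp: r_def field_simps)
    then show ?thesis by (simp only: distrib_left mult.assoc[symmetric] mult_1)
  qed
  finally show "f z - f (z - h) \<le> (f (z + s *\<^sub>R h) - f z) / s" using s by (simp add: field_simps)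
qed

lemma difference_quotients_tendsto:
  fixes f :: "'a::real_normed_vector \<Rightarrow> real"
  assumes f: "(f has_derivative f') (at z)" and s: "s \<longlonglongrightarrow> 0" "\<And>n. s n \<noteq> 0"
  shows "(\<lambda>n. (f (z + s n *\<^sub>R h) - f z) / s n) \<longlonglongrightarrow> f' h"
proof -
  have g: "((\<lambda>r. z + r *\<^sub>R h) has_derivative (\<lambda>r. r *\<^sub>R h)) (at 0)"
    by (auto intro!: derivative_eq_intros)
  have "((\<lambda>r. f (z + r *\<^sub>R h)) has_derivative (\<lambda>r. f' (r *\<^sub>R h))) (at 0)"
    using diff_chain_at[OF g, of f f'] f by (simp add: o_def)
  moreover have "f' (r *\<^sub>R h) = f' h * r" for r
    using has_derivative_bounded_linear[OF f] by (simp add: linear_simps)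
  ultimately have "DERIV (\<lambda>r. f (z + r *\<^sub>R h)) 0 :> f' h"
    by (simp add: has_field_derivative_def)
  then have lim: "(\<lambda>r. (f (z + r *\<^sub>R h) - f z) / r) \<midarrow>0\<rightarrow> f' h"
    by (simp add: DERIV_def)
  have "filterlim s (at 0) sequentially"
    using s by (intro filterlim_atI) auto
  from filterlim_compose[OF lim this] show ?thesis .
qed

locale convex_lagrangian = supercritical_order a b \<alpha> p q for a b \<alpha> p q +
  fixes L :: "'e::euclidean_space \<Rightarrow> 'e \<Rightarrow> real \<Rightarrow> real"
    and Lx Ly :: "'e \<Rightarrow> 'e \<Rightarrow> real \<Rightarrow> 'e"
    and \<gamma> d C :: real
  assumes L_continuous: "continuous_on UNIV (\<lambda>(x, y, t). L x y t)"
    and Lx_continuous: "continuous_on UNIV (\<lambda>(x, y, t). Lx x y t)"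
    and Ly_continuous: "continuous_on UNIV (\<lambda>(x, y, t). Ly x y t)"
    and L_derivative: "\<And>x y t. ((\<lambda>(x, y). L x y t) has_derivative (\<lambda>(h, k). Lx x y t \<bullet> h + Ly x y t \<bullet> k)) (at (x, y))"
    and L_convex: "\<And>t. convex_on UNIV (\<lambda>(x, y). L x y t)"
    and growth: "\<And>R. \<exists>B. \<forall>x y t. norm x \<le> R \<longrightarrow> \<bar>L x y t\<bar> \<le> B * (1 + norm y powr p)
        \<and> norm (Lx x y t) \<le> B * (1 + norm y powr p) \<and> norm (Ly x y t) \<le> B * (1 + norm y powr p)"
    and \<gamma>: "0 < \<gamma>" and d: "0 \<le> d" "d < p" and C: "0 \<le> C"
    and coercive: "\<And>x y t. \<gamma> * norm y powr p \<le> L x y t + C * norm x powr d + C"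
begin

text \<open>\<open>along G v\<close> is \<open>G\<close> evaluated on the trajectory whose left derivative of order \<open>\<alpha>\<close> is \<open>v\<close>.\<close>

definition along :: "('e \<Rightarrow> 'e \<Rightarrow> real \<Rightarrow> 'x) \<Rightarrow> (real \<Rightarrow> 'e) \<Rightarrow> real \<Rightarrow> 'x" where
  "along G v t = G (I\<alpha> v t) (v t) t"

lemma borel_measurable_along:
  fixes G :: "'e \<Rightarrow> 'e \<Rightarrow> real \<Rightarrow> 'x::{second_countable_topology, real_normed_vector}"
  assumes G: "continuous_on UNIV (\<lambda>(x, y, t). G x y t)" and v[measurable]: "v \<in> borel_measurable borel"
  shows "along G v \<in> borel_measurable borel"
proof -
  have [measurable]: "(\<lambda>(x, y, t). G x y t) \<in> borel_measurable borel"
    using G by (rule borel_measurable_continuous_onI)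
  have "(\<lambda>t. (\<lambda>(x, y, t). G x y t) (I\<alpha> v t, v t, t)) \<in> borel_measurable borel"
    by (rule measurable_compose[where N = borel]) measurable
  then show ?thesis by (simp add: along_def[abs_def])
qed

text \<open>The trajectory stays in a bounded set, on which \<open>G\<close> grows at most like \<open>1 + norm y powr p\<close>.\<close>

lemma integrable_along_growth:
  fixes G :: "'e \<Rightarrow> 'e \<Rightarrow> real \<Rightarrow> 'x::{second_countable_topology, banach}"
  assumes G: "continuous_on UNIV (\<lambda>(x, y, t). G x y t)" and v: "Lp v"
    and B: "\<And>R. \<exists>B. \<forall>x y t. norm x \<le> R \<longrightarrow> norm (G x y t) \<le> B * (1 + norm y powr p)"
  shows "integrable M (along G v)"
proof -
  obtain B where B: "norm (G x y t) \<le> B * (1 + norm y powr p)"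
    if "norm x \<le> ((1 + kernel_bound) powr p * (1 + Lp_int v)) powr (1 / p)" for x y t
    using B by blast
  show ?thesis
  proof (rule Bochner_Integration.integrable_bound)
    show "integrable M (\<lambda>t. B * (1 + norm (v t) powr p))"
      using Lp_integrable_powr[OF v] by simp
    show "along G v \<in> borel_measurable M"
      using borel_measurable_along[OF G Lp_measurable[OF v]] by simp
    show "AE t in M. norm (along G v t) \<le> norm (B * (1 + norm (v t) powr p))"
      using AE_M_interval
    proof eventually_elim
      case (elim t)
      have "norm (along G v t) \<le> B * (1 + norm (v t) powr p)"
        unfolding along_def using elim by (intro B norm_I\<alpha>_le v) auto
      then show ?case by simp
    qed
  qed
qed

lemma integrable_along:
  assumes "Lp v"
  shows "integrable M (along L v)" "integrable M (along Lx v)" "integrable M (along Ly v)"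
proof -
  have "\<exists>B. \<forall>x y t. norm x \<le> R \<longrightarrow> norm (L x y t) \<le> B * (1 + norm y powr p)"
    "\<exists>B. \<forall>x y t. norm x \<le> R \<longrightarrow> norm (Lx x y t) \<le> B * (1 + norm y powr p)"
    "\<exists>B. \<forall>x y t. norm x \<le> R \<longrightarrow> norm (Ly x y t) \<le> B * (1 + norm y powr p)" for R
    using growth[of R] unfolding real_norm_def by blast+
  with assms show "integrable M (along L v)" "integrable M (along Lx v)" "integrable M (along Ly v)"
    by (auto intro!: integrable_along_growth L_continuous Lx_continuous Ly_continuous)
qed

definition action :: "(real \<Rightarrow> 'e) \<Rightarrow> real" where
  "action v = (\<integral>t. along L v t \<partial>M)"

text \<open>The negative term \<open>C * norm x powr d\<close> of the lower bound for \<open>L\<close> is absorbed: since \<open>d < p\<close>, it is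
  at most \<open>\<epsilon> * norm x powr p\<close> plus a constant, and along a trajectory the \<open>p\<close>-th power is at most
  a multiple of \<open>1 + Lp_int v\<close>.\<close>

lemma action_coercive:
  obtains B where "\<And>v. Lp v \<Longrightarrow> \<gamma> / 2 * Lp_int v \<le> action v + B"
proof -
  define K where "K = (1 + kernel_bound) powr p"
  have K: "K \<ge> 0" by (simp add: K_def)
\<comment> \<open>small enough that the absorbed term costs at most \<open>\<gamma> / 2 * (1 + Lp_int v)\<close>\<close>
  define \<epsilon> where "\<epsilon> = \<gamma> / (2 * (C * K * (b - a) + 1))"
  have pos: "0 \<le> C * K * (b - a)" using C K ab by (intro mult_nonneg_nonneg) auto
  have \<epsilon>: "\<epsilon> > 0" using \<gamma> pos by (simp add: \<epsilon>_def)
  have \<epsilon>C: "\<epsilon> * (C * K * (b - a)) \<le> \<gamma> / 2"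
    using \<gamma> pos by (simp add: \<epsilon>_def field_simps)
  obtain D where D: "0 \<le> D" "\<And>s. 0 \<le> s \<Longrightarrow> s powr d \<le> \<epsilon> * s powr p + D"
    using powr_absorb[OF d \<epsilon>] by blast
  have "\<gamma> / 2 * Lp_int v \<le> action v + (\<gamma> / 2 + (C * D + C) * (b - a))" if v: "Lp v" for v
  proof -
    have "\<gamma> * Lp_int v = (\<integral>t. \<gamma> * norm (v t) powr p \<partial>M)" by (simp add: Lp_int_def)
    also have "\<dots> \<le> (\<integral>t. along L v t + (C * (\<epsilon> * (K * (1 + Lp_int v)) + D) + C) \<partial>M)"
    proof (rule integral_mono_AE)
      show "integrable M (\<lambda>t. \<gamma> * norm (v t) powr p)" using Lp_integrable_powr[OF v] by simp
      show "integrable M (\<lambda>t. along L v t + (C * (\<epsilon> * (K * (1 + Lp_int v)) + D) + C))"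
        using integrable_along(1)[OF v] by simp
      show "AE t in M. \<gamma> * norm (v t) powr p \<le> along L v t + (C * (\<epsilon> * (K * (1 + Lp_int v)) + D) + C)"
        using AE_M_interval
      proof eventually_elim
        case (elim t)
        have "norm (I\<alpha> v t) powr d \<le> \<epsilon> * norm (I\<alpha> v t) powr p + D" by (rule D) simp
        also have "\<dots> \<le> \<epsilon> * (K * (1 + Lp_int v)) + D"
          using norm_I\<alpha>_powr_le[OF v, of t] elim \<epsilon> unfolding K_def by (intro add_right_mono mult_left_mono) auto
        finally have "C * norm (I\<alpha> v t) powr d \<le> C * (\<epsilon> * (K * (1 + Lp_int v)) + D)"
          using C by (intro mult_left_mono)
        then show ?case using coercive[of "v t" "I\<alpha> v t" t] by (simp add: along_def)
      qed
    qed
    also have "\<dots> = action v + (C * (\<epsilon> * (K * (1 + Lp_int v)) + D) + C) * (b - a)"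
      using integrable_along(1)[OF v] by (simp add: action_def measure_M)
    also have "\<dots> = action v + \<epsilon> * (C * K * (b - a)) * (1 + Lp_int v) + (C * D + C) * (b - a)"
      by (simp add: algebra_simps)
    also have "\<dots> \<le> action v + \<gamma> / 2 * (1 + Lp_int v) + (C * D + C) * (b - a)"
      using \<epsilon>C Lp_int_nonneg[of v] by (intro add_mono mult_right_mono order_refl) auto
    finally show ?thesis by (simp add: algebra_simps)
  qed
  then show ?thesis by (rule that)
qed

lemma action_midpoint:
  assumes v: "Lp v" and w: "Lp w"
  shows "Lp (\<lambda>t. (1 / 2) *\<^sub>R (v t + w t))"
    and "action (\<lambda>t. (1 / 2) *\<^sub>R (v t + w t)) \<le> (action v + action w) / 2"
proof -
  define m where "m = (\<lambda>t. (1 / 2) *\<^sub>R v t + (1 / 2) *\<^sub>R w t)"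
  have m_eq: "(\<lambda>t. (1 / 2) *\<^sub>R (v t + w t)) = m" by (simp add: m_def scaleR_add_right)
  have v2: "Lp (\<lambda>t. (1 / 2) *\<^sub>R v t)" by (rule Lp_scaleR[OF v])
  show m: "Lp (\<lambda>t. (1 / 2) *\<^sub>R (v t + w t))"
    unfolding m_eq m_def by (intro Lp_add Lp_scaleR v w)
  have "action m \<le> (\<integral>t. (along L v t + along L w t) / 2 \<partial>M)"
    unfolding action_def
  proof (rule integral_mono_AE)
    show "integrable M (along L m)" using m m_eq integrable_along(1) by simp
    show "integrable M (\<lambda>t. (along L v t + along L w t) / 2)"
      using integrable_along(1) v w by simp
    show "AE t in M. along L m t \<le> (along L v t + along L w t) / 2"
      using AE_M_interval
    proof eventually_elim
      case (elim t)
      then have t: "t \<in> {a..b}" by auto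
      have "I\<alpha> (\<lambda>t. 0 + (1 / 2) *\<^sub>R v t) t = I\<alpha> (\<lambda>t. 0) t + (1 / 2) *\<^sub>R I\<alpha> v t"
        by (rule I\<alpha>_add_scaleR[OF Lp_bounded[where B = 0] v t]) auto
      then have "I\<alpha> (\<lambda>t. (1 / 2) *\<^sub>R v t) t = (1 / 2) *\<^sub>R I\<alpha> v t"
        by (simp add: frac_int_def)
      then have e: "I\<alpha> m t = (1 / 2) *\<^sub>R I\<alpha> v t + (1 / 2) *\<^sub>R I\<alpha> w t"
        unfolding m_def by (subst I\<alpha>_add_scaleR[OF v2 w t]) simp
      have "(\<lambda>(x, y). L x y t) ((1 - 1 / 2) *\<^sub>R (I\<alpha> v t, v t) + (1 / 2) *\<^sub>R (I\<alpha> w t, w t))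
          \<le> (1 - 1 / 2) * (\<lambda>(x, y). L x y t) (I\<alpha> v t, v t) + (1 / 2) * (\<lambda>(x, y). L x y t) (I\<alpha> w t, w t)"
        using L_convex[of t] by (intro convex_onD) auto
      then show ?case unfolding along_def e by (simp add: m_def)
    qed
  qed
  also have "\<dots> = (action v + action w) / 2"
    unfolding action_def using integrable_along(1) v w by simp
  finally show "action (\<lambda>t. (1 / 2) *\<^sub>R (v t + w t)) \<le> (action v + action w) / 2"
    unfolding m_eq .
qed

text \<open>The sublevel sets \<open>K n\<close> of the action are closed under midpoints by convexity and bounded in
  \<open>L\<^sup>p\<close> by coercivity. The action of the limit of a selection \<open>w n \<in> K n\<close> is at most the infimum by
  Fatou's lemma; the minorant that it requires comes from the uniform bound on the trajectories.\<close>

lemma minimizer_exists: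
  obtains v where "Lp v" "\<And>w. Lp w \<Longrightarrow> action v \<le> action w"
proof -
  obtain B where B: "\<And>v. Lp v \<Longrightarrow> \<gamma> / 2 * Lp_int v \<le> action v + B"
    using action_coercive by blast
  define A where "A = action ` {v. Lp v}"
  have bdd: "bdd_below A"
    unfolding A_def
  proof (intro bdd_belowI[of _ "- B"], clarsimp)
    fix v :: "real \<Rightarrow> 'e" assume "Lp v"
    then have "0 \<le> action v + B"
      using B[of v] mult_nonneg_nonneg[of "\<gamma> / 2" "Lp_int v"] \<gamma> Lp_int_nonneg[of v] by linarith
    then show "- B \<le> action v" by simp
  qed
  have "Lp (\<lambda>t. 0 :: 'e)" by (rule Lp_bounded[where B = 0]) auto
  then have ne: "A \<noteq> {}" by (auto simp: A_def)
  define m where "m = Inf A"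
  have m_le: "m \<le> action w" if "Lp w" for w
    unfolding m_def using bdd that by (intro cInf_lower) (auto simp: A_def)
  define K where "K = (\<lambda>n. {v. Lp v \<and> action v \<le> m + 1 / real (Suc n)})"
  define N where "N = 2 / \<gamma> * (m + 1 + B)"
  have K_N: "Lp_int v \<le> N" if "v \<in> K 0" for v :: "real \<Rightarrow> 'e"
  proof -
    have "Lp v" "action v \<le> m + 1" using that by (auto simp: K_def)
    then have "\<gamma> / 2 * Lp_int v \<le> m + 1 + B" using B[of v] by linarith
    then show ?thesis using \<gamma> by (simp add: N_def field_simps)
  qed
  have K_dec: "K n \<subseteq> K k" if "k \<le> n" for k n
  proof -
    have "1 / real (Suc n) \<le> 1 / real (Suc k)" using that by (intro divide_left_mono) auto
    then show ?thesis by (auto simp: K_def)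
  qed
  have K_ne: "K n \<noteq> {}" for n
    using cInf_lessD[OF ne, of "m + 1 / real (Suc n)"] by (auto simp: m_def K_def A_def intro: less_imp_le)
  have K_mid: "(\<lambda>t. (1 / 2) *\<^sub>R (v t + w t)) \<in> K n" if "v \<in> K n" "w \<in> K n" for n and v w :: "real \<Rightarrow> 'e"
    using action_midpoint[of v w] that by (auto simp: K_def)
  obtain w v where w: "\<And>n. w n \<in> K n" and v[measurable]: "v \<in> borel_measurable M"
    and lim: "AE t in M. (\<lambda>n. w n t) \<longlonglongrightarrow> v t"
  proof (rule AE_convergent_selection[of p K N])
    show "\<And>v. v \<in> K 0 \<Longrightarrow> v \<in> borel_measurable M"
      "\<And>v. v \<in> K 0 \<Longrightarrow> integrable M (\<lambda>t. norm (v t) powr p)"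
      by (auto simp: K_def Lp_def)
    show "\<And>v. v \<in> K 0 \<Longrightarrow> (\<integral>t. norm (v t) powr p \<partial>M) \<le> N"
      using K_N by (simp add: Lp_int_def)
  qed (use p K_ne K_dec K_mid in blast)+
  have wL: "Lp (w n)" for n using w[of n] by (simp add: K_def)
  have wN: "Lp_int (w n) \<le> N" for n using w[of n] K_dec[of 0 n] K_N by auto
  note [measurable] = Lp_measurable[OF wL]
  have vL: "Lp v"
  proof -
    have "integrable M (\<lambda>t. norm (v t) powr p)"
    proof (rule integrable_limit_of_bounded_integrals(1))
      show "AE t in M. (\<lambda>n. norm (w n t) powr p) \<longlonglongrightarrow> norm (v t) powr p"
        using lim by eventually_elim (use p in \<open>auto intro!: tendsto_intros\<close>)
      show "(\<integral>t. norm (w n t) powr p \<partial>M) \<le> N" for n using wN by (simp add: Lp_int_def)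
      show "integrable M (\<lambda>t. 0 :: real)" by simp
      show "integrable M (\<lambda>t. norm (w n t) powr p)" for n using Lp_integrable_powr[OF wL] .
    qed (use v in \<open>auto intro: tendsto_const\<close>)
    then show ?thesis using v by (simp add: Lp_def)
  qed
  define R where "R = ((1 + kernel_bound) powr p * (1 + N)) powr (1 / p)"
  have "action v \<le> m"
    unfolding action_def
  proof (rule integrable_limit_of_bounded_integrals(2))
    show "integrable M (along L (w n))" for n by (rule integrable_along(1)[OF wL])
    show "along L v \<in> borel_measurable M"
      using borel_measurable_along[OF L_continuous Lp_measurable[OF vL]] by simp
    show "AE t in M. (\<lambda>n. along L (w n) t) \<longlonglongrightarrow> along L v t"
      using lim AE_M_interval
    proof eventually_elim
      case (elim t)
      have "(\<lambda>n. I\<alpha> (w n) t) \<longlonglongrightarrow> I\<alpha> v t"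
        using elim by (intro I\<alpha>_tendsto[OF wL wN vL lim]) auto
      then have "(\<lambda>n. (I\<alpha> (w n) t, w n t, t)) \<longlonglongrightarrow> (I\<alpha> v t, v t, t)"
        using elim by (intro tendsto_intros)
      then have "(\<lambda>n. (\<lambda>(x, y, t). L x y t) (I\<alpha> (w n) t, w n t, t)) \<longlonglongrightarrow> (\<lambda>(x, y, t). L x y t) (I\<alpha> v t, v t, t)"
        using continuous_on_tendsto_compose[OF L_continuous] by fastforce
      then show ?case by (simp add: along_def)
    qed
    show "integrable M (\<lambda>t. - (C * R powr d + C))" by simp
    show "AE t in M. - (C * R powr d + C) \<le> along L (w n) t" for n
      using AE_M_interval
    proof eventually_elim
      case (elim t)
      have "norm (I\<alpha> (w n) t) powr d \<le> R powr d"
        using norm_I\<alpha>_le[OF wL _ wN, of t n] elim d unfolding R_def by (intro powr_mono2) auto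
      then have "C * norm (I\<alpha> (w n) t) powr d \<le> C * R powr d" using C by (intro mult_left_mono)
      moreover have "0 \<le> \<gamma> * norm (w n t) powr p" using \<gamma> by simp
      ultimately show ?case using coercive[of "w n t" "I\<alpha> (w n) t" t] by (simp add: along_def)
    qed
    show "(\<integral>t. along L (w n) t \<partial>M) \<le> m + 1 / real (Suc n)" for n
      using w[of n] by (simp add: K_def action_def)
    show "(\<lambda>n. m + 1 / real (Suc n)) \<longlonglongrightarrow> m"
      using tendsto_add[OF tendsto_const LIMSEQ_Suc[OF lim_1_over_n], of m] by simp
  qed
  then show ?thesis using that vL m_le order_trans by blast
qed

section \<open>The Euler-Lagrange equation\<close>

text \<open>The difference quotients \<open>Q n\<close> of the integrand in the direction \<open>h\<close> have nonnegative integrals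
  because \<open>v\<close> is a minimizer. By convexity of \<open>L\<close> they are dominated by the increments to
  \<open>v + h\<close> and \<open>v - h\<close>, so the inequality passes to the limit.\<close>

lemma first_variation_nonneg:
  assumes v: "Lp v" and min: "\<And>w. Lp w \<Longrightarrow> action v \<le> action w" and h: "Lp h"
  shows "integrable M (\<lambda>t. along Lx v t \<bullet> I\<alpha> h t + along Ly v t \<bullet> h t) \<and>
    0 \<le> (\<integral>t. along Lx v t \<bullet> I\<alpha> h t + along Ly v t \<bullet> h t \<partial>M)"
proof -
  note [measurable] = Lp_measurable[OF v] Lp_measurable[OF h]
    borel_measurable_along[OF L_continuous] borel_measurable_along[OF Lx_continuous] borel_measurable_along[OF Ly_continuous]
  define w where "w = (\<lambda>s t. v t + s *\<^sub>R h t)"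
  have wL: "Lp (w s)" for s unfolding w_def by (intro Lp_add Lp_scaleR v h)
  note [measurable] = Lp_measurable[OF wL]
  define s where "s = (\<lambda>n. 1 / real (Suc n))"
  have s: "0 < s n" "s n \<le> 1" for n by (auto simp: s_def)
  define Q where "Q = (\<lambda>n t. (along L (w (s n)) t - along L v t) / s n)"
  have Qi: "integrable M (Q n)" for n
    unfolding Q_def using integrable_along(1)[OF v] integrable_along(1)[OF wL] by simp
  have wt: "along L (w r) t = (\<lambda>(x, y). L x y t) ((I\<alpha> v t, v t) + r *\<^sub>R (I\<alpha> h t, h t))"
    if "t \<in> {a..b}" for r t
    unfolding along_def w_def using I\<alpha>_add_scaleR[OF v h that] by simp
  have lim: "AE t in M. (\<lambda>n. Q n t) \<longlonglongrightarrow> along Lx v t \<bullet> I\<alpha> h t + along Ly v t \<bullet> h t"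
    using AE_M_interval
  proof eventually_elim
    case (elim t)
    then have t: "t \<in> {a..b}" by auto
    have "s \<longlonglongrightarrow> 0" unfolding s_def using LIMSEQ_Suc[OF lim_1_over_n] by simp
    then have "(\<lambda>n. ((\<lambda>(x, y). L x y t) ((I\<alpha> v t, v t) + s n *\<^sub>R (I\<alpha> h t, h t)) - (\<lambda>(x, y). L x y t) (I\<alpha> v t, v t)) / s n)
      \<longlonglongrightarrow> (\<lambda>(h, k). Lx (I\<alpha> v t) (v t) t \<bullet> h + Ly (I\<alpha> v t) (v t) t \<bullet> k) (I\<alpha> h t, h t)"
      using s by (intro difference_quotients_tendsto[OF L_derivative]) (auto simp: less_imp_neq[symmetric])
    then show ?case unfolding Q_def wt[OF t] by (simp add: along_def)
  qed
  define W where "W = (\<lambda>t. \<bar>along L (w 1) t - along L v t\<bar> + \<bar>along L v t - along L (w (-1)) t\<bar>)"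
  have Wi: "integrable M W"
    unfolding W_def using integrable_along(1)[OF v] integrable_along(1)[OF wL] by simp
  have dom: "AE t in M. norm (Q n t) \<le> W t" for n
    using AE_M_interval
  proof eventually_elim
    case (elim t)
    then have t: "t \<in> {a..b}" by auto
    have e: "along L v t = (\<lambda>(x, y). L x y t) (I\<alpha> v t, v t)" by (simp add: along_def)
    have "Q n t \<le> along L (w 1) t - along L v t" "along L v t - along L (w (-1)) t \<le> Q n t"
      unfolding Q_def wt[OF t] e
      using convex_difference_quotient_bounds[OF L_convex[of t] s(1)[of n] s(2)[of n], of "(I\<alpha> v t, v t)" "(I\<alpha> h t, h t)"]
      by (simp_all only: scaleR_one scaleR_minus1_left add_uminus_conv_diff)
    then show ?case by (simp add: W_def)
  qed
  have m: "(\<lambda>t. along Lx v t \<bullet> I\<alpha> h t + along Ly v t \<bullet> h t) \<in> borel_measurable M" by measurable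
  have Qm: "Q n \<in> borel_measurable M" for n using Qi by (rule borel_measurable_integrable)
  have "(\<lambda>n. \<integral>t. Q n t \<partial>M) \<longlonglongrightarrow> (\<integral>t. along Lx v t \<bullet> I\<alpha> h t + along Ly v t \<bullet> h t \<partial>M)"
    by (rule integral_dominated_convergence[OF m Qm Wi lim dom])
  moreover have "0 \<le> (\<integral>t. Q n t \<partial>M)" for n
  proof -
    have "(\<integral>t. Q n t \<partial>M) = (action (w (s n)) - action v) / s n"
      unfolding Q_def action_def using integrable_along(1)[OF v] integrable_along(1)[OF wL] by simp
    then show ?thesis using min[OF wL] s[of n] by (simp add: less_imp_le)
  qed
  ultimately have "0 \<le> (\<integral>t. along Lx v t \<bullet> I\<alpha> h t + along Ly v t \<bullet> h t \<partial>M)"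
    by (intro LIMSEQ_le_const) auto
  then show ?thesis using integrable_dominated_convergence[OF m Qm Wi lim dom] by simp
qed

text \<open>Equality holds in the first variation because \<open>-h\<close> is admissible as well, and the fractional
  integral is moved from \<open>h\<close> onto \<open>Lx\<close> by parts.\<close>

lemma weak_Euler_Lagrange:
  assumes v: "Lp v" and min: "\<And>w. Lp w \<Longrightarrow> action v \<le> action w"
    and [measurable]: "h \<in> borel_measurable borel" and hB: "\<And>t. norm (h t) \<le> B"
  shows "(\<integral>t. (along Ly v t + frac_int (-1) \<alpha> (along Lx v) t) \<bullet> h t \<partial>M) = 0"
    and "integrable M (\<lambda>t. (along Ly v t + frac_int (-1) \<alpha> (along Lx v) t) \<bullet> h t)"
proof -
  have h: "Lp h" by (rule Lp_bounded[OF _ hB]) measurable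
  have h': "Lp (\<lambda>t. (-1) *\<^sub>R h t)" by (rule Lp_scaleR[OF h])
  define E where "E = (\<lambda>t. along Lx v t \<bullet> I\<alpha> h t + along Ly v t \<bullet> h t)"
  have "I\<alpha> (\<lambda>t. (-1) *\<^sub>R h t) t = - I\<alpha> h t" for t
    by (simp add: frac_int_def)
  then have e': "along Lx v t \<bullet> I\<alpha> (\<lambda>t. (-1) *\<^sub>R h t) t + along Ly v t \<bullet> ((-1) *\<^sub>R h t) = - E t" for t
    by (simp add: E_def)
  have "0 \<le> (\<integral>t. E t \<partial>M)" "integrable M E"
    using first_variation_nonneg[OF v min h] unfolding E_def by auto
  moreover have "0 \<le> (\<integral>t. - E t \<partial>M)"
    using first_variation_nonneg[OF v min h'] unfolding e' by auto
  ultimately have E0: "(\<integral>t. E t \<partial>M) = 0" and Ei: "integrable M E" by auto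
  note bp = frac_int_by_parts[OF \<alpha>_pos _ integrable_along(2)[OF v] _ hB, of 1]
  have i1: "integrable M (\<lambda>t. along Lx v t \<bullet> I\<alpha> h t)" by (rule bp(3)) auto
  have i2: "integrable M (\<lambda>t. frac_int (-1) \<alpha> (along Lx v) t \<bullet> h t)" by (rule bp(2)) auto
  have i3: "integrable M (\<lambda>t. along Ly v t \<bullet> h t)"
    using Bochner_Integration.integrable_diff[OF Ei i1] by (simp add: E_def)
  show "integrable M (\<lambda>t. (along Ly v t + frac_int (-1) \<alpha> (along Lx v) t) \<bullet> h t)"
    unfolding inner_add_left by (rule Bochner_Integration.integrable_add[OF i3 i2])
  have "(\<integral>t. (along Ly v t + frac_int (-1) \<alpha> (along Lx v) t) \<bullet> h t \<partial>M)
      = (\<integral>t. along Ly v t \<bullet> h t \<partial>M) + (\<integral>t. frac_int (-1) \<alpha> (along Lx v) t \<bullet> h t \<partial>M)"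
    unfolding inner_add_left by (rule Bochner_Integration.integral_add[OF i3 i2])
  also have "(\<integral>t. frac_int (-1) \<alpha> (along Lx v) t \<bullet> h t \<partial>M) = (\<integral>t. along Lx v t \<bullet> I\<alpha> h t \<partial>M)"
    by (rule bp(1)[symmetric]) auto
  also have "(\<integral>t. along Ly v t \<bullet> h t \<partial>M) + \<dots> = (\<integral>t. E t \<partial>M)"
    unfolding E_def using i1 i3 by simp
  finally show "(\<integral>t. (along Ly v t + frac_int (-1) \<alpha> (along Lx v) t) \<bullet> h t \<partial>M) = 0" using E0 by simp
qed

lemma Euler_Lagrange_solution:
  obtains v where "Lp v" "AE t in M. along Ly v t = - frac_int (-1) \<alpha> (along Lx v) t"
proof -
  obtain v where v: "Lp v" and min: "\<And>w. Lp w \<Longrightarrow> action v \<le> action w"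
    using minimizer_exists by blast
  note [measurable] = borel_measurable_along[OF Lx_continuous Lp_measurable[OF v]]
    borel_measurable_along[OF Ly_continuous Lp_measurable[OF v]]
  define z where "z = (\<lambda>t. along Ly v t + frac_int (-1) \<alpha> (along Lx v) t)"
  have [measurable]: "z \<in> borel_measurable borel" unfolding z_def by measurable
\<comment> \<open>test the equation with the bounded direction \<open>h = sgn z\<close>, for which \<open>z \<bullet> h = norm z\<close>\<close>
  have m: "(\<lambda>t. sgn (z t)) \<in> borel_measurable borel" unfolding sgn_div_norm by measurable
  have b: "norm (sgn (z t)) \<le> 1" for t by (simp add: norm_sgn)
  have e: "z t \<bullet> sgn (z t) = norm (z t)" for t
    by (cases "z t = 0") (auto simp: sgn_div_norm power2_norm_eq_inner[symmetric] power2_eq_square)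
  have zt: "along Ly v t + frac_int (-1) \<alpha> (along Lx v) t = z t" for t by (simp add: z_def)
  have "(\<integral>t. norm (z t) \<partial>M) = 0" "integrable M (\<lambda>t. norm (z t))"
    using weak_Euler_Lagrange[OF v min m b] unfolding zt e by auto
  then have "AE t in M. norm (z t) = 0"
    using integral_nonneg_eq_0_iff_AE[of M "\<lambda>t. norm (z t)"] by simp
  then have "AE t in M. along Ly v t = - frac_int (-1) \<alpha> (along Lx v) t"
    by eventually_elim (simp add: z_def add_eq_0_iff2)
  then show ?thesis using that v by blast
qed

end

section \<open>Riemann-Liouville derivatives of fractional integrals\<close>

lemma abs_continuous_diff_const: "abs_continuous a b F \<Longrightarrow> abs_continuous a b (\<lambda>t. F t - c)"
  unfolding abs_continuous_def by simp

context bounded_interval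
begin

lemma set_integrable_lebesgueI:
  fixes f g :: "real \<Rightarrow> 'e::euclidean_space"
  assumes g: "integrable M g" and fg: "\<And>t. t \<in> {a<..<b} \<Longrightarrow> f t = g t"
  shows "set_integrable lebesgue {a<..<b} f"
proof -
  have gm: "g \<in> borel_measurable borel" using borel_measurable_integrable[OF g] by simp
  then have i: "set_integrable lborel {a<..<b} g" using g integrable_M by blast
  then have "set_integrable lebesgue {a<..<b} g"
    unfolding set_integrable_def by (subst integrable_completion) auto
  moreover have "set_integrable lebesgue {a<..<b} f = set_integrable lebesgue {a<..<b} g"
    by (rule set_integrable_cong) (use fg in auto)
  ultimately show ?thesis by simp
qed

lemma integral_indicator_left_right:
  fixes g :: "real \<Rightarrow> 'e::euclidean_space"
  assumes g: "integrable M g" and t: "t \<in> {a<..<b}"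
  shows "(\<integral>\<xi>. indicator {0<..} (1 * (t - \<xi>)) *\<^sub>R g \<xi> \<partial>M) = (LINT s:{a<..<t}|lborel. g s)"
    and "(\<integral>\<xi>. indicator {0<..} (- 1 * (t - \<xi>)) *\<^sub>R g \<xi> \<partial>M) = (LINT s:{a<..<b}|lborel. g s) - (LINT s:{a<..<t}|lborel. g s)"
proof -
  have gm[measurable]: "g \<in> borel_measurable borel" using borel_measurable_integrable[OF g] by simp
  then have i: "set_integrable lborel {a<..<b} g" using g integrable_M by blast
  show "(\<integral>\<xi>. indicator {0<..} (1 * (t - \<xi>)) *\<^sub>R g \<xi> \<partial>M) = (LINT s:{a<..<t}|lborel. g s)"
    unfolding set_lebesgue_integral_def
    by (subst integral_M; (measurable)?)
       (use t in \<open>auto simp: set_lebesgue_integral_def indicator_def intro!: Bochner_Integration.integral_cong\<close>)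
  have "(\<integral>\<xi>. indicator {0<..} (- 1 * (t - \<xi>)) *\<^sub>R g \<xi> \<partial>M) = (LINT s:{t<..<b}|lborel. g s)"
    unfolding set_lebesgue_integral_def
    by (subst integral_M; (measurable)?)
       (use t in \<open>auto simp: set_lebesgue_integral_def indicator_def intro!: Bochner_Integration.integral_cong\<close>)
  also have "\<dots> = (LINT s:{a<..<b}|lborel. g s) - (LINT s:{a<..<t}|lborel. g s)"
    using set_integral_Ioo_diff[OF i, of t b] t by auto
  finally show "(\<integral>\<xi>. indicator {0<..} (- 1 * (t - \<xi>)) *\<^sub>R g \<xi> \<partial>M) = (LINT s:{a<..<b}|lborel. g s) - (LINT s:{a<..<t}|lborel. g s)" .
qed

text \<open>By the semigroup law the right integral of order \<open>1 - \<alpha>\<close> of \<open>f\<close> is minus the integral of \<open>g\<close> from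
  \<open>t\<close> to \<open>b\<close>, whose derivative is \<open>g\<close>. The function \<open>f'\<close> is a Borel version of \<open>f\<close>.\<close>

lemma has_RL_deriv_right_frac_int:
  fixes f f' g :: "real \<Rightarrow> 'e::euclidean_space"
  assumes \<alpha>: "0 < \<alpha>" "\<alpha> < 1" and g: "integrable M g" and f': "integrable M f'"
    and ff': "\<And>t. t \<in> {a<..<b} \<Longrightarrow> f t = f' t"
    and f'g: "AE t in M. f' t = - frac_int (-1) \<alpha> g t"
  shows "has_RL_deriv_right a b \<alpha> f (\<lambda>t. - g t)"
  unfolding has_RL_deriv_right_def has_ae_derivative_def
proof (intro conjI exI)
  show "set_integrable lebesgue {a<..<b} f" by (rule set_integrable_lebesgueI[OF f' ff'])
  have gm[measurable]: "g \<in> borel_measurable borel" using borel_measurable_integrable[OF g] by simp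
  have [measurable]: "f' \<in> borel_measurable borel" using borel_measurable_integrable[OF f'] by simp
  have i: "set_integrable lborel {a<..<b} g" using g gm integrable_M by blast
  define c where "c = (LINT s:{a<..<b}|lborel. g s)"
  show "abs_continuous a b (\<lambda>t. (LINT s:{a<..<t}|lborel. g s) - c)"
    by (intro abs_continuous_diff_const abs_continuous_indefinite_integral i gm)
  show "AE t\<in>{a<..<b} in lebesgue. (LINT s:{a<..<t}|lborel. g s) - c = RL_int_right b (1 - \<alpha>) f t"
  proof (intro AE_I2 impI)
    fix t assume t: "t \<in> {a<..<b}"
    have "RL_int_right b (1 - \<alpha>) f t = frac_int (-1) (1 - \<alpha>) f' t"
      by (rule RL_int_eq_frac_int(2)[OF _ ff' t]) auto
    also have "\<dots> = (\<integral>\<xi>. - (RL_kernel (1 - \<alpha>) (-1 * (t - \<xi>)) *\<^sub>R frac_int (-1) \<alpha> g \<xi>) \<partial>M)"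
      unfolding frac_int_def[of "-1" "1 - \<alpha>"]
      by (rule integral_cong_AE) (use f'g in \<open>auto elim: eventually_mono\<close>)
    also have "\<dots> = - frac_int (-1) (1 - \<alpha>) (frac_int (-1) \<alpha> g) t"
      unfolding frac_int_def[of "-1" "1 - \<alpha>"] by (rule Bochner_Integration.integral_minus)
    also have "frac_int (-1) (1 - \<alpha>) (frac_int (-1) \<alpha> g) t = c - (LINT s:{a<..<t}|lborel. g s)"
      using frac_int_semigroup[OF \<alpha> _ g t, of "-1"] integral_indicator_left_right(2)[OF g t] by (simp add: c_def)
    finally show "(LINT s:{a<..<t}|lborel. g s) - c = RL_int_right b (1 - \<alpha>) f t" by simp
  qed
  show "AE t\<in>{a<..<b} in lebesgue. ((\<lambda>t. (LINT s:{a<..<t}|lborel. g s) - c) has_vector_derivative - (- g t)) (at t)"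
    using AE_indefinite_integral_has_vector_derivative[OF i gm]
  proof eventually_elim
    case (elim t)
    then show ?case using has_vector_derivative_diff[OF _ has_vector_derivative_const[of c]] by fastforce
  qed
qed

end

context supercritical_order
begin

lemma has_RL_deriv_left_I\<alpha>:
  assumes v: "Lp v"
  shows "has_RL_deriv_left a b \<alpha> (I\<alpha> v) v"
  unfolding has_RL_deriv_left_def has_ae_derivative_def
proof (intro conjI exI)
  note vm[measurable] = Lp_measurable[OF v]
  note vi = Lp_integrable[OF v]
  have i: "set_integrable lborel {a<..<b} v" using vi vm integrable_M by blast
  have "integrable M (I\<alpha> v)"
  proof (rule integrable_const_bound)
    show "AE t in M. norm (I\<alpha> v t) \<le> ((1 + kernel_bound) powr p * (1 + Lp_int v)) powr (1 / p)"
      using AE_M_interval by eventually_elim (auto intro!: norm_I\<alpha>_le v)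
  qed measurable
  then show "set_integrable lebesgue {a<..<b} (I\<alpha> v)" by (rule set_integrable_lebesgueI) simp
  show "abs_continuous a b (\<lambda>t. LINT s:{a<..<t}|lborel. v s)"
    by (intro abs_continuous_indefinite_integral i vm)
  show "AE t\<in>{a<..<b} in lebesgue. (LINT s:{a<..<t}|lborel. v s) = RL_int_left a (1 - \<alpha>) (I\<alpha> v) t"
  proof (intro AE_I2 impI)
    fix t assume t: "t \<in> {a<..<b}"
    have "RL_int_left a (1 - \<alpha>) (I\<alpha> v) t = frac_int 1 (1 - \<alpha>) (I\<alpha> v) t"
      by (rule RL_int_eq_frac_int(1)[OF _ _ t]) auto
    also have "\<dots> = (LINT s:{a<..<t}|lborel. v s)"
      using frac_int_semigroup[OF \<alpha>_pos \<alpha>(2) _ vi t, of 1] integral_indicator_left_right(1)[OF vi t] by simp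
    finally show "(LINT s:{a<..<t}|lborel. v s) = RL_int_left a (1 - \<alpha>) (I\<alpha> v) t" by simp
  qed
  show "AE t\<in>{a<..<b} in lebesgue. ((\<lambda>t. LINT s:{a<..<t}|lborel. v s) has_vector_derivative v t) (at t)"
    by (rule AE_indefinite_integral_has_vector_derivative[OF i vm])
qed

end

section \<open>The Lagrangian and its gradients\<close>

text \<open>For fixed \<open>t\<close> the spatial slice lies entirely in the domain, so the derivative within the domain
  restricts to a two-sided derivative in \<open>(x, y)\<close>, and its partial gradients inherit the
  continuity of the full derivative.\<close>

lemma C1_on_partial_gradients:
  fixes L :: "'e::euclidean_space \<times> 'e \<times> real \<Rightarrow> real"
  assumes "C1_on (UNIV \<times> UNIV \<times> T) L"
  shows "\<And>x y t. t \<in> T \<Longrightarrow>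
      ((\<lambda>(x, y). L (x, y, t)) has_derivative (\<lambda>(h, k). grad_x L x y t \<bullet> h + grad_y L x y t \<bullet> k)) (at (x, y))"
    and "continuous_on (UNIV \<times> UNIV \<times> T) (\<lambda>(x, y, t). grad_x L x y t)"
    and "continuous_on (UNIV \<times> UNIV \<times> T) (\<lambda>(x, y, t). grad_y L x y t)"
    and "continuous_on (UNIV \<times> UNIV \<times> T) L"
proof -
  define S where "S = (UNIV :: 'e set) \<times> (UNIV :: 'e set) \<times> T"
  obtain f' where f': "\<And>z. z \<in> S \<Longrightarrow> (L has_derivative blinfun_apply (f' z)) (at z within S)"
    and cont: "continuous_on S f'"
    using assms unfolding C1_on_def S_def by blast
  define D where "D = (\<lambda>z. blinfun_apply (f' z))"
  have DL: "(L has_derivative D z) (at z within S)" if "z \<in> S" for z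
    using f'[OF that] by (simp add: D_def)
  have D_lin: "bounded_linear (D z)" for z unfolding D_def by (rule blinfun.bounded_linear_right)
  have D_cont: "continuous_on S (\<lambda>z. D z h)" for h
    unfolding D_def using cont by (intro continuous_intros)
  have lin: "D z (h, 0, 0) = (\<Sum>i\<in>Basis. (h \<bullet> i) * D z (i, 0, 0))"
    "D z (0, h, 0) = (\<Sum>i\<in>Basis. (h \<bullet> i) * D z (0, i, 0))" for z h
  proof -
    have "bounded_linear (\<lambda>h::'e. D z (h, 0, 0))" "bounded_linear (\<lambda>h::'e. D z (0, h, 0))"
      by (intro bounded_linear_compose[OF D_lin]
          bounded_linear_Pair bounded_linear_ident bounded_linear_zero)+
    then have l: "linear (\<lambda>h::'e. D z (h, 0, 0))" "linear (\<lambda>h::'e. D z (0, h, 0))"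
      by (auto dest: bounded_linear.linear)
    show "D z (h, 0, 0) = (\<Sum>i\<in>Basis. (h \<bullet> i) * D z (i, 0, 0))"
      using linear_sum[OF l(1), of "\<lambda>i. (h \<bullet> i) *\<^sub>R i" Basis] linear_cmul[OF l(1)]
      by (simp add: euclidean_representation)
    show "D z (0, h, 0) = (\<Sum>i\<in>Basis. (h \<bullet> i) * D z (0, i, 0))"
      using linear_sum[OF l(2), of "\<lambda>i. (h \<bullet> i) *\<^sub>R i" Basis] linear_cmul[OF l(2)]
      by (simp add: euclidean_representation)
  qed
  have total: "((\<lambda>(x, y). L (x, y, t)) has_derivative (\<lambda>(h, k). D (x, y, t) (h, k, 0))) (at (x, y))"
    if t: "t \<in> T" for x y t
  proof -
    have "((\<lambda>z. (fst z, snd z, t)) has_derivative (\<lambda>z. (fst z, snd z, 0))) (at (x, y) within UNIV)"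
      by (auto intro!: derivative_eq_intros)
    moreover have "(L has_derivative D (x, y, t)) (at ((\<lambda>z. (fst z, snd z, t)) (x, y)) within range (\<lambda>z. (fst z, snd z, t)))"
      using has_derivative_subset[OF DL[of "(x, y, t)"], of "range (\<lambda>z. (fst z, snd z, t))"] t by (auto simp: S_def)
    ultimately have "(L \<circ> (\<lambda>z. (fst z, snd z, t)) has_derivative D (x, y, t) \<circ> (\<lambda>z. (fst z, snd z, 0))) (at (x, y) within UNIV)"
      by (rule diff_chain_within)
    then show ?thesis by (simp add: o_def case_prod_beta')
  qed
  have gx: "grad_x L x y t = (\<Sum>i\<in>Basis. D (x, y, t) (i, 0, 0) *\<^sub>R i)" if t: "t \<in> T" for x y t
    unfolding grad_x_def
  proof (rule grad_eqI)
    have "((\<lambda>\<xi>. (\<xi>, y)) has_derivative (\<lambda>h. (h, 0))) (at x)" by (auto intro!: derivative_eq_intros)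
    from diff_chain_at[OF this total[OF t]]
    have "((\<lambda>\<xi>. L (\<xi>, y, t)) has_derivative (\<lambda>h. D (x, y, t) (h, 0, 0))) (at x)" by (simp add: o_def)
    moreover have "(\<lambda>h. D (x, y, t) (h, 0, 0)) = (\<lambda>h. h \<bullet> (\<Sum>i\<in>Basis. D (x, y, t) (i, 0, 0) *\<^sub>R i))"
    proof (rule ext)
      fix h
      have "D (x, y, t) (h, 0, 0) = (\<Sum>i\<in>Basis. (h \<bullet> i) * D (x, y, t) (i, 0, 0))" by (rule lin)
      also have "\<dots> = h \<bullet> (\<Sum>i\<in>Basis. D (x, y, t) (i, 0, 0) *\<^sub>R i)"
        unfolding inner_sum_right inner_scaleR_right by (intro sum.cong refl mult.commute)
      finally show "D (x, y, t) (h, 0, 0) = h \<bullet> (\<Sum>i\<in>Basis. D (x, y, t) (i, 0, 0) *\<^sub>R i)" .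
    qed
    ultimately show "GDERIV (\<lambda>\<xi>. L (\<xi>, y, t)) x :> (\<Sum>i\<in>Basis. D (x, y, t) (i, 0, 0) *\<^sub>R i)"
      unfolding gderiv_def by (rule has_derivative_eq_rhs)
  qed
  have gy: "grad_y L x y t = (\<Sum>i\<in>Basis. D (x, y, t) (0, i, 0) *\<^sub>R i)" if t: "t \<in> T" for x y t
    unfolding grad_y_def
  proof (rule grad_eqI)
    have "((\<lambda>\<eta>. (x, \<eta>)) has_derivative (\<lambda>h. (0, h))) (at y)" by (auto intro!: derivative_eq_intros)
    from diff_chain_at[OF this total[OF t]]
    have "((\<lambda>\<eta>. L (x, \<eta>, t)) has_derivative (\<lambda>h. D (x, y, t) (0, h, 0))) (at y)" by (simp add: o_def)
    moreover have "(\<lambda>h. D (x, y, t) (0, h, 0)) = (\<lambda>h. h \<bullet> (\<Sum>i\<in>Basis. D (x, y, t) (0, i, 0) *\<^sub>R i))"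
    proof (rule ext)
      fix h
      have "D (x, y, t) (0, h, 0) = (\<Sum>i\<in>Basis. (h \<bullet> i) * D (x, y, t) (0, i, 0))" by (rule lin)
      also have "\<dots> = h \<bullet> (\<Sum>i\<in>Basis. D (x, y, t) (0, i, 0) *\<^sub>R i)"
        unfolding inner_sum_right inner_scaleR_right by (intro sum.cong refl mult.commute)
      finally show "D (x, y, t) (0, h, 0) = h \<bullet> (\<Sum>i\<in>Basis. D (x, y, t) (0, i, 0) *\<^sub>R i)" .
    qed
    ultimately show "GDERIV (\<lambda>\<eta>. L (x, \<eta>, t)) y :> (\<Sum>i\<in>Basis. D (x, y, t) (0, i, 0) *\<^sub>R i)"
      unfolding gderiv_def by (rule has_derivative_eq_rhs)
  qed
  show "((\<lambda>(x, y). L (x, y, t)) has_derivative (\<lambda>(h, k). grad_x L x y t \<bullet> h + grad_y L x y t \<bullet> k)) (at (x, y))"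
    if t: "t \<in> T" for x y t
  proof -
    have "D (x, y, t) (h, k, 0) = grad_x L x y t \<bullet> h + grad_y L x y t \<bullet> k" for h k
    proof -
      have "D (x, y, t) (h, k, 0) = D (x, y, t) (h, 0, 0) + D (x, y, t) (0, k, 0)"
        by (simp flip: bounded_linear.linear[OF D_lin, THEN linear_add])
      also have "\<dots> = (\<Sum>i\<in>Basis. (h \<bullet> i) * D (x, y, t) (i, 0, 0)) + (\<Sum>i\<in>Basis. (k \<bullet> i) * D (x, y, t) (0, i, 0))"
        by (intro arg_cong2[where f = plus] lin)
      also have "\<dots> = grad_x L x y t \<bullet> h + grad_y L x y t \<bullet> k"
        unfolding gx[OF t] gy[OF t] inner_sum_left inner_scaleR_left
        by (intro arg_cong2[where f = plus] sum.cong refl) (simp_all add: inner_commute mult.commute)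
      finally show ?thesis .
    qed
    then show ?thesis using total[OF t, of x y] by simp
  qed
  have "continuous_on S (\<lambda>z. \<Sum>i\<in>Basis. D z (i, 0, 0) *\<^sub>R i)" "continuous_on S (\<lambda>z. \<Sum>i\<in>Basis. D z (0, i, 0) *\<^sub>R i)"
    by (intro continuous_on_sum continuous_on_scaleR D_cont continuous_on_const)+
  moreover have "(case z of (x, y, t) \<Rightarrow> grad_x L x y t) = (\<Sum>i\<in>Basis. D z (i, 0, 0) *\<^sub>R i)"
    "(case z of (x, y, t) \<Rightarrow> grad_y L x y t) = (\<Sum>i\<in>Basis. D z (0, i, 0) *\<^sub>R i)" if "z \<in> S" for z
    using that by (auto simp: S_def gx gy)
  ultimately show "continuous_on (UNIV \<times> UNIV \<times> T) (\<lambda>(x, y, t). grad_x L x y t)"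
    "continuous_on (UNIV \<times> UNIV \<times> T) (\<lambda>(x, y, t). grad_y L x y t)"
    unfolding S_def[symmetric] by (metis (no_types, lifting) continuous_on_cong)+
  show "continuous_on (UNIV \<times> UNIV \<times> T) L"
    using f' unfolding S_def by (meson has_derivative_continuous_on)
qed

lemma rpow_le_one_plus_powr:
  assumes "0 \<le> s" "0 \<le> e" "e \<le> p"
  shows "rpow s e \<le> 1 + s powr p"
  using powr_le_one_plus_powr[OF assms] by (auto simp: rpow_def)

lemma bounded_on_cylinder:
  fixes r :: "'e::euclidean_space \<times> real \<Rightarrow> real"
  assumes "continuous_on (UNIV \<times> {a..b}) r"
  obtains B where "0 \<le> B" "\<And>x t. norm x \<le> R \<Longrightarrow> t \<in> {a..b} \<Longrightarrow> \<bar>r (x, t)\<bar> \<le> B"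
proof -
  have "compact (r ` (cball 0 R \<times> {a..b}))"
    by (intro compact_continuous_image compact_Times continuous_on_subset[OF assms]) auto
  then obtain B where B: "\<And>z. z \<in> cball 0 R \<times> {a..b} \<Longrightarrow> norm (r z) \<le> B"
    by (meson compact_imp_bounded bounded_iff imageI)
  show ?thesis
  proof
    show "0 \<le> max B 0" by simp
    show "\<bar>r (x, t)\<bar> \<le> max B 0" if "norm x \<le> R" "t \<in> {a..b}" for x t
      using B[of "(x, t)"] that by auto
  qed
qed

text \<open>The coefficients \<open>r\<close> and \<open>s\<close> are bounded on the compact set where \<open>norm x \<le> R\<close>, which turns
  bounds with variable coefficients into the growth condition of the locale \<open>convex_lagrangian\<close>.\<close>

lemma growth_bound_on_cylinder:
  fixes F :: "'e::euclidean_space \<Rightarrow> 'e \<Rightarrow> real \<Rightarrow> 'x::real_normed_vector"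
  assumes e: "0 \<le> e" "e \<le> p"
    and r: "continuous_on (UNIV \<times> {a..b}) r" and s: "continuous_on (UNIV \<times> {a..b}) s"
    and F: "\<And>x y t. t \<in> {a..b} \<Longrightarrow> norm (F x y t) \<le> r (x, t) * rpow (norm y) e + s (x, t)"
  obtains B where "\<And>x y t. norm x \<le> R \<Longrightarrow> t \<in> {a..b} \<Longrightarrow> norm (F x y t) \<le> B * (1 + norm y powr p)"
proof -
  obtain B where B: "0 \<le> B" "\<And>x t. norm x \<le> R \<Longrightarrow> t \<in> {a..b} \<Longrightarrow> \<bar>r (x, t)\<bar> \<le> B"
    using bounded_on_cylinder[OF r] by blast
  obtain B' where B': "0 \<le> B'" "\<And>x t. norm x \<le> R \<Longrightarrow> t \<in> {a..b} \<Longrightarrow> \<bar>s (x, t)\<bar> \<le> B'"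
    using bounded_on_cylinder[OF s] by blast
  show ?thesis
  proof
    fix x y :: 'e and t assume xt: "norm x \<le> R" "t \<in> {a..b}"
    have "r (x, t) * rpow (norm y) e \<le> B * (1 + norm y powr p)"
      using B(1) B(2)[of x t] xt e rpow_le_one_plus_powr[of "norm y" e p]
      by (intro mult_mono) (auto simp: rpow_def)
    moreover have "s (x, t) \<le> B' * (1 + norm y powr p)"
    proof -
      have "s (x, t) \<le> B'" using B'(2)[OF xt] by simp
      also have "\<dots> \<le> B' * (1 + norm y powr p)" using B'(1) by (simp add: distrib_left)
      finally show ?thesis .
    qed
    ultimately show "norm (F x y t) \<le> (B + B') * (1 + norm y powr p)"
      using F[OF xt(2), of x y] by (simp add: algebra_simps)
  qed
qed

section \<open>Existence of a weak solution\<close>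

theorem theorem1:
  fixes a b \<alpha> p :: real
    and L :: "(real ^ 'n) \<times> (real ^ 'n) \<times> real \<Rightarrow> real"
  assumes "a < b"
    and "0 < 1 / p" and "1 / p < \<alpha>" and "\<alpha> < 1"
    and "C1_on (UNIV \<times> UNIV \<times> {a..b}) L"
    and "\<exists>d1 r1 s1. 0 \<le> d1 \<and> d1 \<le> p \<and>
           continuous_on (UNIV \<times> {a..b}) r1 \<and> continuous_on (UNIV \<times> {a..b}) s1 \<and>
           (\<forall>x. \<forall>t\<in>{a..b}. 0 \<le> r1 (x, t) \<and> 0 \<le> s1 (x, t)) \<and>
           (\<forall>x y. \<forall>t\<in>{a..b}.
              \<bar>L (x, y, t) - L (x, 0, t)\<bar> \<le> r1 (x, t) * rpow (norm y) d1 + s1 (x, t))"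
    and "\<exists>d2 r2 s2. 0 \<le> d2 \<and> d2 \<le> p \<and>
           continuous_on (UNIV \<times> {a..b}) r2 \<and> continuous_on (UNIV \<times> {a..b}) s2 \<and>
           (\<forall>x. \<forall>t\<in>{a..b}. 0 \<le> r2 (x, t) \<and> 0 \<le> s2 (x, t)) \<and>
           (\<forall>x y. \<forall>t\<in>{a..b}.
              norm (grad_x L x y t) \<le> r2 (x, t) * rpow (norm y) d2 + s2 (x, t))"
    and "\<exists>d3 r3 s3. 0 \<le> d3 \<and> d3 \<le> p - 1 \<and>
           continuous_on (UNIV \<times> {a..b}) r3 \<and> continuous_on (UNIV \<times> {a..b}) s3 \<and>
           (\<forall>x. \<forall>t\<in>{a..b}. 0 \<le> r3 (x, t) \<and> 0 \<le> s3 (x, t)) \<and>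
           (\<forall>x y. \<forall>t\<in>{a..b}.
              norm (grad_y L x y t) \<le> r3 (x, t) * rpow (norm y) d3 + s3 (x, t))"
    and "\<exists>\<gamma> d4 c1 c2 c3. 0 < \<gamma> \<and> 1 \<le> d4 \<and> d4 < p \<and>
           continuous_on (UNIV \<times> {a..b}) c1 \<and>
           (\<forall>x. \<forall>t\<in>{a..b}. \<gamma> \<le> c1 (x, t)) \<and>
           continuous_on {a..b} c2 \<and> continuous_on {a..b} c3 \<and>
           (\<forall>x y. \<forall>t\<in>{a..b}.
              c1 (x, t) * rpow (norm y) p + c2 t * rpow (norm x) d4 + c3 t \<le> L (x, y, t))"
    and "\<forall>t\<in>{a..b}. convex_on UNIV (\<lambda>(x, y). L (x, y, t))"
  shows "\<exists>u. weak_solution a b \<alpha> L u"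
proof -
  have p_pos: "p > 0" using assms(2) by simp
  have "1 / p < 1" using assms(3,4) by linarith
  then have p1: "1 < p" using p_pos by simp
  define q where "q = p / (p - 1)"
  have pq: "1 / p + 1 / q = 1" using p1 by (simp add: q_def field_simps)
  define clamp where "clamp = (\<lambda>t. max a (min t b))"
  have clamp: "clamp t \<in> {a..b}" for t using assms(1) by (auto simp: clamp_def)
  have clamp_id: "clamp t = t" if "t \<in> {a..b}" for t using that by (auto simp: clamp_def)
  \<comment> \<open>Freezing the time outside \<open>{a..b}\<close> makes the Lagrangian continuous on the whole space.\<close>
  have clamp_cont: "continuous_on UNIV (\<lambda>(x, y, t). G x y (clamp t))"
    if "continuous_on (UNIV \<times> UNIV \<times> {a..b}) (\<lambda>(x, y, t). G x y t)"
    for G :: "real^'n \<Rightarrow> real^'n \<Rightarrow> real \<Rightarrow> 'x::topological_space"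
  proof -
    have "continuous_on UNIV (\<lambda>z. (\<lambda>(x, y, t). G x y t) (fst z, fst (snd z), clamp (snd (snd z))))"
      by (rule continuous_on_compose2[OF that])
         (use clamp in \<open>auto simp: clamp_def intro!: continuous_intros\<close>)
    then show ?thesis by (simp add: case_prod_beta')
  qed
  note grads = C1_on_partial_gradients[OF assms(5)]
  obtain d1 r1 s1 where 1: "0 \<le> d1" "d1 \<le> p" "continuous_on (UNIV \<times> {a..b}) r1" "continuous_on (UNIV \<times> {a..b}) s1"
    "\<And>x y t. t \<in> {a..b} \<Longrightarrow> \<bar>L (x, y, t) - L (x, 0, t)\<bar> \<le> r1 (x, t) * rpow (norm y) d1 + s1 (x, t)"
    using assms(6) by blast
  obtain d2 r2 s2 where 2: "0 \<le> d2" "d2 \<le> p" "continuous_on (UNIV \<times> {a..b}) r2" "continuous_on (UNIV \<times> {a..b}) s2"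
    "\<And>x y t. t \<in> {a..b} \<Longrightarrow> norm (grad_x L x y t) \<le> r2 (x, t) * rpow (norm y) d2 + s2 (x, t)"
    using assms(7) by blast
  obtain d3 r3 s3 where 3: "0 \<le> d3" "d3 \<le> p - 1" "continuous_on (UNIV \<times> {a..b}) r3" "continuous_on (UNIV \<times> {a..b}) s3"
    "\<And>x y t. t \<in> {a..b} \<Longrightarrow> norm (grad_y L x y t) \<le> r3 (x, t) * rpow (norm y) d3 + s3 (x, t)"
    using assms(8) by blast
  obtain \<gamma> d4 c1 c2 c3 where 4: "0 < \<gamma>" "1 \<le> d4" "d4 < p" "\<And>x t. t \<in> {a..b} \<Longrightarrow> \<gamma> \<le> c1 (x, t)"
    "continuous_on {a..b} c2" "continuous_on {a..b} c3"
    "\<And>x y t. t \<in> {a..b} \<Longrightarrow> c1 (x, t) * rpow (norm y) p + c2 t * rpow (norm x) d4 + c3 t \<le> L (x, y, t)"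
    using assms(9) by blast
  have "bounded (c2 ` {a..b})" "bounded (c3 ` {a..b})"
    using 4 by (auto intro!: compact_imp_bounded compact_continuous_image)
  then obtain C2 C3 where C23: "\<And>t. t \<in> {a..b} \<Longrightarrow> \<bar>c2 t\<bar> \<le> C2" "\<And>t. t \<in> {a..b} \<Longrightarrow> \<bar>c3 t\<bar> \<le> C3"
    unfolding bounded_iff by (metis imageI real_norm_def)
  define C where "C = max C2 (max C3 0)"
\<comment> \<open>bounds \<open>L\<close> itself, where hypothesis \<open>assms(6)\<close> bounds \<open>L (x, y, t) - L (x, 0, t)\<close>\<close>
  have s1': "continuous_on (UNIV \<times> {a..b}) (\<lambda>(x, t). s1 (x, t) + \<bar>L (x, 0, t)\<bar>)"
  proof -
    have "continuous_on (UNIV \<times> {a..b}) (\<lambda>z. L (fst z, 0, snd z))"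
      by (rule continuous_on_compose2[OF grads(4)]) (auto intro!: continuous_intros)
    then have "continuous_on (UNIV \<times> {a..b}) (\<lambda>z. s1 z + \<bar>L (fst z, 0, snd z)\<bar>)"
      using 1(4) by (intro continuous_intros)
    then show ?thesis by (simp add: case_prod_beta')
  qed
  interpret convex_lagrangian a b \<alpha> p q "\<lambda>x y t. L (x, y, clamp t)"
    "\<lambda>x y t. grad_x L x y (clamp t)" "\<lambda>x y t. grad_y L x y (clamp t)" \<gamma> d4 C
  proof
    show "a < b" "1 < p" "1 / p + 1 / q = 1" "1 / p < \<alpha>" "\<alpha> < 1" "0 < \<gamma>" "d4 < p" "0 \<le> d4" "0 \<le> C"
      using assms(1,3,4) p1 pq 4 by (auto simp: C_def)
    show "continuous_on UNIV (\<lambda>(x, y, t). L (x, y, clamp t))"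
      using clamp_cont[of "\<lambda>x y t. L (x, y, t)"] grads(4) by simp
    show "continuous_on UNIV (\<lambda>(x, y, t). grad_x L x y (clamp t))"
      "continuous_on UNIV (\<lambda>(x, y, t). grad_y L x y (clamp t))"
      by (intro clamp_cont grads)+
    show "((\<lambda>(x, y). L (x, y, clamp t)) has_derivative
        (\<lambda>(h, k). grad_x L x y (clamp t) \<bullet> h + grad_y L x y (clamp t) \<bullet> k)) (at (x, y))" for x y t
      by (rule grads(1)[OF clamp])
    show "convex_on UNIV (\<lambda>(x, y). L (x, y, clamp t))" for t
      using assms(10) clamp by blast
    show "\<exists>B. \<forall>x y t. norm x \<le> R \<longrightarrow> \<bar>L (x, y, clamp t)\<bar> \<le> B * (1 + norm y powr p)
        \<and> norm (grad_x L x y (clamp t)) \<le> B * (1 + norm y powr p)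
        \<and> norm (grad_y L x y (clamp t)) \<le> B * (1 + norm y powr p)" for R
    proof -
      have "norm (L (x, y, t)) \<le> r1 (x, t) * rpow (norm y) d1 + (\<lambda>(x, t). s1 (x, t) + \<bar>L (x, 0, t)\<bar>) (x, t)"
        if "t \<in> {a..b}" for x y t using 1(5)[OF that, of x y] by simp
      then obtain B1 where B1: "\<And>x y t. norm x \<le> R \<Longrightarrow> t \<in> {a..b} \<Longrightarrow> norm (L (x, y, t)) \<le> B1 * (1 + norm y powr p)"
        using growth_bound_on_cylinder[OF 1(1,2,3) s1', of "\<lambda>x y t. L (x, y, t)" R] by blast
      obtain B2 where B2: "\<And>x y t. norm x \<le> R \<Longrightarrow> t \<in> {a..b} \<Longrightarrow> norm (grad_x L x y t) \<le> B2 * (1 + norm y powr p)"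
        using growth_bound_on_cylinder[OF 2, of R] by blast
      have "d3 \<le> p" using 3(2) by simp
      then obtain B3 where B3: "\<And>x y t. norm x \<le> R \<Longrightarrow> t \<in> {a..b} \<Longrightarrow> norm (grad_y L x y t) \<le> B3 * (1 + norm y powr p)"
        using growth_bound_on_cylinder[OF 3(1) _ 3(3,4,5), of p R] by blast
      define B where "B = max B1 (max B2 B3)"
      have le: "A * (1 + norm y powr p) \<le> B * (1 + norm y powr p)" if "A \<le> B" for A and y :: "real^'n"
        using that by (intro mult_right_mono add_nonneg_nonneg) simp_all
      have B: "B1 \<le> B" "B2 \<le> B" "B3 \<le> B" by (simp_all add: B_def)
      show ?thesis
      proof (intro exI[of _ B] allI impI conjI)
        fix x y :: "real^'n" and t assume x: "norm x \<le> R"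
        show "\<bar>L (x, y, clamp t)\<bar> \<le> B * (1 + norm y powr p)"
          using order_trans[OF B1[OF x clamp] le[OF B(1)]] by simp
        show "norm (grad_x L x y (clamp t)) \<le> B * (1 + norm y powr p)"
          by (rule order_trans[OF B2[OF x clamp] le[OF B(2)]])
        show "norm (grad_y L x y (clamp t)) \<le> B * (1 + norm y powr p)"
          by (rule order_trans[OF B3[OF x clamp] le[OF B(3)]])
      qed
    qed
    show "\<gamma> * norm y powr p \<le> L (x, y, clamp t) + C * norm x powr d4 + C" for x y t
    proof -
      have "\<gamma> * norm y powr p \<le> c1 (x, clamp t) * norm y powr p"
        using 4(4)[OF clamp] by (intro mult_right_mono) auto
      moreover have "- (C * norm x powr d4) \<le> c2 (clamp t) * norm x powr d4"
      proof -
        have "- C \<le> c2 (clamp t)" using C23(1)[OF clamp, of t] by (auto simp: C_def)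
        then have "(- C) * norm x powr d4 \<le> c2 (clamp t) * norm x powr d4" by (rule mult_right_mono) simp
        then show ?thesis by simp
      qed
      moreover have "- C \<le> c3 (clamp t)" using C23(2)[OF clamp, of t] by (auto simp: C_def)
      moreover have "c1 (x, clamp t) * norm y powr p + c2 (clamp t) * norm x powr d4 + c3 (clamp t) \<le> L (x, y, clamp t)"
        using 4(7)[OF clamp, of x t y] 4(2) p1 by (simp add: rpow_def)
      ultimately show ?thesis by linarith
    qed
  qed
  obtain v where v: "Lp v"
    and EL: "AE t in M. along (\<lambda>x y t. grad_y L x y (clamp t)) v t
      = - frac_int (-1) \<alpha> (along (\<lambda>x y t. grad_x L x y (clamp t)) v) t"
    using Euler_Lagrange_solution by blast
  have "has_RL_deriv_right a b \<alpha> (\<lambda>t. grad_y L (I\<alpha> v t) (v t) t)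
      (\<lambda>t. - along (\<lambda>x y t. grad_x L x y (clamp t)) v t)"
    by (rule has_RL_deriv_right_frac_int[OF \<alpha>_pos \<alpha>(2) integrable_along(2,3)[OF v] _ EL])
       (auto simp: along_def clamp_id)
  moreover have "AE t\<in>{a..b} in lebesgue.
      grad_x L (I\<alpha> v t) (v t) t + - along (\<lambda>x y t. grad_x L x y (clamp t)) v t = 0"
    by (intro AE_I2 impI) (simp add: along_def clamp_id)
  ultimately have "weak_solution a b \<alpha> L (I\<alpha> v)"
    unfolding weak_solution_def using continuous_on_I\<alpha>[OF v] has_RL_deriv_left_I\<alpha>[OF v] by blast
  then show ?thesis by blast
qed

end
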